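(* Let $\Omega$ be an open connected bounded polygonal domain of $\mathbb{R}^2$ and let $\Gamma^0$ be a part of the boundary $\partial\Omega$ such that $\mathrm{m}(\Gamma^0)>0$. Let $p,q$ be real numbers such that either $1\le p<2$ and $1\le q\le p^*=\frac{2p}{2-p}$, or $p\ge 2$ and $1\le q<+\infty$. Then there exists a constant $C>0$ depending only on $p$, $q$, $\Gamma^0$ and $\Omega$ such that, for every DDFV mesh $\mathcal{T}=(\overline{\mathfrak{M}},\overline{\mathfrak{M}^*},\mathfrak{D})$ of $\Omega$ compatible with $\Gamma^0$ and satisfying the regularity conditions (R1) with parameter $\alpha_{\mathcal{T}}$ and (R2) with parameter $\zeta$ (defined in the context), $$\|u\|_{0,q,\mathcal{T}}\le \frac{C}{(\sin\alpha_{\mathcal{T}})^{1/p}\,\zeta^{(p-1)/p}}\,|u|_{1,p,\mathcal{T}}\qquad\text{for all }u\in Z_{\Gamma^0}(\mathcal{T}).$$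
   Context: Standing assumption: $\Omega$ is a Lipschitz domain. $\mathrm{m}$ denotes area (2D Lebesgue measure) or length. DDFV mesh. The interior primal mesh $\mathfrak{M}$ is a finite partition of $\Omega$ (up to a null set) into disjoint open polygonal control volumes $\mathcal{K}$, each with a center $x_{\mathcal{K}}\in\mathcal{K}$. $\partial\mathfrak{M}$ is the set of boundary edges, considered as degenerate control volumes, each with a center $x_{\mathcal{K}}$ on the edge. The primal mesh is $\overline{\mathfrak{M}}=\mathfrak{M}\cup\partial\mathfrak{M}$. The dual mesh $\overline{\mathfrak{M}^*}$ is obtained by connecting the centers of the primal mesh: to each vertex $x_{\mathcal{K}^*}$ of the primal mesh is associated the polygonal dual cell $\mathcal{K}^*$ around it whose vertices are the centers $x_{\mathcal{K}}$ of the $\mathcal{K}\in\overline{\mathfrak{M}}$ having $x_{\mathcal{K}^*}$ as a vertex (together with $x_{\mathcal{K}^*}$ itself when $x_{\mathcal{K}^*}\in\partial\Omega$). $\mathfrak{M}^*$ (resp. $\partial\mathfrak{M}^*$) is the set of dual cells whose vertex $x_{\mathcal{K}^*}$ is interior to $\Omega$ (resp. on $\partial\Omega$), and $\overline{\mathfrak{M}^*}=\mathfrak{M}^*\cup\partial\mathfrak{M}^*$ is also a partition of $\Omega$. Each primal cell $\mathcal{K}\in\mathfrak{M}$ is assumed star-shaped with respect to $x_{\mathcal{K}}$ and each dual cell $\mathcal{K}^*$ star-shaped with respect to $x_{\mathcal{K}^*}$. To each primal edge $\sigma=\mathcal{K}|\mathcal{L}$ (with endpoints $x_{\mathcal{K}^*},x_{\mathcal{L}^*}$;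 if $\sigma\subset\partial\Omega$, $\mathcal{L}\in\partial\mathfrak{M}$ is the degenerate volume $\sigma$) corresponds the dual edge $\sigma^*=\mathcal{K}^*|\mathcal{L}^*$, the segment joining $x_{\mathcal{K}}$ and $x_{\mathcal{L}}$. The diamond $\mathcal{D}=\mathcal{D}_{\sigma,\sigma^*}$ is the quadrilateral with diagonals $\sigma$ and $\sigma^*$, i.e. with vertices $x_{\mathcal{K}},x_{\mathcal{K}^*},x_{\mathcal{L}},x_{\mathcal{L}^*}$ (degenerating into a triangle if $\sigma\subset\partial\Omega$). The set $\mathfrak{D}$ of diamonds is a partition of $\Omega$. For $V$ a primal or dual cell, $\mathfrak{D}_V$ is the set of diamonds $\mathcal{D}_{\sigma,\sigma^*}$ such that $\sigma$ (if $V$ is primal) or $\sigma^*$ (if $V$ is dual) is an edge of $V$. $\alpha_{\mathcal{D}}$ is the angle between the lines $(x_{\mathcal{K}},x_{\mathcal{L}})$ and $(x_{\mathcal{K}^*},x_{\mathcal{L}^*})$, so $2\mathrm{m}(\mathcal{D})=\mathrm{m}(\sigma)\mathrm{m}(\sigma^* )\sin\alpha_{\mathcal{D}}$. The mesh is compatible with $\Gamma^0$ if $\Gamma^0$ is, up to a set of zero length, the union of the boundary edges $\mathcal{K}\in\partial\mathfrak{M}$ with $\mathcal{K}\subset\Gamma^0$. Regularity conditions. (R1): $\alpha_{\mathcal{T}}\in(0,\pi/2]$ and $|\sin\alpha_{\mathcal{D}}|\ge\sin\alpha_{\mathcal{T}}$ for all $\mathcal{D}\in\mathfrak{D}$. (R2):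 $\zeta>0$, $\sum_{\mathcal{D}_{\sigma,\sigma^*}\in\mathfrak{D}_{\mathcal{K}}}\mathrm{m}(\sigma)\mathrm{m}(\sigma^* )\le \mathrm{m}(\mathcal{K})/\zeta$ for all $\mathcal{K}\in\mathfrak{M}$, and $\sum_{\mathcal{D}_{\sigma,\sigma^*}\in\mathfrak{D}_{\mathcal{K}^*}}\mathrm{m}(\sigma)\mathrm{m}(\sigma^* )\le \mathrm{m}(\mathcal{K}^* )/\zeta$ for all $\mathcal{K}^*\in\overline{\mathfrak{M}^*}$. Discrete functions. $Z(\mathcal{T})$ is the set of functions $u=\frac12(u_{\mathfrak{M}}+u_{\overline{\mathfrak{M}^*}})$ with $u_{\mathfrak{M}}=\sum_{\mathcal{K}\in\mathfrak{M}}u_{\mathcal{K}}\mathbf{1}_{\mathcal{K}}$ and $u_{\overline{\mathfrak{M}^*}}=\sum_{\mathcal{K}^*\in\overline{\mathfrak{M}^*}}u_{\mathcal{K}^*}\mathbf{1}_{\mathcal{K}^*}$, where $u_{\mathcal{T}}=((u_{\mathcal{K}})_{\mathcal{K}\in\overline{\mathfrak{M}}},(u_{\mathcal{K}^*})_{\mathcal{K}^*\in\overline{\mathfrak{M}^*}})$ are real discrete unknowns; $u$ is understood as given together with $u_{\mathcal{T}}$, and the quantities below are computed from $u_{\mathcal{T}}$. $Z_{\Gamma^0}(\mathcal{T})$ is the set of $u\in Z(\mathcal{T})$ such that $u_{\mathcal{K}}=0$ for all $\mathcal{K}\in\partial\mathfrak{M}$ with $\mathcal{K}\subset\Gamma^0$,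 and $u_{\mathcal{K}^*}=0$ for all $\mathcal{K}^*\in\partial\mathfrak{M}^*$ with $\overline{\mathcal{K}^*}\cap\Gamma^0\ne\emptyset$. For $p\in[1,\infty)$, $$\|u\|_{0,p,\mathcal{T}}^p=\tfrac12\|u_{\mathfrak{M}}\|_{L^p(\Omega)}^p+\tfrac12\|u_{\overline{\mathfrak{M}^*}}\|_{L^p(\Omega)}^p.$$ For $\mathcal{D}=\mathcal{D}_{\sigma,\sigma^*}\in\mathfrak{D}$ the discrete gradient is $$\nabla^{\mathcal{D}}u=\frac{1}{\sin\alpha_{\mathcal{D}}}\Big(\frac{u_{\mathcal{L}}-u_{\mathcal{K}}}{\mathrm{m}(\sigma^* )}\mathbf{n}_{\sigma\mathcal{K}}+\frac{u_{\mathcal{L}^*}-u_{\mathcal{K}^*}}{\mathrm{m}(\sigma)}\mathbf{n}_{\sigma^*\mathcal{K}^*}\Big),$$ where $\mathbf{n}_{\sigma\mathcal{K}}$ is the unit normal to $\sigma$ outward $\mathcal{K}$ and $\mathbf{n}_{\sigma^*\mathcal{K}^*}$ the unit normal to $\sigma^*$ outward $\mathcal{K}^*$; equivalently, its component along the unit vector from $x_{\mathcal{K}}$ to $x_{\mathcal{L}}$ is $(u_{\mathcal{L}}-u_{\mathcal{K}})/\mathrm{m}(\sigma^* )$ and its component along the unit vector from $x_{\mathcal{K}^*}$ to $x_{\mathcal{L}^*}$ is $(u_{\mathcal{L}^*}-u_{\mathcal{K}^*})/\mathrm{m}(\sigma)$. Finally $$|u|_{1,p,\mathcal{T}}=\Big(\sum_{\mathcal{D}\in\mathfrak{D}}\mathrm{m}(\mathcal{D})|\nabla^{\mathcal{D}}u|^p\Big)^{1/p}.$$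 *)

theory Defs
  imports "HOL-Analysis.Analysis"
begin

type_synonym point = "real^2"

section \<open>Plane geometry\<close>

definition rot90 :: "point \<Rightarrow> point" where
  "rot90 v = vector [- (v $ 2), v $ 1]"

definition line_angle :: "point \<Rightarrow> point \<Rightarrow> real" where
  "line_angle v w = arccos (\<bar>v \<bullet> w\<bar> / (norm v * norm w))"

text \<open>
  The unit normal to the segment from \<open>a\<close> to \<open>b\<close> that points away from the point \<open>c\<close>
  (\<open>0\<close> if \<open>a\<close>, \<open>b\<close>, \<open>c\<close> are collinear).
\<close>
definition normal_away :: "point \<Rightarrow> point \<Rightarrow> point \<Rightarrow> point" where
  "normal_away a b c = sgn (rot90 (b - a) \<bullet> (a - c)) *\<^sub>R sgn (rot90 (b - a))"

definition star_shaped_at :: "point \<Rightarrow> point set \<Rightarrow> bool" where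
  "star_shaped_at a S \<longleftrightarrow> a \<in> S \<and> (\<forall>x\<in>S. closed_segment a x \<subseteq> S)"

text \<open>
  One-dimensional Hausdorff (outer) measure, normalised so that a segment has its usual length.
\<close>
definition length_measure :: "point set \<Rightarrow> ennreal" where
  "length_measure A =
     (SUP \<delta>\<in>{0<..}. INF U\<in>{U :: nat \<Rightarrow> point set.
          A \<subseteq> (\<Union>n. U n) \<and> (\<forall>n. bounded (U n) \<and> diameter (U n) \<le> \<delta>)}.
        \<Sum>n. ennreal (diameter (U n)))"

text \<open>
  A polygon is given by its vertices in cyclic order. Flat angles are allowed, so that a point
  where the neighbouring cell changes along a straight side can be listed as a vertex.
\<close>
fun polygonal_path :: "point list \<Rightarrow> real \<Rightarrow> point" where
  "polygonal_path [] = linepath 0 0"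
| "polygonal_path [a] = linepath a a"
| "polygonal_path [a, b] = linepath a b"
| "polygonal_path (a # b # c # vs) = linepath a b +++ polygonal_path (b # c # vs)"

definition boundary_path :: "point list \<Rightarrow> real \<Rightarrow> point" where
  "boundary_path vs = polygonal_path (vs @ [hd vs])"

definition simple_polygon :: "point list \<Rightarrow> bool" where
  "simple_polygon vs \<longleftrightarrow> vs \<noteq> [] \<and> simple_path (boundary_path vs)"

definition polygon_region :: "point list \<Rightarrow> point set" where
  "polygon_region vs = inside (path_image (boundary_path vs))"

text \<open>An edge is represented by the set of its two endpoints.\<close>
definition polygon_edges :: "point list \<Rightarrow> point set set" where
  "polygon_edges vs = {{vs ! i, vs ! (Suc i mod length vs)} | i. i < length vs}"

definition open_partition :: "point set \<Rightarrow> 'i set \<Rightarrow> ('i \<Rightarrow> point set) \<Rightarrow> bool" where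
  "open_partition \<Omega> I V \<longleftrightarrow>
     finite I \<and> disjoint_family_on V I \<and> (\<forall>i\<in>I. open (V i) \<and> V i \<subseteq> \<Omega>) \<and>
     negligible (\<Omega> - (\<Union>i\<in>I. V i))"

section \<open>Domains\<close>

text \<open>
  Near each boundary point, in a suitable orthonormal frame centred there, \<open>\<Omega>\<close> is the part of a
  rectangle lying strictly above the graph of a Lipschitz function.
\<close>
definition lipschitz_domain :: "point set \<Rightarrow> bool" where
  "lipschitz_domain \<Omega> \<longleftrightarrow> open \<Omega> \<and> connected \<Omega> \<and>
     (\<forall>x\<in>frontier \<Omega>. \<exists>e \<phi> L r h. norm e = 1 \<and> 0 < r \<and> 0 < h \<and>
        L-lipschitz_on {-r<..<r} \<phi> \<and>
        (\<forall>s\<in>{-r<..<r}. \<forall>t\<in>{-h<..<h}. x + s *\<^sub>R rot90 e + t *\<^sub>R e \<in> \<Omega> \<longleftrightarrow> \<phi> s < t))"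

definition polygonal_domain :: "point set \<Rightarrow> bool" where
  "polygonal_domain \<Omega> \<longleftrightarrow> open \<Omega> \<and> connected \<Omega> \<and> bounded \<Omega> \<and>
     (\<exists>S. finite S \<and> frontier \<Omega> = (\<Union>(a, b)\<in>S. closed_segment a b))"

section \<open>DDFV meshes\<close>

text \<open>
  A diamond is recorded by the primal cells \<open>K\<close>, \<open>L\<close> on both sides of its primal edge and by the
  endpoints \<open>K\<^sup>*\<close>, \<open>L\<^sup>*\<close> of that edge. The same diamond can be recorded with \<open>K\<close>, \<open>L\<close> or
  \<open>K\<^sup>*\<close>, \<open>L\<^sup>*\<close> exchanged; a mesh contains one of these records for each edge.
\<close>
record diamond =
  cellK :: "point set"
  cellL :: "point set"
  vertK :: point
  vertL :: point

text \<open>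
  Interior primal cells are the open polygons themselves and boundary primal cells are open
  segments. Dual cells are indexed by the vertex of the primal mesh that they surround.
\<close>
record mesh =
  primal :: "point set set"
  primal_verts :: "point set \<Rightarrow> point list"
  center :: "point set \<Rightarrow> point"
  dual_verts :: "point \<Rightarrow> point list"
  diamonds :: "diamond set"

definition primal_edges :: "mesh \<Rightarrow> point set set" where
  "primal_edges T = (\<Union>K\<in>primal T. polygon_edges (primal_verts T K))"

definition boundary_primal :: "point set \<Rightarrow> mesh \<Rightarrow> point set set" where
  "boundary_primal \<Omega> T =
     {open_segment a b | a b. {a, b} \<in> primal_edges T \<and> open_segment a b \<subseteq> frontier \<Omega>}"

definition vertices :: "mesh \<Rightarrow> point set" where
  "vertices T = (\<Union>K\<in>primal T. set (primal_verts T K))"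

definition boundary_vertices :: "point set \<Rightarrow> mesh \<Rightarrow> point set" where
  "boundary_vertices \<Omega> T = vertices T \<inter> frontier \<Omega>"

definition dual_cell :: "mesh \<Rightarrow> point \<Rightarrow> point set" where
  "dual_cell T v = polygon_region (dual_verts T v)"

definition has_edge :: "point set \<Rightarrow> mesh \<Rightarrow> point set \<Rightarrow> point \<Rightarrow> point \<Rightarrow> bool" where
  "has_edge \<Omega> T V a b \<longleftrightarrow>
     V \<in> primal T \<and> {a, b} \<in> polygon_edges (primal_verts T V) \<or>
     V \<in> boundary_primal \<Omega> T \<and> V = open_segment a b"

definition has_vertex :: "point set \<Rightarrow> mesh \<Rightarrow> point set \<Rightarrow> point \<Rightarrow> bool" where
  "has_vertex \<Omega> T V a \<longleftrightarrow> (\<exists>b. has_edge \<Omega> T V a b)"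

definition edge :: "diamond \<Rightarrow> point set" where
  "edge d = {vertK d, vertL d}"

definition dual_edge :: "mesh \<Rightarrow> diamond \<Rightarrow> point set" where
  "dual_edge T d = {center T (cellK d), center T (cellL d)}"

definition edge_length :: "diamond \<Rightarrow> real" where
  "edge_length d = dist (vertK d) (vertL d)"

definition dual_edge_length :: "mesh \<Rightarrow> diamond \<Rightarrow> real" where
  "dual_edge_length T d = dist (center T (cellK d)) (center T (cellL d))"

definition diamond_verts :: "mesh \<Rightarrow> diamond \<Rightarrow> point list" where
  "diamond_verts T d = [center T (cellK d), vertK d, center T (cellL d), vertL d]"

definition diamond_region :: "mesh \<Rightarrow> diamond \<Rightarrow> point set" where
  "diamond_region T d = polygon_region (diamond_verts T d)"

definition diamond_angle :: "mesh \<Rightarrow> diamond \<Rightarrow> real" where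
  "diamond_angle T d =
     line_angle (center T (cellL d) - center T (cellK d)) (vertL d - vertK d)"

definition primal_mesh :: "point set \<Rightarrow> mesh \<Rightarrow> bool" where
  "primal_mesh \<Omega> T \<longleftrightarrow>
     open_partition \<Omega> (primal T) (\<lambda>K. K) \<and>
     (\<forall>K\<in>primal T. simple_polygon (primal_verts T K) \<and> K = polygon_region (primal_verts T K) \<and>
        star_shaped_at (center T K) K) \<and>
     (\<forall>K\<in>boundary_primal \<Omega> T. center T K \<in> K)"

text \<open>
  The first component of a diamond is always an interior cell; the second one is the degenerate
  cell if the edge lies on the boundary. In particular every primal edge inside \<open>\<Omega>\<close> is a full edge
  of two distinct cells.
\<close>
definition diamond_mesh :: "point set \<Rightarrow> mesh \<Rightarrow> bool" where
  "diamond_mesh \<Omega> T \<longleftrightarrow>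
     (\<forall>d\<in>diamonds T.
        cellK d \<in> primal T \<and> cellL d \<in> primal T \<union> boundary_primal \<Omega> T \<and> cellK d \<noteq> cellL d \<and>
        has_edge \<Omega> T (cellK d) (vertK d) (vertL d) \<and>
        has_edge \<Omega> T (cellL d) (vertK d) (vertL d) \<and>
        simple_polygon (diamond_verts T d)) \<and>
     (\<forall>s\<in>primal_edges T. \<exists>!d. d \<in> diamonds T \<and> edge d = s) \<and>
     open_partition \<Omega> (diamonds T) (diamond_region T)"

text \<open>
  The edges of the dual cell of \<open>v\<close> are the dual edges of the primal edges ending at \<open>v\<close> and, for
  \<open>v\<close> on the boundary, the two boundary pieces joining \<open>v\<close> to the centers of the adjacent boundary
  edges. A boundary \<open>v\<close> is a vertex of its open dual cell and so not an element of it, which is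
  why star-shapedness is stated for the closed cell.
\<close>
definition dual_mesh :: "point set \<Rightarrow> mesh \<Rightarrow> bool" where
  "dual_mesh \<Omega> T \<longleftrightarrow>
     open_partition \<Omega> (vertices T) (dual_cell T) \<and>
     (\<forall>v\<in>vertices T.
        simple_polygon (dual_verts T v) \<and>
        set (dual_verts T v) =
          {center T V | V. V \<in> primal T \<union> boundary_primal \<Omega> T \<and> has_vertex \<Omega> T V v} \<union>
          (if v \<in> frontier \<Omega> then {v} else {}) \<and>
        polygon_edges (dual_verts T v) =
          {dual_edge T d | d. d \<in> diamonds T \<and> v \<in> edge d} \<union>
          {{v, center T V} | V. V \<in> boundary_primal \<Omega> T \<and> has_vertex \<Omega> T V v} \<and>
        (v \<in> \<Omega> \<longrightarrow> v \<in> dual_cell T v) \<and>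
        star_shaped_at v (closure (dual_cell T v)))"

definition ddfv_mesh :: "point set \<Rightarrow> mesh \<Rightarrow> bool" where
  "ddfv_mesh \<Omega> T \<longleftrightarrow> primal_mesh \<Omega> T \<and> diamond_mesh \<Omega> T \<and> dual_mesh \<Omega> T"

text \<open>The union is contained in \<open>\<Gamma>0\<close>, so this difference is the symmetric difference.\<close>
definition compatible :: "point set \<Rightarrow> point set \<Rightarrow> mesh \<Rightarrow> bool" where
  "compatible \<Omega> \<Gamma>0 T \<longleftrightarrow>
     length_measure (\<Gamma>0 - \<Union>{K \<in> boundary_primal \<Omega> T. K \<subseteq> \<Gamma>0}) = 0"

definition R1 :: "mesh \<Rightarrow> real \<Rightarrow> bool" where
  "R1 T \<alpha> \<longleftrightarrow> \<alpha> \<in> {0<..pi / 2} \<and> (\<forall>d\<in>diamonds T. \<bar>sin (diamond_angle T d)\<bar> \<ge> sin \<alpha>)"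

definition R2 :: "mesh \<Rightarrow> real \<Rightarrow> bool" where
  "R2 T \<zeta> \<longleftrightarrow> \<zeta> > 0 \<and>
     (\<forall>K\<in>primal T.
        (\<Sum>d | d \<in> diamonds T \<and> edge d \<in> polygon_edges (primal_verts T K).
           edge_length d * dual_edge_length T d) \<le> measure lebesgue K / \<zeta>) \<and>
     (\<forall>v\<in>vertices T.
        (\<Sum>d | d \<in> diamonds T \<and> dual_edge T d \<in> polygon_edges (dual_verts T v).
           edge_length d * dual_edge_length T d) \<le> measure lebesgue (dual_cell T v) / \<zeta>)"

section \<open>Discrete functions\<close>

text \<open>Only the values on the primal cells and on the vertices of the mesh matter.\<close>
record unknowns =
  at_primal :: "point set \<Rightarrow> real"
  at_dual :: "point \<Rightarrow> real"

definition primal_fun :: "mesh \<Rightarrow> unknowns \<Rightarrow> point \<Rightarrow> real" where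
  "primal_fun T u x = (\<Sum>K\<in>primal T. at_primal u K * indicator K x)"

definition dual_fun :: "mesh \<Rightarrow> unknowns \<Rightarrow> point \<Rightarrow> real" where
  "dual_fun T u x = (\<Sum>v\<in>vertices T. at_dual u v * indicator (dual_cell T v) x)"

text \<open>
  The unknowns of the functions \<open>\<lambda>x. (primal_fun T u x + dual_fun T u x) / 2\<close> that vanish on the
  boundary part \<open>\<Gamma>0\<close>. Norms below are those of the unknowns.
\<close>
definition Z_space :: "point set \<Rightarrow> point set \<Rightarrow> mesh \<Rightarrow> unknowns set" where
  "Z_space \<Omega> \<Gamma>0 T = {u.
     (\<forall>K\<in>boundary_primal \<Omega> T. K \<subseteq> \<Gamma>0 \<longrightarrow> at_primal u K = 0) \<and>
     (\<forall>v\<in>boundary_vertices \<Omega> T. closure (dual_cell T v) \<inter> \<Gamma>0 \<noteq> {} \<longrightarrow> at_dual u v = 0)}"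

definition Lp_norm :: "real \<Rightarrow> point set \<Rightarrow> (point \<Rightarrow> real) \<Rightarrow> real" where
  "Lp_norm p \<Omega> f = (LINT x:\<Omega>|lebesgue. \<bar>f x\<bar> powr p) powr (1 / p)"

definition norm_0 :: "point set \<Rightarrow> mesh \<Rightarrow> real \<Rightarrow> unknowns \<Rightarrow> real" where
  "norm_0 \<Omega> T p u =
     (Lp_norm p \<Omega> (primal_fun T u) powr p / 2 + Lp_norm p \<Omega> (dual_fun T u) powr p / 2) powr (1 / p)"

text \<open>
  Since the cells are star-shaped with respect to their centers, the outward normal of a cell at
  one of its edges is the one that points away from the center.
\<close>
definition discrete_gradient :: "mesh \<Rightarrow> unknowns \<Rightarrow> diamond \<Rightarrow> point" where
  "discrete_gradient T u d =
     (1 / sin (diamond_angle T d)) *\<^sub>R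
       (((at_primal u (cellL d) - at_primal u (cellK d)) / dual_edge_length T d) *\<^sub>R
           normal_away (vertK d) (vertL d) (center T (cellK d)) +
        ((at_dual u (vertL d) - at_dual u (vertK d)) / edge_length d) *\<^sub>R
           normal_away (center T (cellK d)) (center T (cellL d)) (vertK d))"

definition seminorm_1 :: "mesh \<Rightarrow> real \<Rightarrow> unknowns \<Rightarrow> real" where
  "seminorm_1 T p u =
     (\<Sum>d\<in>diamonds T. measure lebesgue (diamond_region T d) *
        norm (discrete_gradient T u d) powr p) powr (1 / p)"

end

theory Submission
  imports Defs
begin

text \<open>
  The inequality is a Sobolev inequality for functions of bounded variation, applied to a power of
  the discrete function. It is proved for the primal and for the dual function separately, and both
  are treated as \<^emph>\<open>step functions\<close>: finitely many open cells with values, and a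
  finite set of segments (jumps) across which the value changes. The total variation is the sum of
  the lengths of the jumps times their heights.

  The core is the estimate \<open>\<parallel>v\<parallel>\<^sub>2 \<le> C \<cdot> TV(v)\<close> over
  \<open>\<Omega>\<close> for step functions that vanish on a flat piece \<open>Z\<close> of the
  boundary, with \<open>C\<close> depending on \<open>\<Omega>\<close> and \<open>Z\<close> only. It
  rests on the argument of Gagliardo and Nirenberg in the plane. If \<open>v\<close> varies along a
  line by at most \<open>W\<^sub>1\<close> in one direction and by at most \<open>W\<^sub>2\<close>
  in another, then \<open>v\<^sup>2\<close> is at most a product of two functions of one variable
  each, and the integral of the product is the product of the integrals, each of which is at most a
  multiple of \<open>TV(v)\<close> (\<open>two_directions_sobolev\<close>). The variation along a
  path is bounded by the jumps that the path meets by a connectedness argument with level sets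
  (\<open>level_set_chain\<close>). Paths with one corner carry the estimate from one piece of
  \<open>\<Omega>\<close> to another (\<open>sobolev_set_transfer\<close>), and segments that leave
  \<open>\<Omega>\<close> through \<open>Z\<close> start it (\<open>sobolev_set_anchor\<close>).
  Lipschitz charts, connectedness of \<open>\<Omega>\<close> and compactness of its closure then
  give the estimate on all of \<open>\<Omega>\<close> (\<open>sobolev_domain\<close>).

  For a discrete function \<open>u\<close> the estimate is applied to
  \<open>\<bar>u\<bar>\<^sup>s\<close>. The jump of \<open>\<bar>u\<bar>\<^sup>s\<close> is at most
  \<open>s\<close> times the jump of \<open>u\<close> times values of \<open>\<bar>u\<bar>\<close>
  to the power \<open>s - 1\<close>; Hoelder's inequality separates the two factors. The first gives
  the discrete gradient, where (R1) compares the product of the two diagonals of a diamond with its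
  area; the second gives a Lebesgue norm of \<open>u\<close> again, where (R2) compares the same
  products with the areas of the cells. For \<open>p < 2\<close> the choice \<open>s = p / (2 -
  p)\<close> makes the norms on both sides equal, so that one can divide; for \<open>p \<ge>
  2\<close> any large \<open>s\<close> will do (\<open>sobolev_to_Lq\<close>).

  What remains is that the primal and the dual function are step functions with the right jumps
  (\<open>step_function_primal\<close>, \<open>step_function_dual\<close>). Star-shapedness puts the
  triangle spanned by an edge and the center of a cell into the closed cell, and disjointness of the
  cells forces the triangles on the two sides of an edge to lie on opposite sides. So near an inner
  point of an edge there are no other cells. The flat piece \<open>Z\<close> is taken from a
  boundary edge of one compatible mesh; every other compatible mesh covers it by edges with zero
  boundary values up to a set of zero length, and such a set is invisible to almost every line.
\<close>

section \<open>Oriented areas in the plane\<close>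

text \<open>
  Twice the oriented area of the triangle \<open>a\<close>, \<open>b\<close>, \<open>y\<close>. Its
  sign tells on which side of the line through \<open>a\<close> and \<open>b\<close> the point
  \<open>y\<close> lies.
\<close>
definition cross :: "point \<Rightarrow> point \<Rightarrow> point \<Rightarrow> real" where
  "cross a b y = rot90 (b - a) \<bullet> (y - a)"

lemma rot90_nth [simp]: "rot90 v $ 1 = - (v $ 2)" "rot90 v $ 2 = v $ 1"
  by (auto simp: rot90_def vector_2)

lemma inner_point: "(v :: point) \<bullet> w = v $ 1 * w $ 1 + v $ 2 * w $ 2"
  by (simp add: inner_vec_def sum_2)

lemma point_eq_iff: "(v :: point) = w \<longleftrightarrow> v $ 1 = w $ 1 \<and> v $ 2 = w $ 2"
  by (simp add: vec_eq_iff forall_2)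

lemma cross_coords:
  "cross a b y = (b $ 1 - a $ 1) * (y $ 2 - a $ 2) - (b $ 2 - a $ 2) * (y $ 1 - a $ 1)"
  by (simp add: cross_def inner_point algebra_simps)

lemma norm_rot90 [simp]: "norm (rot90 v) = norm v"
  by (simp add: norm_eq_sqrt_inner inner_point)

lemma rot90_orthogonal [simp]: "rot90 v \<bullet> v = 0" "v \<bullet> rot90 v = 0"
  by (auto simp: inner_point)

lemma rot90_inner_Pythagoras: "(rot90 v \<bullet> w)\<^sup>2 + (v \<bullet> w)\<^sup>2 = (norm v)\<^sup>2 * (norm w)\<^sup>2"
  by (simp add: power2_norm_eq_inner inner_point) algebra

lemma cross_rotate: "cross b c a = cross a b c" "cross c a b = cross a b c"
  by (simp_all add: cross_coords algebra_simps)

lemma cross_same [simp]: "cross a b a = 0" "cross a b b = 0"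
  by (simp_all add: cross_coords)

lemma cross_affine:
  "cross a b ((1 - u) *\<^sub>R y + u *\<^sub>R z) = (1 - u) * cross a b y + u * cross a b z"
  by (simp add: cross_coords algebra_simps)

lemma cross_on_segment: "x \<in> closed_segment a b \<Longrightarrow> cross a b x = 0"
  by (auto simp: in_segment cross_affine)

lemma continuous_on_cross [continuous_intros]: "continuous_on S (cross a b)"
  unfolding cross_def by (intro continuous_intros)

lemma isCont_cross: "isCont (cross a b) x"
  unfolding cross_def by (intro continuous_intros)

lemma cross_eq_0_collinear:
  assumes "cross a b c = 0"
  shows "collinear {a, b, c}"
proof -
  have "((b - a) \<bullet> (c - a))\<^sup>2 = (norm (b - a) * norm (c - a))\<^sup>2"
    using rot90_inner_Pythagoras[of "b - a" "c - a"] assms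
    by (simp add: cross_def power_mult_distrib)
  then have "\<bar>(b - a) \<bullet> (c - a)\<bar> = norm (b - a) * norm (c - a)"
    using power2_eq_iff_nonneg[of "\<bar>(b - a) \<bullet> (c - a)\<bar>" "norm (b - a) * norm (c - a)"] by simp
  then have "collinear {0, b - a, c - a}"
    by (simp add: norm_cauchy_schwarz_equal)
  then have "collinear {b, a, c}"
    by (simp add: collinear_3[of b a c])
  then show ?thesis by (simp add: insert_commute)
qed

text \<open>
  At an inner point of the edge \<open>ab\<close> the barycentric coordinates of \<open>a\<close>
  and \<open>b\<close> are positive, and they stay positive nearby; the coordinate of
  \<open>c\<close> is nonnegative exactly on the side of \<open>c\<close>. This is the only local
  information about cells that is used later on.
\<close>
lemma half_disc_in_triangle:
  assumes x: "x \<in> open_segment a b" and c: "cross a b c \<noteq> 0"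
  shows "\<exists>\<rho>>0. \<forall>y\<in>ball x \<rho>. 0 \<le> cross a b y * cross a b c \<longrightarrow> y \<in> convex hull {a, b, c}"
proof -
  obtain u where u: "0 < u" "u < 1" and xu: "x = (1 - u) *\<^sub>R a + u *\<^sub>R b"
    using x by (auto simp: in_segment)
  have 1: "cross b c x = (1 - u) * cross a b c" "cross c a x = u * cross a b c"
    unfolding xu cross_affine by (simp_all add: cross_rotate)
  have c2: "cross a b c * cross a b c > 0" using c by (simp add: zero_less_mult_iff) linarith
  have "isCont (\<lambda>y. cross b c y * cross a b c) x" "isCont (\<lambda>y. cross c a y * cross a b c) x"
    by (intro continuous_intros isCont_cross)+
  then have "((\<lambda>y. cross b c y * cross a b c) \<longlongrightarrow> cross b c x * cross a b c) (nhds x)"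
    "((\<lambda>y. cross c a y * cross a b c) \<longlongrightarrow> cross c a x * cross a b c) (nhds x)"
    by (simp_all add: continuous_at tendsto_nhds_iff)
  then have "\<forall>\<^sub>F y in nhds x. 0 < cross b c y * cross a b c" "\<forall>\<^sub>F y in nhds x. 0 < cross c a y * cross a b c"
    using u c2 by (auto intro!: order_tendstoD(1) simp: 1 mult.assoc)
  then have "\<forall>\<^sub>F y in nhds x. 0 < cross b c y * cross a b c \<and> 0 < cross c a y * cross a b c"
    by (rule eventually_conj)
  then obtain \<rho> where \<rho>: "\<rho> > 0" "\<And>y. dist y x < \<rho> \<Longrightarrow> 0 < cross b c y * cross a b c \<and> 0 < cross c a y * cross a b c"
    unfolding eventually_nhds_metric by blast
  show ?thesis
  proof (intro exI[of _ \<rho>] conjI ballI impI)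
    fix y assume y: "y \<in> ball x \<rho>" "0 \<le> cross a b y * cross a b c"
    let ?D = "cross a b c"
    define l m n where "l = cross b c y / ?D" and "m = cross c a y / ?D" and "n = cross a b y / ?D"
    have pos: "0 \<le> l" "0 \<le> m" "0 \<le> n"
      using \<rho>(2)[of y] y c
      by (auto simp: l_def m_def n_def dist_commute zero_le_divide_iff zero_le_mult_iff zero_less_mult_iff)
    have sum: "l + m + n = 1"
    proof -
      have "cross b c y + cross c a y + cross a b y = ?D"
        by (simp add: cross_coords algebra_simps)
      then show ?thesis using c by (simp add: l_def m_def n_def field_simps)
    qed
    have "?D *\<^sub>R y = cross b c y *\<^sub>R a + cross c a y *\<^sub>R b + cross a b y *\<^sub>R c"
      by (simp add: point_eq_iff cross_coords) algebra
    then have "y = l *\<^sub>R a + m *\<^sub>R b + n *\<^sub>R c"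
      using c by (simp add: l_def m_def n_def point_eq_iff field_simps)
    then show "y \<in> convex hull {a, b, c}"
      unfolding convex_hull_3 using pos sum by blast
  qed (use \<rho> in auto)
qed

section \<open>Polygons given by vertex lists\<close>

lemma polygonal_path_ends:
  assumes "vs \<noteq> []"
  shows "pathstart (polygonal_path vs) = hd vs" "pathfinish (polygonal_path vs) = last vs"
  using assms by (induction vs rule: polygonal_path.induct) auto

lemma path_image_polygonal_path:
  assumes "length vs \<ge> 2"
  shows "path_image (polygonal_path vs) = (\<Union>i<length vs - 1. closed_segment (vs ! i) (vs ! Suc i))"
  using assms
proof (induction vs rule: polygonal_path.induct)
  case (4 a b c vs)
  have "path_image (polygonal_path (a # b # c # vs)) =
     closed_segment a b \<union> path_image (polygonal_path (b # c # vs))"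
    by (simp add: path_image_join polygonal_path_ends)
  also have "\<dots> = closed_segment a b \<union>
      (\<Union>i<length (b # c # vs) - 1. closed_segment ((b # c # vs) ! i) ((b # c # vs) ! Suc i))"
    using 4 by simp
  also have "\<dots> = (\<Union>i<length (a # b # c # vs) - 1. closed_segment ((a # b # c # vs) ! i) ((a # b # c # vs) ! Suc i))"
    by (simp add: lessThan_Suc_eq_insert_0 image_image del: lessThan_Suc) 
  finally show ?case .
qed auto

lemma vertex_in_polygonal_path:
  assumes "length vs \<ge> 2" "x \<in> set vs"
  shows "x \<in> path_image (polygonal_path vs)"
proof -
  obtain k where k: "k < length vs" "x = vs ! k" using assms by (auto simp: in_set_conv_nth)
  show ?thesis
  proof (cases "k < length vs - 1")
    case True
    then show ?thesis using k by (auto simp: path_image_polygonal_path[OF assms(1)])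
  next
    case False
    then have "k = Suc (length vs - 2)" using k assms by auto
    then have "x \<in> closed_segment (vs ! (length vs - 2)) (vs ! Suc (length vs - 2))" using k by auto
    moreover have "length vs - 2 < length vs - 1" using assms by auto
    ultimately show ?thesis unfolding path_image_polygonal_path[OF assms(1)] by blast
  qed
qed

lemma arc_linepath_distinct:
  fixes a b :: point
  assumes "arc (linepath a b)" shows "a \<noteq> b"
  using arc_distinct_ends[OF assms] by simp

lemma arc_polygonal_path_distinct:
  assumes "arc (polygonal_path vs)" "length vs \<ge> 2"
  shows "distinct vs"
  using assms
proof (induction vs rule: polygonal_path.induct)
  case (3 a b)
  then show ?case using arc_linepath_distinct[of a b] by auto
next
  case (4 a b c vs)
  have *: "arc (linepath a b)" "arc (polygonal_path (b # c # vs))"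
     "closed_segment a b \<inter> path_image (polygonal_path (b # c # vs)) \<subseteq> {b}"
    using "4.prems"(1) by (auto simp: arc_join_eq polygonal_path_ends)
  have d: "distinct (b # c # vs)" using * 4 by auto
  have "a \<noteq> b" using *(1) by (rule arc_linepath_distinct)
  then have "a \<notin> path_image (polygonal_path (b # c # vs))" using *(3) by auto
  then have "a \<notin> set (b # c # vs)" using vertex_in_polygonal_path[of "b # c # vs" a] by auto
  then show ?case using d by auto
qed auto

text \<open>
  An injective polygonal path meets a vertex only at the parameter of that vertex, hence only on the
  two segments that end there.
\<close>
lemma arc_polygonal_path_vertex:
  assumes "arc (polygonal_path vs)" "k < length vs" "Suc i < length vs"
    and "vs ! k \<in> closed_segment (vs ! i) (vs ! Suc i)"
  shows "k = i \<or> k = Suc i"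
  using assms
proof (induction vs arbitrary: i k rule: polygonal_path.induct)
  case (3 a b)
  then show ?case by auto
next
  case (4 a b c vs)
  let ?t = "b # c # vs"
  have *: "arc (linepath a b)" "arc (polygonal_path ?t)"
     "closed_segment a b \<inter> path_image (polygonal_path ?t) \<subseteq> {b}"
    using "4.prems"(1) by (auto simp: arc_join_eq polygonal_path_ends)
  have d: "distinct (a # ?t)" using arc_polygonal_path_distinct[OF "4.prems"(1)] by simp
  show ?case
  proof (cases i)
    case 0
    show ?thesis
    proof (cases "k \<le> 1")
      case True then show ?thesis using 0 by auto
    next
      case False
      then obtain k' where k': "k = Suc (Suc k')" by (metis One_nat_def not_less_eq_eq old.nat.exhaust less_eq_nat.simps(1) )
      have "(a # ?t) ! k \<in> set ?t" using k' "4.prems"(2) nth_mem[of "Suc k'" ?t] by simp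
      then have "(a # ?t) ! k \<in> path_image (polygonal_path ?t)" using vertex_in_polygonal_path[of ?t] by simp
      then have "(a # ?t) ! k = (a # ?t) ! 1" using *(3) "4.prems"(4) 0 by auto
      then show ?thesis using d "4.prems"(2) nth_eq_iff_index_eq[OF d, of k 1] 0 by auto
    qed
  next
    case (Suc i')
    show ?thesis
    proof (cases k)
      case 0
      have "a \<in> closed_segment (?t ! i') (?t ! Suc i')" using "4.prems"(4) 0 Suc by simp
      then have "a \<in> path_image (polygonal_path ?t)"
        using "4.prems"(3) Suc by (subst path_image_polygonal_path) auto
      then have "a = b" using *(3) by auto
      then show ?thesis using d by auto
    next
      case (Suc k')
      then show ?thesis using "4.IH"[OF *(2), of k' i'] "4.prems"(2-4) \<open>i = Suc i'\<close> by auto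
    qed
  qed
qed auto

lemma simple_polygon_arcs:
  assumes "simple_polygon vs"
  obtains a b ws where "vs = a # b # ws" "arc (linepath a b)" "arc (polygonal_path (b # ws @ [a]))"
    "closed_segment a b \<inter> path_image (polygonal_path (b # ws @ [a])) \<subseteq> {a, b}"
proof -
  from assms have s: "simple_path (boundary_path vs)" and ne: "vs \<noteq> []"
    by (auto simp: simple_polygon_def)
  show thesis
  proof (cases vs rule: polygonal_path.cases)
    case 1 then show thesis using ne by simp
  next
    case (2 a)
    then have "loop_free (linepath a a)" using s by (simp add: boundary_path_def simple_path_def)
    then have "(1/2::real) = 1/3" unfolding loop_free_def linepath_refl
      by (elim ballE[of _ _ "1/2"] ballE[of _ _ "1/3"]) auto
    then show thesis by simp
  next
    case (3 a b)
    show thesis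
      using s 3 by (intro that[of a b "[]"]) (auto simp: boundary_path_def simple_path_join_loop_eq)
  next
    case (4 a b c ws)
    show thesis
      using s 4 by (intro that[of a b "c # ws"]) (auto simp: boundary_path_def simple_path_join_loop_eq polygonal_path_ends)
  qed
qed

lemma polygon_edges_Cons:
  "polygon_edges (a # b # ws) =
     insert {a, b} {{(b # ws @ [a]) ! i, (b # ws @ [a]) ! Suc i} | i. Suc i < length (b # ws @ [a])}"
  (is "?L = insert _ ?R")
proof -
  let ?vs = "a # b # ws" and ?t = "b # ws @ [a]"
  have t: "?vs ! (Suc (Suc i) mod length ?vs) = ?t ! Suc i" "?vs ! Suc i = ?t ! i" if "i < Suc (length ws)" for i
    using that by (auto simp: nth_append nth_Cons' mod_if)
  have "?L = (\<lambda>i. {?vs ! i, ?vs ! (Suc i mod length ?vs)}) ` {..<Suc (Suc (length ws))}"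
    by (auto simp: polygon_edges_def)
  also have "\<dots> = insert {a, b} ((\<lambda>i. {?vs ! Suc i, ?vs ! (Suc (Suc i) mod length ?vs)}) ` {..<Suc (length ws)})"
    by (subst lessThan_Suc_eq_insert_0) (simp add: image_image)
  also have "(\<lambda>i. {?vs ! Suc i, ?vs ! (Suc (Suc i) mod length ?vs)}) ` {..<Suc (length ws)}
     = (\<lambda>i. {?t ! i, ?t ! Suc i}) ` {..<Suc (length ws)}"
    using t by (intro image_cong) auto
  also have "\<dots> = ?R" by auto
  finally show ?thesis .
qed

lemma polygon_edges_image:
  "polygon_edges vs = (\<lambda>i. {vs ! i, vs ! (Suc i mod length vs)}) ` {..<length vs}"
  by (auto simp: polygon_edges_def)

lemma polygon_edges_4: "polygon_edges [a, b, c, d] = {{a, b}, {b, c}, {c, d}, {d, a}}"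
proof -
  have "{..<length [a, b, c, d]} = {0, Suc 0, Suc (Suc 0), Suc (Suc (Suc 0))}" by (simp add: lessThan_Suc insert_commute)
  then show ?thesis unfolding polygon_edges_image by simp
qed

text \<open>
  Excludes degenerate configurations: without this a vertex of a dual cell could lie inside the dual
  edge opposite to it, and one side of that edge would be out of control.
\<close>
lemma simple_polygon_vertex_on_edge:
  assumes "simple_polygon vs" "{x, y} \<in> polygon_edges vs" "v \<in> set vs" "v \<in> closed_segment x y"
  shows "v = x \<or> v = y"
proof -
  from assms(1) obtain a b ws where vs: "vs = a # b # ws" and 1: "arc (linepath a b)" "arc (polygonal_path (b # ws @ [a]))"
    "closed_segment a b \<inter> path_image (polygonal_path (b # ws @ [a])) \<subseteq> {a, b}"
    by (rule simple_polygon_arcs)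
  let ?t = "b # ws @ [a]"
  have vt: "v \<in> set ?t" using assms(3) vs by auto
  then have vp: "v \<in> path_image (polygonal_path ?t)" by (intro vertex_in_polygonal_path) auto
  consider "{x, y} = {a, b}" | i where "{x, y} = {?t ! i, ?t ! Suc i}" "Suc i < length ?t"
    using assms(2) unfolding vs polygon_edges_Cons by auto
  then show ?thesis
  proof cases
    case 1
    then have "v \<in> closed_segment a b" using assms(4) by (auto simp: doubleton_eq_iff closed_segment_commute)
    then show ?thesis using vp \<open>_ \<subseteq> {a, b}\<close> 1 by blast
  next
    case 2
    obtain k where k: "k < length ?t" "v = ?t ! k" using vt by (metis in_set_conv_nth)
    have "v \<in> closed_segment (?t ! i) (?t ! Suc i)" using assms(4) 2 by (auto simp: doubleton_eq_iff closed_segment_commute)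
    then have "k = i \<or> k = Suc i" using arc_polygonal_path_vertex[OF 1(2) k(1) 2(2)] k(2) by auto
    then show ?thesis using k 2(1) by blast
  qed
qed

lemma simple_polygon_edge_ends_distinct:
  assumes "simple_polygon vs" "{x, y} \<in> polygon_edges vs"
  shows "x \<noteq> y"
proof -
  from assms(1) obtain a b ws where vs: "vs = a # b # ws" and 1: "arc (linepath a b)" "arc (polygonal_path (b # ws @ [a]))"
    by (rule simple_polygon_arcs)
  let ?t = "b # ws @ [a]"
  have d: "distinct ?t" using arc_polygonal_path_distinct[OF 1(2)] by simp
  consider "{x, y} = {a, b}" | i where "{x, y} = {?t ! i, ?t ! Suc i}" "Suc i < length ?t"
    using assms(2) unfolding vs polygon_edges_Cons by auto
  then show ?thesis
  proof cases
    case 1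
    then show ?thesis using arc_linepath_distinct[OF \<open>arc (linepath a b)\<close>] by (auto simp: doubleton_eq_iff)
  next
    case 2
    then have "?t ! i \<noteq> ?t ! Suc i" using nth_eq_iff_index_eq[OF d, of i "Suc i"] by simp
    then show ?thesis using 2 by (metis doubleton_eq_iff)
  qed
qed

lemma simple_polygon_distinct:
  assumes "simple_polygon vs"
  shows "distinct vs"
proof -
  from assms(1) obtain a b ws where vs: "vs = a # b # ws" and 1: "arc (polygonal_path (b # ws @ [a]))"
    by (rule simple_polygon_arcs)
  then show ?thesis using arc_polygonal_path_distinct[OF 1] by auto
qed

text \<open>
  Three consecutive vertices on a line must come in their order, since otherwise one of the two
  edges runs through the third vertex.
\<close>
lemma simple_polygon_flat_vertex:
  assumes "simple_polygon vs" "{x, y} \<in> polygon_edges vs" "{y, z} \<in> polygon_edges vs"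
    and "x \<in> set vs" "z \<in> set vs" "x \<noteq> z" and "cross x z y = 0"
  shows "y \<in> open_segment x z"
proof -
  note v = simple_polygon_vertex_on_edge[OF assms(1)] and ne = simple_polygon_edge_ends_distinct[OF assms(1)]
  have "collinear {x, z, y}" using assms(7) by (rule cross_eq_0_collinear)
  then consider "x \<in> closed_segment z y" | "z \<in> closed_segment y x" | "y \<in> closed_segment x z"
    unfolding collinear_between_cases between_mem_segment by blast
  then show ?thesis
  proof cases
    case 1
    then have "x = y \<or> x = z" using v[OF assms(3,4)] by (auto simp: closed_segment_commute)
    then show ?thesis using ne[OF assms(2)] assms(6) by auto
  next
    case 2
    then have "z = x \<or> z = y" using v[OF assms(2,5)] by (auto simp: closed_segment_commute)
    then show ?thesis using ne[OF assms(3)] assms(6) by auto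
  next
    case 3
    then show ?thesis using ne[OF assms(2)] ne[OF assms(3)] by (auto simp: open_segment_def)
  qed
qed

lemma path_image_boundary_path:
  assumes "simple_polygon vs"
  shows "z \<in> path_image (boundary_path vs) \<longleftrightarrow> (\<exists>x y. {x, y} \<in> polygon_edges vs \<and> z \<in> closed_segment x y)"
proof -
  from assms(1) obtain a b ws where vs: "vs = a # b # ws" by (rule simple_polygon_arcs)
  let ?t = "b # ws @ [a]"
  have "boundary_path vs = linepath a b +++ polygonal_path ?t"
    by (cases ws) (auto simp: boundary_path_def vs)
  then have im: "path_image (boundary_path vs) = closed_segment a b \<union> path_image (polygonal_path ?t)"
    by (simp add: path_image_join polygonal_path_ends)
  have im2: "path_image (polygonal_path ?t) = (\<Union>i<length ?t - 1. closed_segment (?t ! i) (?t ! Suc i))"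
    by (rule path_image_polygonal_path) simp
  show ?thesis
  proof
    assume "z \<in> path_image (boundary_path vs)"
    then consider "z \<in> closed_segment a b" | i where "i < length ?t - 1" "z \<in> closed_segment (?t ! i) (?t ! Suc i)"
      unfolding im im2 by blast
    then show "\<exists>x y. {x, y} \<in> polygon_edges vs \<and> z \<in> closed_segment x y"
    proof cases
      case 1
      then show ?thesis unfolding vs polygon_edges_Cons by blast
    next
      case 2
      then have "Suc i < length ?t" by auto
      then show ?thesis unfolding vs polygon_edges_Cons using 2(2) by blast
    qed
  next
    assume "\<exists>x y. {x, y} \<in> polygon_edges vs \<and> z \<in> closed_segment x y"
    then obtain x y where xy: "{x, y} \<in> polygon_edges vs" "z \<in> closed_segment x y" by blast
    then consider "{x, y} = {a, b}" | i where "{x, y} = {?t ! i, ?t ! Suc i}" "Suc i < length ?t"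
      unfolding vs polygon_edges_Cons by auto
    then show "z \<in> path_image (boundary_path vs)"
    proof cases
      case 1
      then show ?thesis using xy(2) unfolding im by (auto simp: doubleton_eq_iff closed_segment_commute)
    next
      case 2
      then have "z \<in> closed_segment (?t ! i) (?t ! Suc i)" using xy(2) by (auto simp: doubleton_eq_iff closed_segment_commute)
      moreover have "i < length ?t - 1" using 2 by auto
      ultimately show ?thesis unfolding im im2 by blast
    qed
  qed
qed

lemma boundary_path_closed: "vs \<noteq> [] \<Longrightarrow> pathfinish (boundary_path vs) = pathstart (boundary_path vs)"
  by (simp add: boundary_path_def polygonal_path_ends)

text \<open>
  The boundary of a simple polygon is a topological circle, so by the Jordan-Brouwer theorem it is
  the frontier of every component of its complement, in particular of one inside.
\<close>
lemma frontier_polygon_region: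
  assumes "simple_polygon vs" "polygon_region vs \<noteq> {}"
  shows "frontier (polygon_region vs) = path_image (boundary_path vs)"
proof -
  let ?P = "path_image (boundary_path vs)"
  have sp: "simple_path (boundary_path vs)" and ne: "vs \<noteq> []" using assms by (auto simp: simple_polygon_def)
  have cl: "closed ?P" using sp by (simp add: closed_path_image simple_path_imp_path)
  have "?P homeomorphic sphere (0::complex) 1"
    using homeomorphic_simple_path_image_circle[OF sp boundary_path_closed[OF ne], of 1 0] by simp
  moreover have "sphere (0::complex) 1 homeomorphic sphere (0::point) 1"
    by (intro homeomorphic_spheres') auto
  ultimately have hom: "?P homeomorphic sphere (0::point) 1" by (rule homeomorphic_trans)
  obtain z where z: "z \<in> inside ?P" using assms(2) by (auto simp: polygon_region_def)
  define T where "T = connected_component_set (- ?P) z"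
  have T: "T \<in> components (- ?P)" using z unfolding T_def
    by (intro componentsI) (auto simp: inside_def)
  then have fT: "frontier T = ?P" using Jordan_Brouwer_frontier[OF hom] by simp
  have "T \<subseteq> inside ?P"
  proof
    fix y assume y: "y \<in> T"
    then have "connected_component_set (- ?P) y = T"
      unfolding T_def using connected_component_eq by blast
    moreover have "bounded T" using z by (simp add: T_def inside_def)
    ultimately show "y \<in> inside ?P" using y unfolding inside_def T_def
      using connected_component_in by fastforce
  qed
  then have "?P \<subseteq> closure (inside ?P)" using fT closure_mono[of T "inside ?P"] by (auto simp: frontier_def)
  moreover have "?P \<inter> inside ?P = {}" by (auto simp: inside_def)
  moreover have "open (inside ?P)" using cl by (rule open_inside)
  ultimately have "?P \<subseteq> frontier (inside ?P)" by (auto simp: frontier_def interior_open)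
  then show ?thesis using frontier_inside_subset[OF cl] unfolding polygon_region_def by blast
qed

section \<open>Triangles and quadrilaterals\<close>

text \<open>
  If \<open>c\<close> and \<open>d\<close> were on the same side, both triangles would contain a
  common half disc at the midpoint of \<open>ab\<close>, and the disjoint open sets \<open>V\<close>
  and \<open>T\<close> would both be dense in it.
\<close>
lemma disjoint_triangles_opposite:
  assumes V: "open V" "T \<inter> V = {}" "open T"
    and c: "convex hull {a, b, c} \<subseteq> closure V" and d: "convex hull {a, b, d} \<subseteq> closure T"
    and ab: "a \<noteq> b" and nc: "cross a b c \<noteq> 0" and nd: "cross a b d \<noteq> 0"
  shows "cross a b c * cross a b d < 0"
proof (rule ccontr)
  assume "\<not> ?thesis"
  then have pos: "cross a b c * cross a b d > 0" using nc nd by (simp add: not_less less_le)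
  define x where "x = midpoint a b"
  have x: "x \<in> open_segment a b" using ab by (simp add: x_def)
  obtain r1 where r1: "r1 > 0" "\<And>y. y \<in> ball x r1 \<Longrightarrow> 0 \<le> cross a b y * cross a b c \<Longrightarrow> y \<in> convex hull {a, b, c}"
    using half_disc_in_triangle[OF x nc] by blast
  obtain r2 where r2: "r2 > 0" "\<And>y. y \<in> ball x r2 \<Longrightarrow> 0 \<le> cross a b y * cross a b d \<Longrightarrow> y \<in> convex hull {a, b, d}"
    using half_disc_in_triangle[OF x nd] by blast
  define O' where "O' = ball x (min r1 r2) \<inter> {y. 0 < cross a b y * cross a b c}"
  have "open O'" unfolding O'_def
    by (intro open_Int open_Collect_less continuous_intros) auto
  have sub1: "O' \<subseteq> closure V" using r1 c by (force simp: O'_def)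
  have sub2: "O' \<subseteq> closure T"
  proof
    fix y assume y: "y \<in> O'"
    then have "0 \<le> cross a b y * cross a b d" using pos
      by (auto simp: O'_def zero_less_mult_iff zero_le_mult_iff)
    then show "y \<in> closure T" using r2(2)[of y] d y by (auto simp: O'_def)
  qed
  have "\<exists>y. y \<in> O'"
  proof -
    define t where "t = min r1 r2 / (2 * (norm (c - x) + 1))"
    have t: "t > 0" using r1 r2 by (auto simp: t_def intro!: divide_pos_pos add_nonneg_pos)
    define y where "y = (1 - t) *\<^sub>R x + t *\<^sub>R c"
    have "cross a b x = 0" using x by (meson cross_on_segment open_closed_segment)
    then have "cross a b y = t * cross a b c" by (simp add: y_def cross_affine)
    then have 1: "0 < cross a b y * cross a b c" using t nc
      by (metis mult.assoc mult_pos_pos not_real_square_gt_zero)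
    have "y - x = t *\<^sub>R (c - x)" by (simp add: y_def algebra_simps)
    then have "dist x y = t * norm (c - x)" using t by (simp add: dist_norm norm_minus_commute[of x])
    also have "t * norm (c - x) < t * (2 * (norm (c - x) + 1))"
    proof (rule mult_strict_left_mono[OF _ t])
      have "0 \<le> norm (c - x)" by simp
      then show "norm (c - x) < 2 * (norm (c - x) + 1)" by argo
    qed
    also have "\<dots> = min r1 r2"
    proof -
      have "0 \<le> norm (c - x)" by simp
      then have "2 * (norm (c - x) + 1) \<noteq> 0" by argo
      then show ?thesis unfolding t_def by simp
    qed
    finally show ?thesis using 1 by (auto simp: O'_def)
  qed
  then obtain y where "y \<in> O'" ..
  then have "O' \<inter> V \<noteq> {}"
    using open_Int_closure_eq_empty[OF \<open>open O'\<close>, of V] sub1 by blast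
  then have "O' \<inter> V \<inter> T \<noteq> {}"
    using open_Int_closure_eq_empty[OF open_Int[OF \<open>open O'\<close> V(1)], of T] sub2 by blast
  then show False using V(2) by blast
qed

text \<open>
  Two half discs at \<open>x\<close> make a disc.
\<close>
lemma two_triangles_neighbourhood:
  assumes x: "x \<in> open_segment a b" and opp: "cross a b c * cross a b d < 0"
  shows "\<exists>\<rho>>0. ball x \<rho> \<subseteq> convex hull {a, b, c} \<union> convex hull {a, b, d}"
proof -
  have n: "cross a b c \<noteq> 0" "cross a b d \<noteq> 0" using opp by auto
  obtain r1 where r1: "r1 > 0" "\<And>y. y \<in> ball x r1 \<Longrightarrow> 0 \<le> cross a b y * cross a b c \<Longrightarrow> y \<in> convex hull {a, b, c}"
    using half_disc_in_triangle[OF x n(1)] by blast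
  obtain r2 where r2: "r2 > 0" "\<And>y. y \<in> ball x r2 \<Longrightarrow> 0 \<le> cross a b y * cross a b d \<Longrightarrow> y \<in> convex hull {a, b, d}"
    using half_disc_in_triangle[OF x n(2)] by blast
  have "ball x (min r1 r2) \<subseteq> convex hull {a, b, c} \<union> convex hull {a, b, d}"
  proof
    fix y assume "y \<in> ball x (min r1 r2)"
    moreover have "0 \<le> cross a b y * cross a b c \<or> 0 \<le> cross a b y * cross a b d"
      using opp by (auto simp: mult_less_0_iff zero_le_mult_iff)
    ultimately show "y \<in> convex hull {a, b, c} \<union> convex hull {a, b, d}" using r1(2)[of y] r2(2)[of y] by auto
  qed
  then show ?thesis using r1(1) r2(1) by (intro exI[of _ "min r1 r2"]) auto
qed

lemma measure_triangle:
  "measure lebesgue (convex hull {a, b, c}) = \<bar>cross a b c\<bar> / 2"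
proof -
  have "closed (convex hull {a, b, c})"
    by (intro compact_imp_closed finite_imp_compact_convex_hull) auto
  then have "measure lebesgue (convex hull {a, b, c}) = measure lborel (convex hull {a, b, c})"
    by (intro measure_completion) (simp add: borel_closed)
  then show ?thesis unfolding content_triangle cross_coords by (simp add: mult.commute abs_minus_commute)
qed

lemma lmeasurable_triangle: "convex hull {a, b, c :: point} \<in> lmeasurable"
  by (intro lmeasurable_compact finite_imp_compact_convex_hull) auto

lemma negligible_closed_segment: "negligible (closed_segment a (b :: point))"
proof -
  have "measure lebesgue (convex hull {a, b, b}) = 0" unfolding measure_triangle by simp
  then have "negligible (convex hull {a, b, b})"
    using lmeasurable_triangle negligible_iff_measure by blast
  then show ?thesis by (simp add: segment_convex_hull)
qed

lemma cross_in_triangle: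
  assumes "y \<in> convex hull {a, b, c}"
  shows "0 \<le> cross a b y * cross a b c"
proof -
  obtain u v w where "0 \<le> u" "0 \<le> v" "0 \<le> w" and sum: "u + v + w = 1" and y: "y = u *\<^sub>R a + v *\<^sub>R b + w *\<^sub>R c"
    using assms unfolding convex_hull_3 by blast
  have "u = 1 - v - w" using sum by simp
  have "cross a b y = w * cross a b c" unfolding y \<open>u = 1 - v - w\<close> by (simp add: cross_coords algebra_simps)
  then show ?thesis using \<open>0 \<le> w\<close> by (simp add: mult.assoc)
qed

text \<open>
  The two triangles over the diagonal \<open>vw\<close> have the oriented areas in question, of
  opposite sign, and overlap in a null set. Their union \<open>Q\<close> has its frontier on the
  quadrilateral path \<open>P\<close>, so \<open>Q\<close> without \<open>P\<close> is inside
  \<open>P\<close>, be the quadrilateral convex or not. The second case of the assumption on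
  \<open>c\<close> is the degenerate diamond at a boundary edge.
\<close>
lemma quadrilateral_area:
  assumes sp: "simple_polygon [p, v, c, w]" and p: "cross v w p \<noteq> 0"
    and c: "cross v w p * cross v w c < 0 \<or> c \<in> closed_segment v w"
  shows "\<bar>cross v w p - cross v w c\<bar> / 2 \<le> measure lebesgue (polygon_region [p, v, c, w])"
proof -
  let ?P = "path_image (boundary_path [p, v, c, w])"
  let ?T1 = "convex hull {v, w, p}" and ?T2 = "convex hull {v, w, c}"
  let ?Q = "?T1 \<union> ?T2"
  have P: "?P = closed_segment p v \<union> closed_segment v c \<union> closed_segment c w \<union> closed_segment w p"
    unfolding boundary_path_def by (simp add: path_image_join Un_assoc)
  have le0: "cross v w p * cross v w c \<le> 0" using c cross_on_segment by force
  have negP: "negligible ?P" unfolding P by (intro negligible_Un negligible_closed_segment)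
  have closedP: "closed ?P" unfolding P by (intro closed_Un) auto
  have boundedP: "bounded ?P" unfolding P by (simp add: bounded_closed_segment)
  have "?T1 \<inter> ?T2 \<subseteq> {y. rot90 (w - v) \<bullet> y = rot90 (w - v) \<bullet> v}"
  proof
    fix y assume y: "y \<in> ?T1 \<inter> ?T2"
    then have "0 \<le> cross v w y * cross v w p" "0 \<le> cross v w y * cross v w c" using cross_in_triangle by blast+
    then have "cross v w y = 0 \<or> (cross v w c = 0)" using le0 p
      by (auto simp: zero_le_mult_iff mult_le_0_iff)
    moreover have "cross v w y = 0" if "cross v w c = 0"
    proof -
      obtain u a b where sum: "u + a + b = 1" and y': "y = u *\<^sub>R v + a *\<^sub>R w + b *\<^sub>R c"
        using y unfolding convex_hull_3 by blast
      have "u = 1 - a - b" using sum by simp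
      have "cross v w y = b * cross v w c" unfolding y' \<open>u = 1 - a - b\<close> by (simp add: cross_coords algebra_simps)
      then show ?thesis using that by simp
    qed
    ultimately have "cross v w y = 0" by blast
    then show "y \<in> {y. rot90 (w - v) \<bullet> y = rot90 (w - v) \<bullet> v}" by (simp add: cross_def inner_diff_right)
  qed
  moreover have "rot90 (w - v) \<noteq> 0"
  proof -
    have "v \<noteq> w" using p by (auto simp: cross_coords)
    then show ?thesis by (metis norm_eq_zero norm_rot90 right_minus_eq)
  qed
  ultimately have "negligible (?T1 \<inter> ?T2)"
    using negligible_hyperplane[of "rot90 (w - v)"] negligible_subset by blast
  then have "measure lebesgue ?Q = measure lebesgue ?T1 + measure lebesgue ?T2"
    using measure_Un3[OF lmeasurable_triangle lmeasurable_triangle] negligible_imp_measure0 by simp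
  also have "\<dots> = \<bar>cross v w p - cross v w c\<bar> / 2"
    unfolding measure_triangle using le0 by (auto simp: mult_le_0_iff abs_if)
  finally have area: "measure lebesgue ?Q = \<bar>cross v w p - cross v w c\<bar> / 2" .
  have fr: "frontier ?Q \<subseteq> ?P"
    using c
  proof
    assume opp: "cross v w p * cross v w c < 0"
    have "frontier ?Q \<subseteq> frontier ?T1 \<union> frontier ?T2" by (rule frontier_Un_subset)
    also have "\<dots> \<subseteq> ?P \<union> open_segment v w"
      unfolding P by (auto simp: frontier_of_triangle closed_segment_commute open_segment_def)
    finally have 1: "frontier ?Q \<subseteq> ?P \<union> open_segment v w" .
    have "x \<notin> frontier ?Q" if "x \<in> open_segment v w" for x
    proof -
      obtain \<rho> where "\<rho> > 0" "ball x \<rho> \<subseteq> ?Q" using two_triangles_neighbourhood[OF \<open>x \<in> _\<close> opp] by blast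
      then have "x \<in> interior ?Q" using interior_maximal[of "ball x \<rho>" ?Q] by auto
      then show ?thesis by (simp add: frontier_def)
    qed
    then show ?thesis using 1 by blast
  next
    assume cs: "c \<in> closed_segment v w"
    have "c \<in> ?T1" using cs hull_mono[of "{v, w}" "{v, w, p}" convex] by (auto simp: segment_convex_hull)
    then have "?T2 \<subseteq> ?T1" by (intro hull_minimal) (auto intro: hull_inc)
    then have "?Q = ?T1" by blast
    moreover have "closed_segment v w = closed_segment v c \<union> closed_segment c w"
      using Un_closed_segment[OF cs] by simp
    ultimately show ?thesis unfolding P by (auto simp: frontier_of_triangle closed_segment_commute)
  qed
  have bQ: "bounded ?Q" by (simp add: bounded_convex_hull)
  have "interior ?Q \<subseteq> inside (frontier ?Q)" using bQ by (rule interior_inside_frontier)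
  then have "interior ?Q - ?P \<subseteq> inside ?P" using inside_mono[OF fr] by blast
  moreover have "?Q \<subseteq> interior ?Q \<union> frontier ?Q" unfolding frontier_def using closure_subset by blast
  ultimately have sub: "?Q \<subseteq> inside ?P \<union> ?P" using fr by blast
  have "bounded (inside ?P)" using boundedP by (rule bounded_inside)
  then have lm: "inside ?P \<in> lmeasurable" using open_inside[OF closedP] lmeasurable_open by blast
  have lmP: "?P \<in> lmeasurable" using negP by (rule negligible_imp_measurable)
  have lQ: "?Q \<in> lmeasurable" by (intro fmeasurable.Un lmeasurable_triangle)
  have "measure lebesgue ?Q \<le> measure lebesgue (inside ?P \<union> ?P)"
    using sub lm lmP lQ by (intro measure_mono_fmeasurable fmeasurable.Un) auto
  also have "\<dots> \<le> measure lebesgue (inside ?P) + measure lebesgue ?P"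
    using lm lmP by (intro measure_Un_le) auto
  also have "measure lebesgue ?P = 0" using negP by (rule negligible_imp_measure0)
  finally show ?thesis unfolding area polygon_region_def by simp
qed

text \<open>
  The cells are open and their edges are only in the closure, which inherits star-shapedness.
\<close>
lemma closure_star_shaped:
  assumes "star_shaped_at a S" "x \<in> closure S"
  shows "closed_segment a x \<subseteq> closure S"
proof
  fix y assume "y \<in> closed_segment a x"
  then obtain u where u: "0 \<le> u" "u \<le> 1" "y = (1 - u) *\<^sub>R a + u *\<^sub>R x" by (auto simp: in_segment)
  obtain f where f: "\<And>n. f n \<in> S" "f \<longlonglongrightarrow> x" using assms(2) by (auto simp: closure_sequential)
  have "(\<lambda>n. (1 - u) *\<^sub>R a + u *\<^sub>R f n) \<longlonglongrightarrow> y" unfolding u(3) by (intro tendsto_intros f)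
  moreover have "(1 - u) *\<^sub>R a + u *\<^sub>R f n \<in> S" for n
    using assms(1) f(1) u unfolding star_shaped_at_def by (force simp: in_segment)
  ultimately show "y \<in> closure S" unfolding closure_sequential
    by (intro exI[of _ "\<lambda>n. (1 - u) *\<^sub>R a + u *\<^sub>R f n"]) blast
qed

lemma star_triangle_subset:
  assumes star: "\<And>x. x \<in> C \<Longrightarrow> closed_segment c x \<subseteq> C" and ab: "closed_segment a b \<subseteq> C"
  shows "convex hull {a, b, c} \<subseteq> C"
proof
  fix y assume "y \<in> convex hull {a, b, c}"
  then have "y \<in> convex hull (insert c {a, b})" by (simp add: insert_commute)
  then obtain z where "z \<in> convex hull {a, b}" "y \<in> closed_segment c z"
    by (auto simp: convex_hull_insert_segments)
  then show "y \<in> C" using star[of z] ab by (auto simp: segment_convex_hull)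
qed

section \<open>Step functions and their variation along connected sets\<close>

type_synonym jump = "point \<times> point \<times> real \<times> real"

text \<open>
  A jump \<open>(a, b, p, q)\<close> is the segment from \<open>a\<close> to \<open>b\<close>
  together with the values \<open>p\<close> and \<open>q\<close> on its two sides. A set of tuples,
  rather than a family with an index type, lets one constant serve step functions with different
  kinds of indices.
\<close>
definition total_variation :: "jump set \<Rightarrow> real" where
  "total_variation E = (\<Sum>(a, b, p, q)\<in>E. dist a b * \<bar>p - q\<bar>)"

text \<open>
  The lines in direction \<open>d\<close> are the level sets of \<open>offset d\<close>.
\<close>
definition offset :: "point \<Rightarrow> point \<Rightarrow> real" where
  "offset d z = rot90 d \<bullet> z"

definition line_variation :: "point \<Rightarrow> jump set \<Rightarrow> real \<Rightarrow> real" where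
  "line_variation d E s = (\<Sum>(a, b, p, q)\<in>E. \<bar>p - q\<bar> * indicator (offset d ` closed_segment a b) s)"

text \<open>
  \<open>v\<close> is constant on finitely many open cells, and different values meet only at jumps
  that record them. The condition at an inner point is stated for closures of cells, so it also
  speaks about points on edges; finitely many points \<open>P\<close> (the ends of edges) are
  exempt. The last condition says that \<open>v\<close> vanishes on \<open>Z\<close>: if a cell with
  a nonzero value touches \<open>Z\<close>, a jump down to \<open>0\<close> is recorded there, up to
  a set \<open>N\<close> of zero length.
\<close>
definition step_function :: "point set \<Rightarrow> point set \<Rightarrow> (point \<Rightarrow> real) \<Rightarrow> jump set \<Rightarrow> bool" where
  "step_function \<Omega> Z v E \<longleftrightarrow> finite E \<and> v \<in> borel_measurable borel \<and>
     (\<exists>F P N. finite F \<and> finite P \<and> length_measure N = 0 \<and>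
        (\<forall>(V, c)\<in>F. open V \<and> (\<forall>x\<in>V. v x = c)) \<and>
        negligible (\<Omega> - \<Union>(fst ` F)) \<and>
        (\<forall>x\<in>\<Omega> - P. \<forall>(V, c)\<in>F. \<forall>(V', c')\<in>F.
           x \<in> closure V \<and> x \<in> closure V' \<and> c \<noteq> c' \<longrightarrow>
           (\<exists>(a, b, p, q)\<in>E. x \<in> closed_segment a b \<and> {c, c'} \<subseteq> {p, q})) \<and>
        (\<forall>x\<in>Z - N. \<forall>(V, c)\<in>F. x \<in> closure V \<and> c \<noteq> 0 \<longrightarrow>
           (\<exists>(a, b, p, q)\<in>E. x \<in> closed_segment a b \<and> {c, 0} \<subseteq> {p, q})))"

definition crossed_variation :: "jump set \<Rightarrow> point set \<Rightarrow> real" where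
  "crossed_variation E S = (\<Sum>(a, b, p, q)\<in>{(a, b, p, q)\<in>E. closed_segment a b \<inter> S \<noteq> {}}. \<bar>p - q\<bar>)"

lemma total_variation_nonneg: "0 \<le> total_variation E"
  by (auto simp: total_variation_def intro!: sum_nonneg)

lemma line_variation_nonneg: "0 \<le> line_variation d E s"
  by (auto simp: line_variation_def intro!: sum_nonneg)

lemma linear_offset: "linear (offset d)"
  unfolding offset_def by (intro linearI) (auto simp: inner_add_right)

lemma offset_add: "offset d (x + y) = offset d x + offset d y"
  by (simp add: offset_def inner_add_right)

lemma offset_scaleR: "offset d (c *\<^sub>R x) = c * offset d x"
  by (simp add: offset_def)

lemma offset_self [simp]: "offset d d = 0"
  by (simp add: offset_def)

text \<open>
  Let \<open>l\<close> be a level between \<open>c0\<close> and \<open>c1\<close>. The sets of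
  \<open>F\<close> with values at most \<open>l\<close> and those with values above \<open>l\<close>
  have closed unions that cover the connected set \<open>S\<close> and both meet it, so they have a
  common point on \<open>S\<close>, and at this point a jump crosses the level \<open>l\<close>.
  Hence the intervals of the jumps met by \<open>S\<close> cover \<open>{c0..<c1}\<close>, and
  lengths compare. Every jump counts once, however often \<open>S\<close> meets it.
\<close>
lemma level_set_chain:
  fixes F :: "(point set \<times> real) set"
  assumes S: "connected S" and F: "finite F" "\<And>K c. (K, c) \<in> F \<Longrightarrow> closed K" "S \<subseteq> \<Union>(fst ` F)" and E: "finite E"
    and meet: "\<And>x l K c K' c'. x \<in> S \<Longrightarrow> (K, c) \<in> F \<Longrightarrow> (K', c') \<in> F \<Longrightarrow> x \<in> K \<Longrightarrow> x \<in> K' \<Longrightarrow>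
       c \<le> l \<Longrightarrow> l < c' \<Longrightarrow> \<exists>(a, b, p, q)\<in>E. x \<in> closed_segment a b \<and> min p q \<le> l \<and> l < max p q"
    and K0: "(K0, c0) \<in> F" "S \<inter> K0 \<noteq> {}" and K1: "(K1, c1) \<in> F" "S \<inter> K1 \<noteq> {}"
  shows "c1 - c0 \<le> crossed_variation E S"
proof (cases "c0 < c1")
  case False
  have "0 \<le> crossed_variation E S" unfolding crossed_variation_def by (intro sum_nonneg) auto
  then show ?thesis using False by linarith
next
  case True
  let ?E' = "{(a, b, p, q)\<in>E. closed_segment a b \<inter> S \<noteq> {}}"
  have fin: "finite ?E'" by (rule finite_subset[OF _ E]) auto
  let ?I = "\<lambda>(a :: point, b :: point, p :: real, q). {min p q ..< max p q}"
  have "{c0..<c1} \<subseteq> (\<Union>e\<in>?E'. ?I e)"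
  proof
    fix l assume l: "l \<in> {c0..<c1}"
    define A where "A = \<Union>(fst ` {e \<in> F. snd e \<le> l})"
    define B where "B = \<Union>(fst ` {e \<in> F. l < snd e})"
    have "closed A" "closed B" using F(1,2) by (auto simp: A_def B_def intro!: closed_Union)
    moreover have "S \<subseteq> A \<union> B"
    proof
      fix x assume "x \<in> S"
      then obtain K c where "(K, c) \<in> F" "x \<in> K" using F(3) by fastforce
      then show "x \<in> A \<union> B" by (cases "c \<le> l") (force simp: A_def B_def)+
    qed
    moreover have "A \<inter> S \<noteq> {}" using K0 l by (force simp: A_def)
    moreover have "B \<inter> S \<noteq> {}" using K1 l by (force simp: B_def)
    ultimately have "A \<inter> B \<inter> S \<noteq> {}" using S unfolding connected_closed by blast
    then obtain x where x: "x \<in> S" "x \<in> A" "x \<in> B" by blast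
    then obtain K c K' c' where "(K, c) \<in> F" "x \<in> K" "c \<le> l" "(K', c') \<in> F" "x \<in> K'" "l < c'"
      by (auto simp: A_def B_def)
    from meet[OF x(1) this(1,4,2,5,3,6)] x(1)
    show "l \<in> (\<Union>e\<in>?E'. ?I e)" by force
  qed
  then have "measure lborel {c0..<c1} \<le> measure lborel (\<Union>e\<in>?E'. ?I e)"
    using fin by (intro measure_mono_fmeasurable fmeasurable.finite_UN) (auto simp: fmeasurable_def)
  also have "\<dots> \<le> (\<Sum>e\<in>?E'. measure lborel (?I e))"
    using fin by (intro measure_UNION_le) auto
  also have "\<dots> = crossed_variation E S" unfolding crossed_variation_def by (intro sum.cong) (auto simp: min_def max_def split: if_split_asm)
  finally show ?thesis using True by simp
qed

lemma crossed_le_line_variation: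
  assumes E: "finite E" and S: "\<And>y. y \<in> S \<Longrightarrow> offset d y = s"
  shows "crossed_variation E S \<le> line_variation d E s"
proof -
  let ?E' = "{(a, b, p, q)\<in>E. closed_segment a b \<inter> S \<noteq> {}}"
  have "crossed_variation E S \<le>
      (\<Sum>(a, b, p, q)\<in>?E'. \<bar>p - q\<bar> * indicator (offset d ` closed_segment a b) s)"
    unfolding crossed_variation_def using S by (intro sum_mono) (force simp: indicator_def image_iff)
  also have "\<dots> \<le> line_variation d E s"
    unfolding line_variation_def using E by (intro sum_mono2) auto
  finally show ?thesis .
qed

lemma crossed_le_line_variation2:
  assumes E: "finite E" and S: "\<And>y. y \<in> S \<Longrightarrow> offset d y = s \<or> offset d' y = s'"
  shows "crossed_variation E S \<le> line_variation d E s + line_variation d' E s'"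
proof -
  let ?E' = "{(a, b, p, q)\<in>E. closed_segment a b \<inter> S \<noteq> {}}"
  have "crossed_variation E S \<le>
      (\<Sum>(a, b, p, q)\<in>?E'. \<bar>p - q\<bar> * indicator (offset d ` closed_segment a b) s
         + \<bar>p - q\<bar> * indicator (offset d' ` closed_segment a b) s')"
    unfolding crossed_variation_def using S by (intro sum_mono) (force simp: indicator_def image_iff)
  also have "\<dots> \<le> (\<Sum>(a, b, p, q)\<in>E. \<bar>p - q\<bar> * indicator (offset d ` closed_segment a b) s
         + \<bar>p - q\<bar> * indicator (offset d' ` closed_segment a b) s')"
    using E by (intro sum_mono2) auto
  also have "\<dots> = line_variation d E s + line_variation d' E s'"
    unfolding line_variation_def by (simp add: sum.distrib case_prod_unfold)
  finally show ?thesis .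
qed

section \<open>Integrals of the variation along lines\<close>

text \<open>
  The offsets for two independent directions are linear coordinates of the plane.
\<close>
lemma parallelogram_measure:
  assumes "rot90 d \<bullet> d' \<noteq> 0"
  shows "\<exists>K>0. \<forall>a b c e. a \<le> b \<longrightarrow> c \<le> e \<longrightarrow>
     emeasure lborel {z. offset d z \<in> {a..b} \<and> offset d' z \<in> {c..e}} \<le> ennreal (K * (b - a) * (e - c))"
proof -
  let ?D = "rot90 d \<bullet> d'"
  define h :: "point \<Rightarrow> point" where "h y = (- (y $ 2) / ?D) *\<^sub>R d + (y $ 1 / ?D) *\<^sub>R d'" for y
  have lin: "linear h" unfolding h_def
    by (intro linearI) (auto simp: algebra_simps add_divide_distrib diff_divide_distrib)
  have inv: "h (vector [offset d z, offset d' z]) = z" for z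
    using assms by (simp add: h_def point_eq_iff offset_def inner_point divide_simps) algebra
  define K where "K = \<bar>det (matrix h)\<bar> + 1"
  show ?thesis
  proof (intro exI[of _ K] conjI allI impI)
    show "K > 0" by (simp add: K_def)
    fix a b c e :: real assume le: "a \<le> b" "c \<le> e"
    let ?B = "cbox (vector [a, c] :: point) (vector [b, e])"
    let ?S = "{z. offset d z \<in> {a..b} \<and> offset d' z \<in> {c..e}}"
    have "?S \<subseteq> h ` ?B"
    proof
      fix z assume "z \<in> ?S"
      then have "vector [offset d z, offset d' z] \<in> ?B" by (simp add: mem_box_cart forall_2)
      then show "z \<in> h ` ?B" using inv[of z] by (metis image_eqI)
    qed
    moreover have hB: "h ` ?B \<in> lmeasurable"
      by (intro measurable_linear_image lin) auto
    ultimately have "emeasure lebesgue ?S \<le> emeasure lebesgue (h ` ?B)"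
      by (intro emeasure_mono) auto
    also have "\<dots> = ennreal (measure lebesgue (h ` ?B))"
      using hB by (intro emeasure_eq_measure2) (auto simp: fmeasurable_def)
    also have "measure lebesgue (h ` ?B) = \<bar>det (matrix h)\<bar> * measure lebesgue ?B"
      by (intro measure_linear_image lin) auto
    also have "measure lebesgue ?B = (b - a) * (e - c)"
    proof -
      have "?B \<noteq> {}" using le by (simp add: interval_ne_empty_cart forall_2)
      then have "measure lborel ?B = (\<Prod>i\<in>UNIV. (vector [b, e] :: point) $ i - (vector [a, c] :: point) $ i)"
        by (rule content_cbox_cart)
      then show ?thesis by (simp add: prod_2 UNIV_2)
    qed
    also have "ennreal (\<bar>det (matrix h)\<bar> * ((b - a) * (e - c))) \<le> ennreal (K * (b - a) * (e - c))"
      using le by (intro ennreal_leI) (auto simp: K_def mult.assoc intro!: mult_right_mono)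
    finally have "emeasure lebesgue ?S \<le> ennreal (K * (b - a) * (e - c))" .
    moreover have "?S \<in> sets borel"
    proof -
      have "closed ?S" unfolding offset_def by (auto intro!: closed_Collect_conj closed_Collect_le continuous_intros)
      then show ?thesis by (rule borel_closed)
    qed
    ultimately show "emeasure lborel ?S \<le> ennreal (K * (b - a) * (e - c))" by simp
  qed
qed

lemma offset_segment:
  "offset d ` closed_segment a b = {min (offset d a) (offset d b) .. max (offset d a) (offset d b)}"
  using closed_segment_linear_image[OF linear_offset, of d a b]
  by (auto simp: closed_segment_eq_real_ivl min_def max_def)

lemma abs_offset_diff_le: "\<bar>offset d x - offset d y\<bar> \<le> norm d * dist x y"
  using Cauchy_Schwarz_ineq2[of "rot90 d" "x - y"] by (simp add: offset_def inner_diff_right dist_norm)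

lemma offset_measurable [measurable]: "offset d \<in> borel_measurable borel"
  unfolding offset_def by measurable

lemma offset_segment_preimage [measurable]:
  "{z. offset d z \<in> offset d ` closed_segment a b} \<in> sets borel"
proof -
  have "offset d -` (offset d ` closed_segment a b) \<inter> space borel \<in> sets borel"
    unfolding offset_segment by (rule measurable_sets[OF offset_measurable]) simp
  then show ?thesis by (simp add: vimage_def)
qed

lemma line_variation_measurable [measurable]: "(\<lambda>z. line_variation d E (offset d z)) \<in> borel_measurable borel"
proof -
  have "(\<lambda>z. indicator (offset d ` closed_segment a b) (offset d z) :: real) \<in> borel_measurable borel" for a b
    by (intro measurable_compose[OF offset_measurable] borel_measurable_indicator) (simp add: offset_segment)
  then show ?thesis unfolding line_variation_def by (auto intro!: borel_measurable_sum borel_measurable_times simp: case_prod_unfold)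
qed

text \<open>
  Common core of the next two estimates: the functions in question are finite sums of multiples of
  indicators of parallelograms.
\<close>
lemma integral_weighted_indicators:
  fixes g k :: "'e \<Rightarrow> real"
  assumes E: "finite E" and R: "\<And>e. e \<in> E \<Longrightarrow> R e \<in> sets M" "\<And>e. e \<in> E \<Longrightarrow> emeasure M (R e) \<le> ennreal (k e)"
    and nn: "\<And>e. e \<in> E \<Longrightarrow> 0 \<le> g e" "\<And>e. e \<in> E \<Longrightarrow> 0 \<le> k e"
    and f: "\<And>z. f z \<le> (\<Sum>e\<in>E. g e * indicator (R e) z)"
  shows "(\<integral>\<^sup>+ z. ennreal (f z) \<partial>M) \<le> ennreal (\<Sum>e\<in>E. g e * k e)"
proof -
  have "(\<integral>\<^sup>+ z. ennreal (f z) \<partial>M) \<le> (\<integral>\<^sup>+ z. (\<Sum>e\<in>E. ennreal (g e) * indicator (R e) z) \<partial>M)"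
  proof (rule nn_integral_mono)
    fix z
    have "ennreal (f z) \<le> ennreal (\<Sum>e\<in>E. g e * indicator (R e) z)" by (intro ennreal_leI f)
    also have "\<dots> = (\<Sum>e\<in>E. ennreal (g e) * indicator (R e) z)"
      using nn by (subst sum_ennreal[symmetric]) (auto simp: ennreal_mult'' ennreal_indicator)
    finally show "ennreal (f z) \<le> (\<Sum>e\<in>E. ennreal (g e) * indicator (R e) z)" .
  qed
  also have "\<dots> = (\<Sum>e\<in>E. ennreal (g e) * emeasure M (R e))"
    using R(1) by (subst nn_integral_sum) (auto simp: nn_integral_cmult_indicator)
  also have "\<dots> \<le> (\<Sum>e\<in>E. ennreal (g e) * ennreal (k e))"
    by (intro sum_mono mult_left_mono R(2)) auto
  also have "\<dots> = ennreal (\<Sum>e\<in>E. g e * k e)"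
    using nn by (subst sum_ennreal[symmetric]) (auto simp: ennreal_mult)
  finally show ?thesis .
qed

lemma offset_segment_width:
  "max (offset d a) (offset d b) - min (offset d a) (offset d b) \<le> norm d * dist a b"
  using abs_offset_diff_le[of d a b] by (simp add: max_def min_def abs_if split: if_splits)

text \<open>
  The step where the plane enters: a product of functions of two independent coordinates integrates
  to a product, so the total variation occurs squared, as the norm of \<open>v\<^sup>2\<close>
  demands.
\<close>
lemma integral_line_variation_product:
  assumes d: "rot90 d \<bullet> d' \<noteq> 0"
  shows "\<exists>K>0. \<forall>E. finite E \<longrightarrow>
    (\<integral>\<^sup>+ z. ennreal (line_variation d E (offset d z) * line_variation d' E (offset d' z)) \<partial>lborel)
      \<le> ennreal (K * (total_variation E)\<^sup>2)"
proof -
  obtain K where K: "K > 0" and K': "\<And>a b c e. a \<le> b \<Longrightarrow> c \<le> e \<Longrightarrow>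
     emeasure lborel {z. offset d z \<in> {a..b} \<and> offset d' z \<in> {c..e}} \<le> ennreal (K * (b - a) * (e - c))"
    using parallelogram_measure[OF d] by blast
  have dn: "norm d > 0" "norm d' > 0" using d by (auto simp: inner_point)
  define k where "k = K * norm d * norm d'"
  show ?thesis
  proof (intro exI[of _ k] conjI allI impI)
    show "k > 0" using K dn by (simp add: k_def)
    fix E :: "jump set" assume E: "finite E"
    define g :: "jump \<times> jump \<Rightarrow> real" where "g = (\<lambda>((a, b, p, q), (a', b', p', q')). \<bar>p - q\<bar> * \<bar>p' - q'\<bar>)"
    define l :: "jump \<times> jump \<Rightarrow> real" where "l = (\<lambda>((a, b, p, q), (a', b', p', q')). dist a b * dist a' b')"
    define R :: "jump \<times> jump \<Rightarrow> point set" where "R = (\<lambda>((a, b, p, q), (a', b', p', q')).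
       {z. offset d z \<in> offset d ` closed_segment a b \<and> offset d' z \<in> offset d' ` closed_segment a' b'})"
    have W: "line_variation d E (offset d z) * line_variation d' E (offset d' z)
        = (\<Sum>x\<in>E \<times> E. g x * indicator (R x) z)" for z
      unfolding line_variation_def sum_product sum.cartesian_product
      by (intro sum.cong refl) (auto simp: g_def R_def indicator_def)
    have "(\<integral>\<^sup>+ z. ennreal (line_variation d E (offset d z) * line_variation d' E (offset d' z)) \<partial>lborel)
        \<le> ennreal (\<Sum>x\<in>E \<times> E. g x * (k * l x))"
    proof (rule integral_weighted_indicators[where R = R])
      fix x assume "x \<in> E \<times> E"
      obtain a b p q a' b' p' q' where x: "x = ((a, b, p, q), (a', b', p', q'))"
        by (metis surj_pair)
      have "R x = {z. offset d z \<in> offset d ` closed_segment a b} \<inter> {z. offset d' z \<in> offset d' ` closed_segment a' b'}"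
        by (auto simp: R_def x)
      then show "R x \<in> sets lborel" by (simp add: offset_segment_preimage)
      have "emeasure lborel (R x) \<le>
         ennreal (K * (max (offset d a) (offset d b) - min (offset d a) (offset d b))
                    * (max (offset d' a') (offset d' b') - min (offset d' a') (offset d' b')))"
        unfolding R_def x using K' by (simp add: offset_segment)
      also have "\<dots> \<le> ennreal (K * (norm d * dist a b) * (norm d' * dist a' b'))"
        using K by (intro ennreal_leI mult_mono mult_nonneg_nonneg offset_segment_width order_refl) auto
      finally show "emeasure lborel (R x) \<le> ennreal (k * l x)" by (simp add: x l_def k_def ac_simps)
      show "0 \<le> g x" "0 \<le> k * l x" using K by (simp_all add: x g_def l_def k_def)
    qed (use E W in auto)
    also have "(\<Sum>x\<in>E \<times> E. g x * (k * l x)) = k * (total_variation E)\<^sup>2"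
    proof -
      have "(total_variation E)\<^sup>2 = (\<Sum>x\<in>E \<times> E. g x * l x)"
        unfolding total_variation_def power2_eq_square sum_product sum.cartesian_product
        by (intro sum.cong refl) (auto simp: g_def l_def)
      then show ?thesis by (simp add: sum_distrib_left mult.left_commute)
    qed
    finally show "(\<integral>\<^sup>+ z. ennreal (line_variation d E (offset d z) * line_variation d' E (offset d' z)) \<partial>lborel)
      \<le> ennreal (k * (total_variation E)\<^sup>2)" .
  qed
qed

lemma integral_line_variation:
  assumes d: "rot90 d \<bullet> d' \<noteq> 0" and A: "bounded A"
  shows "\<exists>K>0. \<forall>E. finite E \<longrightarrow>
    (\<integral>\<^sup>+ z. ennreal (line_variation d E (offset d z)) * indicator A z \<partial>lborel) \<le> ennreal (K * total_variation E)"
proof -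
  obtain K where K: "K > 0" and K': "\<And>a b c e. a \<le> b \<Longrightarrow> c \<le> e \<Longrightarrow>
     emeasure lborel {z. offset d z \<in> {a..b} \<and> offset d' z \<in> {c..e}} \<le> ennreal (K * (b - a) * (e - c))"
    using parallelogram_measure[OF d] by blast
  have dn: "norm d > 0" "norm d' > 0" using d by (auto simp: inner_point)
  obtain B where B: "B > 0" "\<And>z. z \<in> A \<Longrightarrow> norm z \<le> B" using A by (auto simp: bounded_pos)
  define r where "r = norm d' * B"
  have r: "r > 0" using B dn by (simp add: r_def)
  have off: "offset d' z \<in> {-r..r}" if "z \<in> A" for z
  proof -
    have "\<bar>offset d' z\<bar> \<le> norm d' * norm z" using abs_offset_diff_le[of d' z 0] by (simp add: offset_def)
    also have "\<dots> \<le> r" unfolding r_def using B(2)[OF that] dn by simp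
    finally show ?thesis by auto
  qed
  define k where "k = K * norm d * (2 * r)"
  show ?thesis
  proof (intro exI[of _ k] conjI allI impI)
    show "k > 0" using K dn r by (simp add: k_def)
    fix E :: "jump set" assume E: "finite E"
    define g :: "jump \<Rightarrow> real" where "g = (\<lambda>(a, b, p, q). \<bar>p - q\<bar>)"
    define l :: "jump \<Rightarrow> real" where "l = (\<lambda>(a, b, p, q). dist a b)"
    define R :: "jump \<Rightarrow> point set" where "R = (\<lambda>(a, b, p, q).
       {z. offset d z \<in> offset d ` closed_segment a b \<and> offset d' z \<in> {-r..r}})"
    have W: "line_variation d E (offset d z) * indicator A z \<le> (\<Sum>e\<in>E. g e * indicator (R e) z)" for z
      unfolding line_variation_def sum_distrib_right
    proof (rule sum_mono, clarify)
      fix a b p q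
      show "\<bar>p - q\<bar> * indicator (offset d ` closed_segment a b) (offset d z) * indicator A z
          \<le> g (a, b, p, q) * indicator (R (a, b, p, q)) z"
        using off[of z] by (cases "offset d z \<in> offset d ` closed_segment a b") (auto simp: g_def R_def split: split_indicator)
    qed
    have "(\<integral>\<^sup>+ z. ennreal (line_variation d E (offset d z)) * indicator A z \<partial>lborel)
        = (\<integral>\<^sup>+ z. ennreal (line_variation d E (offset d z) * indicator A z) \<partial>lborel)"
      by (intro nn_integral_cong) (simp add: ennreal_mult'' ennreal_indicator)
    also have "\<dots> \<le> ennreal (\<Sum>e\<in>E. g e * (k * l e))"
    proof (rule integral_weighted_indicators[where R = R, OF E _ _ _ _ W])
      fix e assume "e \<in> E"
      obtain a b p q where e: "e = (a, b, p, q)" by (cases e) auto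
      have "closed {z. offset d' z \<in> {-r..r}}" unfolding offset_def
        by (auto intro!: closed_Collect_conj closed_Collect_le continuous_intros)
      moreover have "R e = {z. offset d z \<in> offset d ` closed_segment a b} \<inter> {z. offset d' z \<in> {-r..r}}"
        by (auto simp: R_def e)
      ultimately show "R e \<in> sets lborel" by (simp add: offset_segment_preimage borel_closed)
      have "emeasure lborel (R e) \<le>
         ennreal (K * (max (offset d a) (offset d b) - min (offset d a) (offset d b)) * (r - (- r)))"
        unfolding R_def e using K'[of _ _ "-r" r] r by (simp add: offset_segment)
      also have "\<dots> \<le> ennreal (K * (norm d * dist a b) * (2 * r))"
        using K r by (intro ennreal_leI mult_mono mult_nonneg_nonneg offset_segment_width order_refl) auto
      finally show "emeasure lborel (R e) \<le> ennreal (k * l e)" by (simp add: e l_def k_def ac_simps)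
      show "0 \<le> g e" "0 \<le> k * l e" using K r by (simp_all add: e g_def l_def k_def)
    qed
    also have "(\<Sum>e\<in>E. g e * (k * l e)) = k * total_variation E"
      unfolding total_variation_def sum_distrib_left
      by (intro sum.cong refl) (auto simp: g_def l_def)
    finally show "(\<integral>\<^sup>+ z. ennreal (line_variation d E (offset d z)) * indicator A z \<partial>lborel)
      \<le> ennreal (k * total_variation E)" .
  qed
qed

lemma negligible_AE_lborel:
  fixes S :: "point set"
  shows "negligible S \<Longrightarrow> AE x in lborel. x \<notin> S"
  by (metis AE_completion_iff AE_not_in negligible_iff_null_sets)

lemma AE_offset_avoids_finite:
  assumes "d \<noteq> 0" "finite P"
  shows "AE z in lborel. offset d z \<notin> offset d ` P"
proof -
  have "rot90 d \<noteq> 0" using assms(1) by (metis norm_eq_zero norm_rot90)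
  then have "negligible {z. offset d z = s}" for s
    unfolding offset_def by (intro negligible_hyperplane) auto
  then have "negligible (\<Union>x\<in>P. {z. offset d z = offset d x})"
    using assms(2) by (intro negligible_Union) auto
  then have "AE z in lborel. z \<notin> (\<Union>x\<in>P. {z. offset d z = offset d x})" by (rule negligible_AE_lborel)
  then show ?thesis by eventually_elim auto
qed

text \<open>
  Projection along \<open>d\<close> does not increase lengths much, so a cover of \<open>N\<close>
  by small sets yields a cover by thin strips, whose areas in a bounded region are proportional to
  the diameters.
\<close>
lemma AE_offset_avoids_null_length:
  assumes d: "d \<noteq> 0" and N: "length_measure N = 0"
  shows "AE z in lborel. offset d z \<notin> offset d ` N"
proof -
  define d' where "d' = rot90 d"
  have dd: "rot90 d \<bullet> d' \<noteq> 0" using d by (simp add: d'_def) (metis norm_eq_zero norm_rot90)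
  obtain K where K: "K > 0" and K': "\<And>a b c e. a \<le> b \<Longrightarrow> c \<le> e \<Longrightarrow>
     emeasure lborel {z. offset d z \<in> {a..b} \<and> offset d' z \<in> {c..e}} \<le> ennreal (K * (b - a) * (e - c))"
    using parallelogram_measure[OF dd] by blast
  let ?X = "\<lambda>R::nat. {z. offset d z \<in> offset d ` N \<and> offset d' z \<in> {- real R .. real R}}"
  have "negligible (?X R)" for R
    unfolding negligible_outer_le
  proof (intro allI impI)
    fix e :: real assume e: "e > 0"
    define k where "k = K * (4 * norm d * (real R + 1))"
    have k: "k > 0" using K d by (simp add: k_def)
    have "(INF U\<in>{U :: nat \<Rightarrow> point set. N \<subseteq> (\<Union>n. U n) \<and> (\<forall>n. bounded (U n) \<and> diameter (U n) \<le> 1)}.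
        \<Sum>n. ennreal (diameter (U n))) \<le> length_measure N"
      unfolding length_measure_def by (intro SUP_upper) auto
    also have "\<dots> < ennreal (e / k)" using N e k by simp
    finally obtain U :: "nat \<Rightarrow> point set" where U: "N \<subseteq> (\<Union>n. U n)" "\<And>n. bounded (U n)"
       "(\<Sum>n. ennreal (diameter (U n))) < ennreal (e / k)"
      unfolding INF_less_iff by blast
    define u where "u n = (SOME x. x \<in> U n)" for n
    define D where "D n = norm d * diameter (U n)" for n
    have D0: "D n \<ge> 0" for n unfolding D_def using U(2) by (intro mult_nonneg_nonneg diameter_ge_0) auto
    define Q where "Q n = {z. offset d z \<in> {offset d (u n) - D n .. offset d (u n) + D n} \<and> offset d' z \<in> {- real R .. real R}}" for n
    have Qm: "Q n \<in> sets lborel" for n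
    proof -
      have "closed (Q n)" unfolding offset_def Q_def
        by (auto intro!: closed_Collect_conj closed_Collect_le continuous_intros)
      then show ?thesis by (simp add: borel_closed)
    qed
    have "emeasure lborel (\<Union>n. Q n) \<le> (\<Sum>n. emeasure lborel (Q n))"
      using Qm by (intro emeasure_subadditive_countably) auto
    also have "\<dots> \<le> (\<Sum>n. ennreal k * ennreal (diameter (U n)))"
    proof (intro suminf_le allI)
      fix n
      have "emeasure lborel (Q n) \<le> ennreal (K * (offset d (u n) + D n - (offset d (u n) - D n)) * (real R - (- real R)))"
        unfolding Q_def using D0[of n] by (intro K') auto
      also have "\<dots> \<le> ennreal (k * diameter (U n))"
      proof (intro ennreal_leI)
        have "K * (2 * D n) * (2 * real R) \<le> K * (2 * D n) * (2 * (real R + 1))"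
          using K D0[of n] by (intro mult_left_mono) auto
        then show "K * (offset d (u n) + D n - (offset d (u n) - D n)) * (real R - - real R) \<le> k * diameter (U n)"
          by (simp add: k_def D_def algebra_simps)
      qed
      also have "\<dots> = ennreal k * ennreal (diameter (U n))" using k diameter_ge_0[OF U(2)[of n]] by (simp add: ennreal_mult)
      finally show "emeasure lborel (Q n) \<le> ennreal k * ennreal (diameter (U n))" .
    qed auto
    also have "\<dots> = ennreal k * (\<Sum>n. ennreal (diameter (U n)))" by simp
    also have "\<dots> \<le> ennreal k * ennreal (e / k)" using U(3) by (intro mult_left_mono) auto
    also have "\<dots> = ennreal e" using k e by (simp flip: ennreal_mult)
    finally have em: "emeasure lborel (\<Union>n. Q n) \<le> ennreal e" .
    have Um: "(\<Union>n. Q n) \<in> sets lborel" using Qm by blast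
    show "\<exists>T. ?X R \<subseteq> T \<and> T \<in> lmeasurable \<and> measure lebesgue T \<le> e"
    proof (intro exI conjI)
      show "?X R \<subseteq> (\<Union>n. Q n)"
      proof
        fix z assume "z \<in> ?X R"
        then obtain x where x: "x \<in> N" "offset d z = offset d x" "offset d' z \<in> {- real R .. real R}" by auto
        obtain n where n: "x \<in> U n" using U(1) x by auto
        then have "u n \<in> U n" unfolding u_def by (rule someI)
        then have "\<bar>offset d x - offset d (u n)\<bar> \<le> D n"
          using abs_offset_diff_le[of d x "u n"] diameter_bounded_bound[OF U(2) n \<open>u n \<in> U n\<close>]
          unfolding D_def by (meson mult_left_mono norm_ge_zero order_trans)
        then have "z \<in> Q n" using x by (auto simp: Q_def)
        then show "z \<in> (\<Union>n. Q n)" by blast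
      qed
      have "emeasure lebesgue (\<Union>n. Q n) \<le> ennreal e" using em Um by simp
      then show "(\<Union>n. Q n) \<in> lmeasurable" using Um
        by (intro fmeasurableI) (auto intro: le_less_trans[OF _ ennreal_less_top])
      show "measure lebesgue (\<Union>n. Q n) \<le> e"
        unfolding measure_def using \<open>emeasure lebesgue (\<Union>n. Q n) \<le> ennreal e\<close> e
        by (intro enn2real_leI) auto
    qed
  qed
  then have "negligible (\<Union>R. ?X R)" by (rule negligible_Union_nat)
  then have "AE z in lborel. z \<notin> (\<Union>R. ?X R)" by (rule negligible_AE_lborel)
  then show ?thesis
  proof eventually_elim
    case (elim z)
    obtain R :: nat where "\<bar>offset d' z\<bar> \<le> real R" using real_arch_simple by blast
    then show ?case using elim by (auto simp: abs_le_iff image_iff intro!: bexI exI[of _ R])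
  qed
qed

section \<open>Propagation of the Sobolev inequality\<close>

text \<open>
  The property that is propagated through \<open>\<Omega>\<close>. The variation is that of all of
  \<open>\<Omega>\<close>, while the norms are local; the first power is needed to pick good points
  in \<open>sobolev_set_transfer\<close>, the second is the goal.
\<close>
definition sobolev_set :: "point set \<Rightarrow> point set \<Rightarrow> point set \<Rightarrow> bool" where
  "sobolev_set \<Omega> Z A \<longleftrightarrow> (\<exists>C>0. \<forall>v E. step_function \<Omega> Z v E \<longrightarrow>
     (\<integral>\<^sup>+ z. ennreal \<bar>v z\<bar> * indicator A z \<partial>lborel) \<le> ennreal (C * total_variation E) \<and>
     (\<integral>\<^sup>+ z. ennreal ((v z)\<^sup>2) * indicator A z \<partial>lborel) \<le> ennreal ((C * total_variation E)\<^sup>2))"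

lemma sobolev_set_subset:
  assumes "sobolev_set \<Omega> Z B" "A \<subseteq> B"
  shows "sobolev_set \<Omega> Z A"
proof -
  from assms(1) obtain C where C: "C > 0" "\<And>v E. step_function \<Omega> Z v E \<Longrightarrow>
     (\<integral>\<^sup>+ z. ennreal \<bar>v z\<bar> * indicator B z \<partial>lborel) \<le> ennreal (C * total_variation E) \<and>
     (\<integral>\<^sup>+ z. ennreal ((v z)\<^sup>2) * indicator B z \<partial>lborel) \<le> ennreal ((C * total_variation E)\<^sup>2)"
    unfolding sobolev_set_def by blast
  have "(\<integral>\<^sup>+ z. f z * indicator A z \<partial>lborel) \<le> (\<integral>\<^sup>+ z. f z * indicator B z \<partial>lborel)"
    for f :: "point \<Rightarrow> ennreal"
    using assms(2) by (intro nn_integral_mono) (auto simp: indicator_def)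
  then show ?thesis unfolding sobolev_set_def using C by (meson order_trans)
qed

lemma sobolev_set_Un:
  assumes "sobolev_set \<Omega> Z A" "sobolev_set \<Omega> Z B" and [measurable]: "A \<in> sets borel" "B \<in> sets borel"
  shows "sobolev_set \<Omega> Z (A \<union> B)"
proof -
  from assms(1) obtain C where C: "C > 0" "\<And>v E. step_function \<Omega> Z v E \<Longrightarrow>
     (\<integral>\<^sup>+ z. ennreal \<bar>v z\<bar> * indicator A z \<partial>lborel) \<le> ennreal (C * total_variation E) \<and>
     (\<integral>\<^sup>+ z. ennreal ((v z)\<^sup>2) * indicator A z \<partial>lborel) \<le> ennreal ((C * total_variation E)\<^sup>2)"
    unfolding sobolev_set_def by blast
  from assms(2) obtain D where D: "D > 0" "\<And>v E. step_function \<Omega> Z v E \<Longrightarrow>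
     (\<integral>\<^sup>+ z. ennreal \<bar>v z\<bar> * indicator B z \<partial>lborel) \<le> ennreal (D * total_variation E) \<and>
     (\<integral>\<^sup>+ z. ennreal ((v z)\<^sup>2) * indicator B z \<partial>lborel) \<le> ennreal ((D * total_variation E)\<^sup>2)"
    unfolding sobolev_set_def by blast
  show ?thesis unfolding sobolev_set_def
  proof (intro exI[of _ "C + D"] conjI allI impI)
    show "C + D > 0" using C D by simp
    fix v E assume st: "step_function \<Omega> Z v E"
    then have [measurable]: "v \<in> borel_measurable borel" by (simp add: step_function_def)
    let ?T = "total_variation E"
    have T: "?T \<ge> 0" by (rule total_variation_nonneg)
    have un: "(\<integral>\<^sup>+ z. f z * indicator (A \<union> B) z \<partial>lborel) \<le>
       (\<integral>\<^sup>+ z. f z * indicator A z \<partial>lborel) + (\<integral>\<^sup>+ z. f z * indicator B z \<partial>lborel)"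
      if [measurable]: "f \<in> borel_measurable borel" for f :: "point \<Rightarrow> ennreal"
      by (subst nn_integral_add[symmetric]) (auto intro!: nn_integral_mono simp: indicator_def)
    show "(\<integral>\<^sup>+ z. ennreal \<bar>v z\<bar> * indicator (A \<union> B) z \<partial>lborel) \<le> ennreal ((C + D) * ?T)"
    proof -
      have "(\<integral>\<^sup>+ z. ennreal \<bar>v z\<bar> * indicator (A \<union> B) z \<partial>lborel) \<le> ennreal (C * ?T) + ennreal (D * ?T)"
        by (rule order_trans[OF un add_mono]) (use C(2)[OF st] D(2)[OF st] in auto)
      then show ?thesis using C(1) D(1) T by (simp add: distrib_right)
    qed
    show "(\<integral>\<^sup>+ z. ennreal ((v z)\<^sup>2) * indicator (A \<union> B) z \<partial>lborel) \<le> ennreal (((C + D) * ?T)\<^sup>2)"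
    proof -
      have "(\<integral>\<^sup>+ z. ennreal ((v z)\<^sup>2) * indicator (A \<union> B) z \<partial>lborel) \<le> ennreal ((C * ?T)\<^sup>2) + ennreal ((D * ?T)\<^sup>2)"
        by (rule order_trans[OF un add_mono]) (use C(2)[OF st] D(2)[OF st] in auto)
      also have "\<dots> = ennreal ((C * ?T)\<^sup>2 + (D * ?T)\<^sup>2)" by simp
      also have "\<dots> \<le> ennreal (((C + D) * ?T)\<^sup>2)"
      proof (rule ennreal_leI)
        have "0 \<le> 2 * (C * ?T) * (D * ?T)" using C(1) D(1) T by simp
        then show "(C * ?T)\<^sup>2 + (D * ?T)\<^sup>2 \<le> ((C + D) * ?T)\<^sup>2"
          by (simp add: distrib_right power2_sum)
      qed
      finally show ?thesis .
    qed
  qed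
qed

lemma sobolev_set_empty: "sobolev_set \<Omega> Z {}"
  unfolding sobolev_set_def by (intro exI[of _ 1]) auto

lemma sobolev_set_Union:
  assumes "finite \<A>" "\<And>A. A \<in> \<A> \<Longrightarrow> sobolev_set \<Omega> Z A" "\<And>A. A \<in> \<A> \<Longrightarrow> A \<in> sets borel"
  shows "sobolev_set \<Omega> Z (\<Union>\<A>)"
  using assms
proof (induction \<A>)
  case (insert A \<A>)
  then have "\<Union>\<A> \<in> sets borel" by (intro sets.finite_Union) auto
  then show ?case using insert by (auto intro!: sobolev_set_Un)
qed (simp add: sobolev_set_empty)

text \<open>
  The inequality of Gagliardo and Nirenberg: \<open>v\<^sup>2\<close> is at most the product of the
  two bounds, and the four terms of this product have integrals of order \<open>TV\<^sup>2\<close>.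
\<close>
lemma two_directions_sobolev:
  assumes A: "A \<in> sets borel" "bounded A" and d: "rot90 d \<bullet> d' \<noteq> 0" and C0: "C0 \<ge> 0"
    and bound: "\<And>v E. step_function \<Omega> Z v E \<Longrightarrow>
      \<exists>k. 0 \<le> k \<and> k \<le> C0 * total_variation E \<and> (AE z in lborel. z \<in> A \<longrightarrow>
         \<bar>v z\<bar> \<le> k + line_variation d E (offset d z) \<and> \<bar>v z\<bar> \<le> k + line_variation d' E (offset d' z))"
  shows "sobolev_set \<Omega> Z A"
proof -
  note [measurable] = A(1)
  have d': "rot90 d' \<bullet> d \<noteq> 0" using d by (simp add: inner_point algebra_simps)
  obtain K1 where K1: "K1 > 0" "\<And>E. finite E \<Longrightarrow>
    (\<integral>\<^sup>+ z. ennreal (line_variation d E (offset d z)) * indicator A z \<partial>lborel) \<le> ennreal (K1 * total_variation E)"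
    using integral_line_variation[OF d A(2)] by blast
  obtain K2 where K2: "K2 > 0" "\<And>E. finite E \<Longrightarrow>
    (\<integral>\<^sup>+ z. ennreal (line_variation d' E (offset d' z)) * indicator A z \<partial>lborel) \<le> ennreal (K2 * total_variation E)"
    using integral_line_variation[OF d' A(2)] by blast
  obtain K where K: "K > 0" "\<And>E. finite E \<Longrightarrow>
    (\<integral>\<^sup>+ z. ennreal (line_variation d E (offset d z) * line_variation d' E (offset d' z)) \<partial>lborel)
      \<le> ennreal (K * (total_variation E)\<^sup>2)"
    using integral_line_variation_product[OF d] by blast
  define m where "m = measure lborel A"
  have fin: "emeasure lborel A < \<infinity>" using emeasure_bounded_finite[OF A(2)] by simp
  have m: "emeasure lborel A = ennreal m" "m \<ge> 0" using fin by (auto simp: m_def emeasure_eq_ennreal_measure)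
  have int_k: "(\<integral>\<^sup>+ z. ennreal c * indicator A z \<partial>lborel) = ennreal (c * m)" if "c \<ge> 0" for c
    using that m by (simp add: nn_integral_cmult_indicator ennreal_mult)
  define c1 where "c1 = C0 * m + K1"
  define c2 where "c2 = C0 * C0 * m + C0 * K1 + C0 * K2 + K"
  have c0: "c1 \<ge> 0" "c2 \<ge> 0" using C0 m K1 K2 K by (auto simp: c1_def c2_def)
  show ?thesis unfolding sobolev_set_def
  proof (intro exI[of _ "1 + c1 + c2"] conjI allI impI)
    show "1 + c1 + c2 > 0" using c0 by simp
    fix v E assume st: "step_function \<Omega> Z v E"
    then have [measurable]: "v \<in> borel_measurable borel" and E: "finite E" by (simp_all add: step_function_def)
    let ?T = "total_variation E" and ?W1 = "\<lambda>z. line_variation d E (offset d z)"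
    let ?W2 = "\<lambda>z. line_variation d' E (offset d' z)"
    have T: "?T \<ge> 0" by (rule total_variation_nonneg)
    have W: "?W1 z \<ge> 0" "?W2 z \<ge> 0" for z by (rule line_variation_nonneg)+
    obtain k where k: "0 \<le> k" "k \<le> C0 * ?T" and ae: "AE z in lborel. z \<in> A \<longrightarrow> \<bar>v z\<bar> \<le> k + ?W1 z \<and> \<bar>v z\<bar> \<le> k + ?W2 z"
      using bound[OF st] by blast
    have I1: "(\<integral>\<^sup>+ z. ennreal (?W1 z) * indicator A z \<partial>lborel) \<le> ennreal (K1 * ?T)"
      and I2: "(\<integral>\<^sup>+ z. ennreal (?W2 z) * indicator A z \<partial>lborel) \<le> ennreal (K2 * ?T)"
      and I3: "(\<integral>\<^sup>+ z. ennreal (?W1 z * ?W2 z) \<partial>lborel) \<le> ennreal (K * ?T\<^sup>2)"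
      using K1(2) K2(2) K(2) E by auto
    have kC: "ennreal k \<le> ennreal (C0 * ?T)" using k by (intro ennreal_leI)
    show "(\<integral>\<^sup>+ z. ennreal \<bar>v z\<bar> * indicator A z \<partial>lborel) \<le> ennreal ((1 + c1 + c2) * ?T)"
    proof -
      have "(\<integral>\<^sup>+ z. ennreal \<bar>v z\<bar> * indicator A z \<partial>lborel)
          \<le> (\<integral>\<^sup>+ z. ennreal k * indicator A z + ennreal (?W1 z) * indicator A z \<partial>lborel)"
        using ae k W by (intro nn_integral_mono_AE) (auto elim!: eventually_mono simp: indicator_def simp flip: ennreal_plus)
      also have "\<dots> = (\<integral>\<^sup>+ z. ennreal k * indicator A z \<partial>lborel) + (\<integral>\<^sup>+ z. ennreal (?W1 z) * indicator A z \<partial>lborel)"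
        by (intro nn_integral_add) auto
      also have "\<dots> \<le> ennreal (k * m) + ennreal (K1 * ?T)" using int_k[OF k(1)] I1 by (intro add_mono) auto
      also have "\<dots> = ennreal (k * m + K1 * ?T)" using k m K1 T by simp
      also have "\<dots> \<le> ennreal ((1 + c1 + c2) * ?T)"
      proof (rule ennreal_leI)
        have "k * m + K1 * ?T \<le> C0 * ?T * m + K1 * ?T" using k m by (intro add_right_mono mult_right_mono) auto
        also have "\<dots> = c1 * ?T" by (simp add: c1_def algebra_simps)
        also have "\<dots> \<le> (1 + c1 + c2) * ?T" using c0 T by (intro mult_right_mono) auto
        finally show "k * m + K1 * ?T \<le> (1 + c1 + c2) * ?T" .
      qed
      finally show ?thesis .
    qed
    show "(\<integral>\<^sup>+ z. ennreal ((v z)\<^sup>2) * indicator A z \<partial>lborel) \<le> ennreal (((1 + c1 + c2) * ?T)\<^sup>2)"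
    proof -
      have "(\<integral>\<^sup>+ z. ennreal ((v z)\<^sup>2) * indicator A z \<partial>lborel)
          \<le> (\<integral>\<^sup>+ z. ennreal (k * k) * indicator A z + (ennreal k * (ennreal (?W1 z) * indicator A z)
               + (ennreal k * (ennreal (?W2 z) * indicator A z) + ennreal (?W1 z * ?W2 z))) \<partial>lborel)"
      proof (intro nn_integral_mono_AE, use ae in eventually_elim)
        case (elim z)
        show ?case
        proof (cases "z \<in> A")
          case True
          then have "(v z)\<^sup>2 \<le> (k + ?W1 z) * (k + ?W2 z)"
            using elim mult_mono[of "\<bar>v z\<bar>" "k + ?W1 z" "\<bar>v z\<bar>" "k + ?W2 z"] k W[of z]
            by (simp add: power2_eq_square)
          also have "\<dots> = k * k + (k * ?W1 z + (k * ?W2 z + ?W1 z * ?W2 z))" by (simp add: algebra_simps)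
          finally have "ennreal ((v z)\<^sup>2) \<le> ennreal (k * k + (k * ?W1 z + (k * ?W2 z + ?W1 z * ?W2 z)))"
            by (rule ennreal_leI)
          also have "\<dots> = ennreal (k * k) + (ennreal k * ennreal (?W1 z) + (ennreal k * ennreal (?W2 z) + ennreal (?W1 z * ?W2 z)))"
            using k W[of z] by (simp flip: ennreal_plus ennreal_mult)
          finally show ?thesis using True by simp
        qed simp
      qed
      also have "\<dots> = (\<integral>\<^sup>+ z. ennreal (k * k) * indicator A z \<partial>lborel)
          + (ennreal k * (\<integral>\<^sup>+ z. ennreal (?W1 z) * indicator A z \<partial>lborel)
           + (ennreal k * (\<integral>\<^sup>+ z. ennreal (?W2 z) * indicator A z \<partial>lborel) + (\<integral>\<^sup>+ z. ennreal (?W1 z * ?W2 z) \<partial>lborel)))"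
        by (simp add: nn_integral_add nn_integral_cmult)
      also have "\<dots> \<le> ennreal (k * k * m) + (ennreal (C0 * ?T) * ennreal (K1 * ?T)
           + (ennreal (C0 * ?T) * ennreal (K2 * ?T) + ennreal (K * ?T\<^sup>2)))"
        using int_k[of "k * k"] k(1) by (intro add_mono mult_mono I1 I2 I3 kC) auto
      also have "\<dots> = ennreal (k * k * m + (C0 * ?T * (K1 * ?T) + (C0 * ?T * (K2 * ?T) + K * ?T\<^sup>2)))"
        using k(1) m C0 T K1 K2 K by (simp flip: ennreal_plus ennreal_mult)
      also have "\<dots> \<le> ennreal (((1 + c1 + c2) * ?T)\<^sup>2)"
      proof (rule ennreal_leI)
        have "k * k * m \<le> (C0 * ?T) * (C0 * ?T) * m" using k m C0 T by (intro mult_mono) auto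
        then have "k * k * m + (C0 * ?T * (K1 * ?T) + (C0 * ?T * (K2 * ?T) + K * ?T\<^sup>2)) \<le> c2 * ?T\<^sup>2"
          by (simp add: c2_def algebra_simps power2_eq_square)
        also have "\<dots> \<le> (1 + c1 + c2)\<^sup>2 * ?T\<^sup>2"
        proof (rule mult_right_mono)
          have "c2 \<le> 1 + c1 + c2" using c0 by simp
          also have "\<dots> \<le> (1 + c1 + c2)\<^sup>2" using c0 by (intro self_le_power) auto
          finally show "c2 \<le> (1 + c1 + c2)\<^sup>2" .
        qed simp
        finally show "k * k * m + (C0 * ?T * (K1 * ?T) + (C0 * ?T * (K2 * ?T) + K * ?T\<^sup>2)) \<le> ((1 + c1 + c2) * ?T)\<^sup>2"
          by (simp add: power_mult_distrib)
      qed
      finally show ?thesis .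
    qed
  qed
qed

lemma below_average_point:
  assumes [measurable]: "B \<in> sets M" "f \<in> borel_measurable M"
    and fin: "emeasure M B < \<infinity>" and pos: "emeasure M B > 0"
    and le: "(\<integral>\<^sup>+ z. ennreal (f z) * indicator B z \<partial>M) \<le> ennreal c" and c: "c \<ge> 0"
    and ae: "AE z in M. Q z"
  shows "\<exists>z\<in>B. Q z \<and> f z \<le> c / measure M B"
proof (rule ccontr)
  assume no: "\<not> ?thesis"
  define k where "k = c / measure M B"
  have m: "measure M B > 0" using fin pos by (simp add: emeasure_eq_ennreal_measure)
  have k0: "k \<ge> 0" using c m by (simp add: k_def)
  have gt: "AE z in M. z \<in> B \<longrightarrow> k < f z"
    using ae by eventually_elim (use no in \<open>auto simp: k_def not_le\<close>)
  have 1: "(\<integral>\<^sup>+ z. ennreal k * indicator B z \<partial>M) = ennreal c"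
    using m fin k0 by (simp add: nn_integral_cmult_indicator emeasure_eq_ennreal_measure k_def flip: ennreal_mult)
  have "(\<integral>\<^sup>+ z. ennreal k * indicator B z \<partial>M) + (\<integral>\<^sup>+ z. ennreal (f z - k) * indicator B z \<partial>M) =
      (\<integral>\<^sup>+ z. ennreal k * indicator B z + ennreal (f z - k) * indicator B z \<partial>M)"
    by (intro nn_integral_add[symmetric]) auto
  also have "\<dots> = (\<integral>\<^sup>+ z. ennreal (f z) * indicator B z \<partial>M)"
    using gt k0 by (intro nn_integral_cong_AE) (auto elim!: eventually_mono simp: indicator_def simp flip: ennreal_plus)
  also have "\<dots> \<le> ennreal c" by fact
  finally have "ennreal c + (\<integral>\<^sup>+ z. ennreal (f z - k) * indicator B z \<partial>M) \<le> ennreal c + 0" unfolding 1 by simp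
  then have "(\<integral>\<^sup>+ z. ennreal (f z - k) * indicator B z \<partial>M) = 0"
    by (subst (asm) ennreal_add_left_cancel_le) auto
  then have "AE z in M. ennreal (f z - k) * indicator B z = 0"
    by (subst (asm) nn_integral_0_iff_AE) auto
  then have "AE z in M. z \<notin> B" using gt
    by eventually_elim (auto simp: indicator_def ennreal_eq_0_iff split: if_splits)
  then have "emeasure M B = 0"
    using sets.sets_into_space[OF assms(1)] by (subst (asm) AE_iff_measurable[OF assms(1)]) auto
  then show False using pos by simp
qed

text \<open>
  Both orders of the two directions are required, because \<open>two_directions_sobolev\<close>
  wants a bound along either line through \<open>z\<close>.
\<close>
definition corner_linked :: "point set \<Rightarrow> point set \<Rightarrow> point set \<Rightarrow> point \<Rightarrow> point \<Rightarrow> bool" where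
  "corner_linked \<Omega> A B d d' \<longleftrightarrow> (\<forall>z\<in>A. \<forall>z'\<in>B. \<exists>s t. z' = z + s *\<^sub>R d + t *\<^sub>R d' \<and>
     closed_segment z (z + s *\<^sub>R d) \<union> closed_segment (z + s *\<^sub>R d) z' \<subseteq> \<Omega> \<and>
     closed_segment z (z + t *\<^sub>R d') \<union> closed_segment (z + t *\<^sub>R d') z' \<subseteq> \<Omega>)"

lemma offset_along_segment:
  "y \<in> closed_segment x (x + s *\<^sub>R d) \<Longrightarrow> offset d y = offset d x"
  "y \<in> closed_segment (x - s *\<^sub>R d) x \<Longrightarrow> offset d y = offset d x"
proof -
  have *: "offset d (x + c *\<^sub>R d) = offset d x" for c by (simp add: offset_add offset_scaleR)
  show "y \<in> closed_segment x (x + s *\<^sub>R d) \<Longrightarrow> offset d y = offset d x"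
  proof -
    assume "y \<in> closed_segment x (x + s *\<^sub>R d)"
    then obtain u where "y = (1 - u) *\<^sub>R x + u *\<^sub>R (x + s *\<^sub>R d)" by (auto simp: in_segment)
    then have "y = x + (u * s) *\<^sub>R d" by (simp add: algebra_simps)
    then show ?thesis using * by simp
  qed
  show "y \<in> closed_segment (x - s *\<^sub>R d) x \<Longrightarrow> offset d y = offset d x"
  proof -
    assume "y \<in> closed_segment (x - s *\<^sub>R d) x"
    then obtain u where "y = (1 - u) *\<^sub>R (x - s *\<^sub>R d) + u *\<^sub>R x" by (auto simp: in_segment)
    then have "y = x + (- (1 - u) * s) *\<^sub>R d" by (simp add: algebra_simps)
    then show ?thesis using *[of "- (1 - u) * s"] by simp
  qed
qed

text \<open>
  A nonempty open set is not negligible, so cells that cover \<open>\<Omega>\<close> up to a null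
  set are dense in it.
\<close>
lemma subset_closure_Union:
  fixes \<Omega> :: "point set"
  assumes "open \<Omega>" "negligible (\<Omega> - \<Union>\<V>)" "finite \<V>"
  shows "\<Omega> \<subseteq> \<Union>(closure ` \<V>)"
proof -
  have "closed (\<Union>(closure ` \<V>))" using assms(3) by (intro closed_Union) auto
  then have op: "open (\<Omega> - \<Union>(closure ` \<V>))" using assms(1) by (intro open_Diff)
  have "\<Omega> - \<Union>(closure ` \<V>) \<subseteq> \<Omega> - \<Union>\<V>" using closure_subset by blast
  then have "negligible (\<Omega> - \<Union>(closure ` \<V>))" using assms(2) negligible_subset by blast
  then have "\<Omega> - \<Union>(closure ` \<V>) = {}" using op open_not_negligible by blast
  then show ?thesis by blast
qed

text \<open>
  All that the following arguments need about a step function: outside the exceptional points, the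
  difference of two values, and the value itself if the path ends on \<open>Z\<close>, is at most
  the sum of the jumps that a connecting path meets.
\<close>
lemma step_function_variation:
  assumes st: "step_function \<Omega> Z v E" and \<Omega>: "open \<Omega>"
  obtains P N Q where "finite P" "length_measure N = 0" "AE z in lborel. z \<in> \<Omega> \<longrightarrow> z \<in> Q"
    "\<And>S z z'. connected S \<Longrightarrow> S \<subseteq> \<Omega> - P \<Longrightarrow> z \<in> S \<inter> Q \<Longrightarrow> z' \<in> S \<inter> Q \<Longrightarrow> \<bar>v z - v z'\<bar> \<le> crossed_variation E S"
    "\<And>S x z. connected S \<Longrightarrow> x \<in> S \<Longrightarrow> x \<in> Z - N \<Longrightarrow> S - {x} \<subseteq> \<Omega> - P \<Longrightarrow> z \<in> S \<inter> Q \<Longrightarrow> \<bar>v z\<bar> \<le> crossed_variation E S"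
proof -
  from st obtain F P N where E: "finite E" and F: "finite F" and PN: "finite P" "length_measure N = 0"
    and val: "\<forall>(V, c)\<in>F. open V \<and> (\<forall>x\<in>V. v x = c)" and neg: "negligible (\<Omega> - \<Union>(fst ` F))" and
     J: "\<forall>x\<in>\<Omega> - P. \<forall>(V, c)\<in>F. \<forall>(V', c')\<in>F.
           x \<in> closure V \<and> x \<in> closure V' \<and> c \<noteq> c' \<longrightarrow>
           (\<exists>(a, b, p, q)\<in>E. x \<in> closed_segment a b \<and> {c, c'} \<subseteq> {p, q})" and
     B: "\<forall>x\<in>Z - N. \<forall>(V, c)\<in>F. x \<in> closure V \<and> c \<noteq> 0 \<longrightarrow>
           (\<exists>(a, b, p, q)\<in>E. x \<in> closed_segment a b \<and> {c, 0} \<subseteq> {p, q})"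
    unfolding step_function_def by (elim conjE exE) (rule that)
  have cov: "\<exists>(V, c)\<in>F. x \<in> closure V" if "x \<in> \<Omega>" for x
  proof -
    have "x \<in> \<Union>(closure ` fst ` F)" using subset_closure_Union[OF \<Omega> neg] F that by blast
    then show ?thesis by force
  qed
  \<comment> \<open>A point of \<open>X\<close> is made a closed cell of its own with value \<open>0\<close>, so that one argument
    bounds both the oscillation along \<open>S\<close> and the distance to the boundary value.\<close>
  define G where "G X = (\<lambda>(V, c). (closure V, c)) ` F \<union> (\<lambda>x. ({x}, 0)) ` X" for X :: "point set"
  have osc: "c1 - c0 \<le> crossed_variation E S"
    if S: "connected S" "S - X \<subseteq> \<Omega> - P" and X: "X \<subseteq> Z - N" "finite X"
      and K: "(K0, c0) \<in> G X" "S \<inter> K0 \<noteq> {}" "(K1, c1) \<in> G X" "S \<inter> K1 \<noteq> {}" for S X K0 c0 K1 c1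
  proof (rule level_set_chain[OF S(1) _ _ _ E _ K])
    show "finite (G X)" using F X(2) by (simp add: G_def)
    show "\<And>K c. (K, c) \<in> G X \<Longrightarrow> closed K" by (auto simp: G_def)
    show "S \<subseteq> \<Union>(fst ` G X)"
    proof
      fix y assume y: "y \<in> S"
      show "y \<in> \<Union>(fst ` G X)"
      proof (cases "y \<in> X")
        case True
        then show ?thesis by (force simp: G_def)
      next
        case False
        then obtain V c where "(V, c) \<in> F" "y \<in> closure V" using cov y S(2) by blast
        then show ?thesis by (force simp: G_def)
      qed
    qed
    fix y l K c K' c'
    assume y: "y \<in> S" "(K, c) \<in> G X" "(K', c') \<in> G X" "y \<in> K" "y \<in> K'" and l: "c \<le> l" "l < c'"
    have "\<exists>a b p q c1 c2. (a, b, p, q) \<in> E \<and> y \<in> closed_segment a b \<and> {c1, c2} \<subseteq> {p, q} \<and> min c1 c2 \<le> l \<and> l < max c1 c2"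
    proof (cases "y \<in> X")
      case False
      then obtain V V' where V: "(V, c) \<in> F" "K = closure V" "(V', c') \<in> F" "K' = closure V'"
        using y by (auto simp: G_def)
      have "\<exists>(a, b, p, q)\<in>E. y \<in> closed_segment a b \<and> {c, c'} \<subseteq> {p, q}"
        using bspec[OF bspec[OF bspec[OF J, of y], of "(V, c)", unfolded prod.case], of "(V', c')"] V y S(2) False l by auto
      then obtain a b p q where "(a, b, p, q) \<in> E" "y \<in> closed_segment a b" "{c, c'} \<subseteq> {p, q}" by blast
      moreover have "min c c' \<le> l \<and> l < max c c'" using l by (auto simp: min_le_iff_disj less_max_iff_disj)
      ultimately show ?thesis by blast
    next
      case True
      \<comment> \<open>Of the two values at \<open>y\<close> one lies on the other side of the level than \<open>0\<close>.\<close>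
      have ex: "\<exists>(a, b, p, q)\<in>E. y \<in> closed_segment a b \<and> {c'', 0} \<subseteq> {p, q}"
        if K: "(K'', c'') \<in> G X" "y \<in> K''" and nz: "c'' \<noteq> 0" for K'' c''
      proof -
        have "\<exists>V. (V, c'') \<in> F \<and> y \<in> closure V" using K nz unfolding G_def by auto
        then obtain V where "(V, c'') \<in> F" "y \<in> closure V" by blast
        then show ?thesis using bspec[OF bspec[OF B, of y], of "(V, c'')"] X(1) True nz by auto
      qed
      have "\<exists>c''. c'' \<noteq> 0 \<and> min c'' 0 \<le> l \<and> l < max c'' 0 \<and> (c'' = c \<or> c'' = c')"
      proof (cases "0 \<le> l")
        case True
        then show ?thesis using l by (intro exI[of _ c']) auto
      next
        case False
        then show ?thesis using l by (intro exI[of _ c]) auto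
      qed
      then obtain c'' where c'': "c'' \<noteq> 0" "min c'' 0 \<le> l" "l < max c'' 0" "c'' = c \<or> c'' = c'" by blast
      then have "\<exists>(a, b, p, q)\<in>E. y \<in> closed_segment a b \<and> {c'', 0} \<subseteq> {p, q}" using ex y by metis
      then show ?thesis using c''(2,3) by blast
    qed
    then obtain a b p q c1 c2 where e: "(a, b, p, q) \<in> E" "y \<in> closed_segment a b" "{c1, c2} \<subseteq> {p, q}"
      "min c1 c2 \<le> l" "l < max c1 c2" by blast
    then have "min p q \<le> l \<and> l < max p q" by (auto simp: min_le_iff_disj less_max_iff_disj)
    then show "\<exists>(a, b, p, q)\<in>E. y \<in> closed_segment a b \<and> min p q \<le> l \<and> l < max p q" using e(1,2) by blast
  qed
  define Q where "Q = \<Union>(fst ` F)"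
  have Q: "\<exists>K. (K, v z) \<in> G X \<and> z \<in> K" if "z \<in> Q" for z X
  proof -
    obtain V c where V: "(V, c) \<in> F" "z \<in> V" using \<open>z \<in> Q\<close> unfolding Q_def by auto
    then have "v z = c" using val by blast
    then show ?thesis using V closure_subset by (force simp: G_def)
  qed
  show thesis
  proof (rule that[OF PN])
    show "AE z in lborel. z \<in> \<Omega> \<longrightarrow> z \<in> Q"
      using negligible_AE_lborel[OF neg] unfolding Q_def by eventually_elim blast
    show "\<bar>v z - v z'\<bar> \<le> crossed_variation E S"
      if S: "connected S" "S \<subseteq> \<Omega> - P" and z: "z \<in> S \<inter> Q" "z' \<in> S \<inter> Q" for S z z'
    proof -
      obtain K K' where "(K, v z) \<in> G {}" "z \<in> K" "(K', v z') \<in> G {}" "z' \<in> K'" using Q z by (meson IntD2)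
      moreover from this have "S \<inter> K \<noteq> {}" "S \<inter> K' \<noteq> {}" using z by blast+
      ultimately have "v z' - v z \<le> crossed_variation E S" "v z - v z' \<le> crossed_variation E S"
        using osc[OF S(1), of "{}"] S(2) by auto
      then show ?thesis by linarith
    qed
    show "\<bar>v z\<bar> \<le> crossed_variation E S"
      if S: "connected S" "x \<in> S" "x \<in> Z - N" "S - {x} \<subseteq> \<Omega> - P" and z: "z \<in> S \<inter> Q" for S x z
    proof -
      obtain K where "(K, v z) \<in> G {x}" "z \<in> K" using Q z by (meson IntD2)
      moreover have "({x}, 0) \<in> G {x}" by (simp add: G_def)
      moreover have "S \<inter> K \<noteq> {}" "S \<inter> {x} \<noteq> {}" using \<open>z \<in> K\<close> z S(2) by blast+
      ultimately have "v z - 0 \<le> crossed_variation E S" "0 - v z \<le> crossed_variation E S"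
        using osc[OF S(1,4), of K "v z" "{x}" 0] osc[OF S(1,4), of "{x}" 0 K "v z"] S(3) by blast+
      then show ?thesis by linarith
    qed
  qed
qed

text \<open>
  By averaging over \<open>B\<close> there is a point \<open>z'\<close> where \<open>v\<close> and
  both line variations are of order \<open>TV\<close>. The two paths with a corner from a point
  \<open>z\<close> to \<open>z'\<close> then bound \<open>\<bar>v z\<bar>\<close> by
  \<open>O(TV)\<close> plus the variation on either line through \<open>z\<close>.
\<close>
lemma sobolev_set_transfer:
  assumes \<Omega>: "open \<Omega>" and A: "A \<in> sets borel" "bounded A" and d: "rot90 d \<bullet> d' \<noteq> 0"
    and B: "open B" "bounded B" "B \<noteq> {}" and link: "corner_linked \<Omega> A B d d'"
    and sob: "sobolev_set \<Omega> Z B"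
  shows "sobolev_set \<Omega> Z A"
proof -
  have d': "rot90 d' \<bullet> d \<noteq> 0" using d by (simp add: inner_point algebra_simps)
  have dn: "d \<noteq> 0" "d' \<noteq> 0" using d by (auto simp: inner_point)
  have Bb[measurable]: "B \<in> sets borel" using B(1) by simp
  obtain K1 where K1: "K1 > 0" "\<And>E. finite E \<Longrightarrow>
    (\<integral>\<^sup>+ z. ennreal (line_variation d E (offset d z)) * indicator B z \<partial>lborel) \<le> ennreal (K1 * total_variation E)"
    using integral_line_variation[OF d B(2)] by blast
  obtain K2 where K2: "K2 > 0" "\<And>E. finite E \<Longrightarrow>
    (\<integral>\<^sup>+ z. ennreal (line_variation d' E (offset d' z)) * indicator B z \<partial>lborel) \<le> ennreal (K2 * total_variation E)"
    using integral_line_variation[OF d' B(2)] by blast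
  obtain C where C: "C > 0" "\<And>v E. step_function \<Omega> Z v E \<Longrightarrow>
     (\<integral>\<^sup>+ z. ennreal \<bar>v z\<bar> * indicator B z \<partial>lborel) \<le> ennreal (C * total_variation E)"
    using sob unfolding sobolev_set_def by blast
  define m where "m = measure lborel B"
  have emB: "emeasure lborel B < \<infinity>" "emeasure lborel B > 0"
    using emeasure_bounded_finite[OF B(2)] B(1,3) open_not_negligible[of B]
    by (auto simp: negligible_iff_null_sets null_sets_def zero_less_iff_neq_zero)
  have m: "m > 0" using emB unfolding m_def by (simp add: emeasure_eq_ennreal_measure)
  let ?C0 = "(K1 + K2 + C) / m"
  show ?thesis
  proof (rule two_directions_sobolev[OF A d])
    show "0 \<le> ?C0" using K1 K2 C m by simp
    fix v E assume st: "step_function \<Omega> Z v E"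
    have E: "finite E" and [measurable]: "v \<in> borel_measurable borel" using st by (auto simp: step_function_def)
    obtain P N Q where P: "finite P" and ae: "AE z in lborel. z \<in> \<Omega> \<longrightarrow> z \<in> Q"
      and var: "\<And>S z z'. connected S \<Longrightarrow> S \<subseteq> \<Omega> - P \<Longrightarrow> z \<in> S \<inter> Q \<Longrightarrow> z' \<in> S \<inter> Q \<Longrightarrow> \<bar>v z - v z'\<bar> \<le> crossed_variation E S"
      by (rule step_function_variation[OF st \<Omega>], rule that)
    let ?T = "total_variation E" and ?W1 = "\<lambda>z. line_variation d E (offset d z)"
    let ?W2 = "\<lambda>z. line_variation d' E (offset d' z)"
    have T: "?T \<ge> 0" by (rule total_variation_nonneg)
    have W: "?W1 z \<ge> 0" "?W2 z \<ge> 0" for z by (rule line_variation_nonneg)+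
    let ?Q = "\<lambda>z. (z \<in> \<Omega> \<longrightarrow> z \<in> Q) \<and> offset d z \<notin> offset d ` P \<and> offset d' z \<notin> offset d' ` P"
    have Q: "AE z in lborel. ?Q z"
      using ae AE_offset_avoids_finite[OF dn(1) P] AE_offset_avoids_finite[OF dn(2) P] by eventually_elim auto
    \<comment> \<open>Almost every point of \<open>B\<close> lies in a cell and on lines that avoid the exceptional
      points, so the averaging can select such a point.\<close>
    have "\<exists>z\<in>B. ?Q z \<and> \<bar>v z\<bar> + ?W1 z + ?W2 z \<le> (K1 + K2 + C) * ?T / measure lborel B"
    proof (rule below_average_point[OF _ _ emB _ _ Q])
      have "(\<integral>\<^sup>+ z. ennreal (\<bar>v z\<bar> + ?W1 z + ?W2 z) * indicator B z \<partial>lborel) =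
        (\<integral>\<^sup>+ z. ennreal \<bar>v z\<bar> * indicator B z + (ennreal (?W1 z) * indicator B z + ennreal (?W2 z) * indicator B z) \<partial>lborel)"
        using W by (intro nn_integral_cong) (auto simp: indicator_def add.assoc)
      also have "\<dots> = (\<integral>\<^sup>+ z. ennreal \<bar>v z\<bar> * indicator B z \<partial>lborel) + ((\<integral>\<^sup>+ z. ennreal (?W1 z) * indicator B z \<partial>lborel)
         + (\<integral>\<^sup>+ z. ennreal (?W2 z) * indicator B z \<partial>lborel))"
        by (simp add: nn_integral_add)
      also have "\<dots> \<le> ennreal (C * ?T) + (ennreal (K1 * ?T) + ennreal (K2 * ?T))"
        by (intro add_mono C(2)[OF st] K1(2) K2(2) E)
      also have "\<dots> = ennreal ((K1 + K2 + C) * ?T)" using C(1) K1(1) K2(1) T by (simp add: algebra_simps)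
      finally show "(\<integral>\<^sup>+ z. ennreal (\<bar>v z\<bar> + ?W1 z + ?W2 z) * indicator B z \<partial>lborel) \<le> ennreal ((K1 + K2 + C) * ?T)" .
      show "0 \<le> (K1 + K2 + C) * ?T" using K1 K2 C T by simp
    qed auto
    then obtain z' where z': "z' \<in> B" "?Q z'" "\<bar>v z'\<bar> + ?W1 z' + ?W2 z' \<le> ?C0 * ?T"
      unfolding m_def[symmetric] by (auto simp: field_simps)
    define k where "k = \<bar>v z'\<bar> + ?W1 z' + ?W2 z'"
    have path: "\<bar>v z - v z'\<bar> \<le> line_variation e E (offset e z) + line_variation e' E (offset e' z')"
      if z: "?Q z" and e: "offset e z \<notin> offset e ` P" "offset e' z' \<notin> offset e' ` P"
        and S: "closed_segment z (z + s *\<^sub>R e) \<union> closed_segment (z + s *\<^sub>R e) z' \<subseteq> \<Omega>" and zz: "z' = z + s *\<^sub>R e + t *\<^sub>R e'"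
      for z e e' s t
    proof -
      let ?S = "closed_segment z (z + s *\<^sub>R e) \<union> closed_segment (z + s *\<^sub>R e) z'"
      have con: "connected ?S" by (intro connected_Un) auto
      have off: "offset e y = offset e z \<or> offset e' y = offset e' z'" if "y \<in> ?S" for y
        using that offset_along_segment(1)[of y z s e] offset_along_segment(2)[of y z' t e'] zz by (auto simp: algebra_simps)
      have "?S \<subseteq> \<Omega> - P"
      proof
        fix y assume y: "y \<in> ?S"
        have "y \<notin> P" using off[OF y] e by (metis imageI)
        then show "y \<in> \<Omega> - P" using S y by blast
      qed
      moreover have "z \<in> ?S \<inter> Q" "z' \<in> ?S \<inter> Q" using z z'(2) S by auto
      ultimately have "\<bar>v z - v z'\<bar> \<le> crossed_variation E ?S" using var[OF con] by blast
      also have "\<dots> \<le> line_variation e E (offset e z) + line_variation e' E (offset e' z')"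
        by (rule crossed_le_line_variation2[OF E off])
      finally show ?thesis .
    qed
    show "\<exists>k. 0 \<le> k \<and> k \<le> ?C0 * ?T \<and> (AE z in lborel. z \<in> A \<longrightarrow> \<bar>v z\<bar> \<le> k + ?W1 z \<and> \<bar>v z\<bar> \<le> k + ?W2 z)"
    proof (intro exI[of _ k] conjI)
      show "0 \<le> k" using W[of z'] by (simp add: k_def)
      show "k \<le> ?C0 * ?T" using z'(3) by (simp add: k_def)
      show "AE z in lborel. z \<in> A \<longrightarrow> \<bar>v z\<bar> \<le> k + ?W1 z \<and> \<bar>v z\<bar> \<le> k + ?W2 z"
        using Q
      proof eventually_elim
        case (elim z)
        show ?case
        proof
          assume "z \<in> A"
          then obtain s t where st': "z' = z + s *\<^sub>R d + t *\<^sub>R d'"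
            "closed_segment z (z + s *\<^sub>R d) \<union> closed_segment (z + s *\<^sub>R d) z' \<subseteq> \<Omega>"
            "closed_segment z (z + t *\<^sub>R d') \<union> closed_segment (z + t *\<^sub>R d') z' \<subseteq> \<Omega>"
            using link z'(1) unfolding corner_linked_def by blast
          have "\<bar>v z - v z'\<bar> \<le> ?W1 z + ?W2 z'"
            using path[of z d d' s t] elim z'(2) st' by blast
          moreover have "\<bar>v z - v z'\<bar> \<le> ?W2 z + ?W1 z'"
            using path[of z d' d t s] elim z'(2) st' by (simp add: algebra_simps)
          ultimately show "\<bar>v z\<bar> \<le> k + ?W1 z \<and> \<bar>v z\<bar> \<le> k + ?W2 z"
            using W[of z] W[of z'] unfolding k_def by linarith
        qed
      qed
    qed
  qed
qed

text \<open>
  If the segments from \<open>z\<close> in both directions leave \<open>\<Omega>\<close> through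
  \<open>Z\<close>, where \<open>v\<close> vanishes, then \<open>\<bar>v z\<bar>\<close> is at most
  the variation on either line.
\<close>
lemma sobolev_set_anchor:
  assumes \<Omega>: "open \<Omega>" and A: "A \<in> sets borel" "bounded A" and d: "rot90 d \<bullet> d' \<noteq> 0"
    and exit: "\<And>z e. z \<in> A \<Longrightarrow> e \<in> {d, d'} \<Longrightarrow> \<exists>s. z - s *\<^sub>R e \<in> Z \<and> closed_segment (z - s *\<^sub>R e) z - {z - s *\<^sub>R e} \<subseteq> \<Omega> \<and> s \<noteq> 0"
  shows "sobolev_set \<Omega> Z A"
proof (rule two_directions_sobolev[OF A d order_refl])
  have dn: "d \<noteq> 0" "d' \<noteq> 0" using d by (auto simp: inner_point)
  fix v E assume st: "step_function \<Omega> Z v E"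
  have E: "finite E" using st by (auto simp: step_function_def)
  obtain P N Q where P: "finite P" and N: "length_measure N = 0" and ae: "AE z in lborel. z \<in> \<Omega> \<longrightarrow> z \<in> Q"
    and var: "\<And>S x z. connected S \<Longrightarrow> x \<in> S \<Longrightarrow> x \<in> Z - N \<Longrightarrow> S - {x} \<subseteq> \<Omega> - P \<Longrightarrow> z \<in> S \<inter> Q \<Longrightarrow> \<bar>v z\<bar> \<le> crossed_variation E S"
    by (rule step_function_variation[OF st \<Omega>], rule that)
  have path: "\<bar>v z\<bar> \<le> line_variation e E (offset e z)"
    if z: "z \<in> Q" and e: "offset e z \<notin> offset e ` P" "offset e z \<notin> offset e ` N"
      and x: "x = z - s *\<^sub>R e" "x \<in> Z" "closed_segment x z - {x} \<subseteq> \<Omega>" for z e s x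
  proof -
    let ?S = "closed_segment x z"
    have off: "offset e y = offset e z" if "y \<in> ?S" for y
      using offset_along_segment(2)[of y z s e] that by (simp add: x(1))
    have avoid: "y \<notin> P" "y \<notin> N" if "y \<in> ?S" for y using off[OF that] e by (metis imageI)+
    have "\<bar>v z\<bar> \<le> crossed_variation E ?S"
      using x(2,3) avoid z by (intro var[of ?S x z]) auto
    also have "\<dots> \<le> line_variation e E (offset e z)"
      by (rule crossed_le_line_variation[OF E off])
    finally show ?thesis .
  qed
  have A\<Omega>: "A \<subseteq> \<Omega>"
  proof
    fix z assume "z \<in> A"
    then obtain s where "z - s *\<^sub>R d \<in> Z \<and> closed_segment (z - s *\<^sub>R d) z - {z - s *\<^sub>R d} \<subseteq> \<Omega> \<and> s \<noteq> 0" using exit[of z d] by blast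
    then show "z \<in> \<Omega>" using dn by auto
  qed
  show "\<exists>k. 0 \<le> k \<and> k \<le> 0 * total_variation E \<and> (AE z in lborel. z \<in> A \<longrightarrow>
     \<bar>v z\<bar> \<le> k + line_variation d E (offset d z) \<and> \<bar>v z\<bar> \<le> k + line_variation d' E (offset d' z))"
  proof (intro exI[of _ 0] conjI)
    show "AE z in lborel. z \<in> A \<longrightarrow> \<bar>v z\<bar> \<le> 0 + line_variation d E (offset d z) \<and> \<bar>v z\<bar> \<le> 0 + line_variation d' E (offset d' z)"
      using ae AE_offset_avoids_finite[OF dn(1) P] AE_offset_avoids_finite[OF dn(2) P]
        AE_offset_avoids_null_length[OF dn(1) N] AE_offset_avoids_null_length[OF dn(2) N]
    proof eventually_elim
      case (elim z)
      show ?case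
      proof
        assume z: "z \<in> A"
        obtain s where s: "z - s *\<^sub>R d \<in> Z" "closed_segment (z - s *\<^sub>R d) z - {z - s *\<^sub>R d} \<subseteq> \<Omega>" "s *\<^sub>R d \<noteq> 0"
          using exit[OF z, of d] dn by auto
        obtain t where t: "z - t *\<^sub>R d' \<in> Z" "closed_segment (z - t *\<^sub>R d') z - {z - t *\<^sub>R d'} \<subseteq> \<Omega>" "t *\<^sub>R d' \<noteq> 0"
          using exit[OF z, of d'] dn by auto
        have "z \<in> Q" using elim(1) z A\<Omega> by blast
        then show "\<bar>v z\<bar> \<le> 0 + line_variation d E (offset d z) \<and> \<bar>v z\<bar> \<le> 0 + line_variation d' E (offset d' z)"
          using path[of z d _ s, OF _ _ _ refl] path[of z d' _ t, OF _ _ _ refl] elim s t by simp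
      qed
    qed
  qed auto
qed

lemma corner_linked_ball:
  assumes "ball z0 (2 * r) \<subseteq> \<Omega>" "B \<subseteq> ball z0 r"
  shows "corner_linked \<Omega> (ball z0 r) B (vector [1, 0]) (vector [0, 1])"
  unfolding corner_linked_def
proof (intro ballI)
  fix z z' assume z: "z \<in> ball z0 r" and "z' \<in> B"
  then have z': "z' \<in> ball z0 r" using assms(2) by auto
  have r: "r > 0" using z by (metis ball_eq_empty empty_iff not_le)
  define s t where "s = z' $ 1 - z $ 1" and "t = z' $ 2 - z $ 2"
  let ?a = "vector [1, 0] :: point" and ?b = "vector [0, 1] :: point"
  have dist2: "(dist z0 y)\<^sup>2 = (z0 $ 1 - y $ 1)\<^sup>2 + (z0 $ 2 - y $ 2)\<^sup>2" for y
    unfolding dist_norm power2_norm_eq_inner by (simp add: inner_point power2_eq_square)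
  have lt: "(dist z0 z)\<^sup>2 < r\<^sup>2" "(dist z0 z')\<^sup>2 < r\<^sup>2"
    using z z' by (auto intro!: power_strict_mono)
  have corner: "c \<in> ball z0 (2 * r)" if "c $ 1 \<in> {z $ 1, z' $ 1}" "c $ 2 \<in> {z $ 2, z' $ 2}" for c
  proof -
    have "(z0 $ 1 - c $ 1)\<^sup>2 \<le> r\<^sup>2" "(z0 $ 2 - c $ 2)\<^sup>2 \<le> r\<^sup>2"
      using that lt unfolding dist2 by (auto intro: order_trans[OF _ less_imp_le])
        (smt (verit) zero_le_power2)+
    then have "(dist z0 c)\<^sup>2 \<le> 2 * r\<^sup>2" unfolding dist2 by simp
    also have "\<dots> < (2 * r)\<^sup>2" using r by (simp add: power_mult_distrib)
    finally show ?thesis using r power_less_imp_less_base[of "dist z0 c" 2 "2 * r"] by simp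
  qed
  have seg: "closed_segment x y \<subseteq> \<Omega>" if "x \<in> ball z0 (2 * r)" "y \<in> ball z0 (2 * r)" for x y
    using closed_segment_subset[OF that convex_ball] assms(1) by blast
  have "z \<in> ball z0 (2 * r)" "z' \<in> ball z0 (2 * r)" "z + s *\<^sub>R ?a \<in> ball z0 (2 * r)" "z + t *\<^sub>R ?b \<in> ball z0 (2 * r)"
    by (rule corner; simp add: s_def t_def)+
  then show "\<exists>s t. z' = z + s *\<^sub>R ?a + t *\<^sub>R ?b \<and>
      closed_segment z (z + s *\<^sub>R ?a) \<union> closed_segment (z + s *\<^sub>R ?a) z' \<subseteq> \<Omega> \<and>
      closed_segment z (z + t *\<^sub>R ?b) \<union> closed_segment (z + t *\<^sub>R ?b) z' \<subseteq> \<Omega>"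
    by (intro exI[of _ s] exI[of _ t] conjI Un_least seg) (auto simp: point_eq_iff s_def t_def)
qed

lemma sobolev_ball_step:
  assumes "open \<Omega>" "r > 0" "ball z (2 * r) \<subseteq> \<Omega>" "z1 \<in> ball z r" "r1 > 0" "sobolev_set \<Omega> Z (ball z1 r1)"
  shows "sobolev_set \<Omega> Z (ball z r)"
proof (rule sobolev_set_transfer[OF assms(1)])
  show "corner_linked \<Omega> (ball z r) (ball z r \<inter> ball z1 r1) (vector [1, 0]) (vector [0, 1])"
    by (rule corner_linked_ball[OF assms(3)]) auto
  show "sobolev_set \<Omega> Z (ball z r \<inter> ball z1 r1)"
    by (rule sobolev_set_subset[OF assms(6)]) auto
  have "z1 \<in> ball z r \<inter> ball z1 r1" using assms by auto
  then show "ball z r \<inter> ball z1 r1 \<noteq> {}" by blast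
qed (auto simp: inner_point)

text \<open>
  Call a point good if a ball around it satisfies the inequality. The good points of
  \<open>\<Omega>\<close> form an open set, and so do the others, because the inequality on a small
  ball inside a larger one extends to the larger one.
\<close>
lemma sobolev_interior:
  assumes \<Omega>: "open \<Omega>" "connected \<Omega>" and start: "z0 \<in> \<Omega>" "r0 > 0" "sobolev_set \<Omega> Z (ball z0 r0)"
    and z: "z \<in> \<Omega>"
  shows "\<exists>r>0. sobolev_set \<Omega> Z (ball z r)"
proof (rule ccontr)
  assume no: "\<not> ?thesis"
  define G where "G = {z \<in> \<Omega>. \<exists>r>0. sobolev_set \<Omega> Z (ball z r)}"
  have rad: "\<exists>r>0. ball y (2 * r) \<subseteq> \<Omega>" if y: "y \<in> \<Omega>" for y
  proof -
    obtain r where "r > 0" "ball y r \<subseteq> \<Omega>" using \<Omega>(1) y open_contains_ball by blast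
    then show ?thesis by (intro exI[of _ "r / 2"]) auto
  qed
  have "open G" unfolding open_contains_ball
  proof
    fix y assume "y \<in> G"
    then obtain r where r: "y \<in> \<Omega>" "r > 0" "sobolev_set \<Omega> Z (ball y r)" by (auto simp: G_def)
    obtain s where s: "s > 0" "ball y s \<subseteq> \<Omega>" using \<Omega>(1) r(1) open_contains_ball by blast
    have "ball y (min s (r / 2)) \<subseteq> G"
    proof
      fix x assume x: "x \<in> ball y (min s (r / 2))"
      have "ball x (r / 2) \<subseteq> ball y r"
      proof
        fix u assume "u \<in> ball x (r / 2)"
        then have "dist x u < r / 2" "dist y x < r / 2" using x by auto
        then show "u \<in> ball y r" using dist_triangle[of y u x] by simp
      qed
      then have "sobolev_set \<Omega> Z (ball x (r / 2))" using sobolev_set_subset r(3) by blast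
      then show "x \<in> G" using x s r by (auto simp: G_def intro!: exI[of _ "r / 2"])
    qed
    then show "\<exists>e>0. ball y e \<subseteq> G" using s r by (intro exI[of _ "min s (r / 2)"]) auto
  qed
  moreover have "open (\<Omega> - G)" unfolding open_contains_ball
  proof
    fix y assume y: "y \<in> \<Omega> - G"
    obtain r where r: "r > 0" "ball y (2 * r) \<subseteq> \<Omega>" using rad y by blast
    have "ball y r \<subseteq> \<Omega> - G"
    proof
      fix x assume x: "x \<in> ball y r"
      have "x \<notin> G"
      proof
        assume "x \<in> G"
        then obtain r1 where "r1 > 0" "sobolev_set \<Omega> Z (ball x r1)" by (auto simp: G_def)
        then have "sobolev_set \<Omega> Z (ball y r)" by (rule sobolev_ball_step[OF \<Omega>(1) r x])
        then show False using y r by (auto simp: G_def)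
      qed
      moreover have "x \<in> \<Omega>" using x r by (auto intro!: subsetD[OF r(2)])
      ultimately show "x \<in> \<Omega> - G" by blast
    qed
    then show "\<exists>e>0. ball y e \<subseteq> \<Omega> - G" using r by blast
  qed
  moreover have "z0 \<in> G" using start by (auto simp: G_def)
  moreover have "z \<in> \<Omega> - G" using z no by (auto simp: G_def)
  ultimately show False using connectedD[OF \<Omega>(2), of G "\<Omega> - G"] start(1) by (auto simp: G_def)
qed

section \<open>Lipschitz charts of the domain\<close>

text \<open>
  Near \<open>x\<close> the domain is a half plane bounded by a line through \<open>x\<close>.
\<close>
definition flat_point :: "point set \<Rightarrow> point \<Rightarrow> bool" where
  "flat_point \<Omega> x \<longleftrightarrow> (\<exists>n \<rho>. 0 < \<rho> \<and> n \<noteq> 0 \<and> (\<forall>y\<in>ball x \<rho>. y \<in> \<Omega> \<longleftrightarrow> 0 < (y - x) \<bullet> n))"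

text \<open>
  The chart of a Lipschitz domain at the boundary point \<open>x\<close>, where \<open>e\<close>
  points into the domain.
\<close>
locale boundary_chart =
  fixes \<Omega> :: "point set" and x e :: point and \<phi> :: "real \<Rightarrow> real" and L r h :: real
  assumes op: "open \<Omega>" and x: "x \<in> frontier \<Omega>" and e: "norm e = 1" and rh: "0 < r" "0 < h"
    and lip: "L-lipschitz_on {-r<..<r} \<phi>"
    and graph0: "\<And>s t. s \<in> {-r<..<r} \<Longrightarrow> t \<in> {-h<..<h} \<Longrightarrow> x + s *\<^sub>R rot90 e + t *\<^sub>R e \<in> \<Omega> \<longleftrightarrow> \<phi> s < t"
begin

definition along :: "point \<Rightarrow> real" where "along y = (y - x) \<bullet> rot90 e"
definition above :: "point \<Rightarrow> real" where "above y = (y - x) \<bullet> e"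
text \<open>
  The directions \<open>dir 1\<close> and \<open>dir (-1)\<close> deviate from \<open>e\<close> by
  this slope; it is chosen such that \<open>L * slope < 1\<close>.
\<close>
definition slope :: real where "slope = 1 / (L + 1)"

lemma e2: "e $ 1 * e $ 1 + e $ 2 * e $ 2 = 1"
  using e by (simp add: norm_eq_1 inner_point)

lemma L0: "L \<ge> 0" using lip by (rule lipschitz_on_nonneg)
lemma slope: "0 < slope" "slope \<le> 1" "L * slope = 1 - slope" using L0 by (auto simp: slope_def field_simps)

lemma orthonormal_expansion: "v = (v \<bullet> rot90 e) *\<^sub>R rot90 e + (v \<bullet> e) *\<^sub>R e"
proof -
  have "v $ 1 * (e $ 1 * e $ 1 + e $ 2 * e $ 2) = v $ 1" "v $ 2 * (e $ 1 * e $ 1 + e $ 2 * e $ 2) = v $ 2"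
    using e2 by simp_all
  then show ?thesis by (simp add: point_eq_iff inner_point algebra_simps)
qed

lemma coords: "y = x + along y *\<^sub>R rot90 e + above y *\<^sub>R e"
  using orthonormal_expansion[of "y - x"] unfolding along_def above_def by (metis add.assoc add_diff_cancel_left' diff_add_cancel add.commute)

lemma e_inner: "e \<bullet> e = 1" "rot90 e \<bullet> rot90 e = 1"
  using e by (simp_all add: norm_eq_1[symmetric])

lemma coords_add [simp]:
  "along (y + c *\<^sub>R e) = along y" "above (y + c *\<^sub>R e) = above y + c"
  "along (y + c *\<^sub>R rot90 e) = along y + c" "above (y + c *\<^sub>R rot90 e) = above y"
  by (simp_all add: along_def above_def inner_add_left inner_diff_left e_inner)

lemma coords_x [simp]: "along x = 0" "above x = 0" by (simp_all add: along_def above_def)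

lemma graph: "\<bar>along y\<bar> < r \<Longrightarrow> \<bar>above y\<bar> < h \<Longrightarrow> y \<in> \<Omega> \<longleftrightarrow> \<phi> (along y) < above y"
  using graph0[of "along y" "above y"] coords[of y] by (auto simp: abs_less_iff)

lemma continuous_coords: "continuous_on A along" "continuous_on A above" "isCont along y" "isCont above y"
  unfolding along_def above_def by (intro continuous_intros)+

lemma open_box: "open {y. \<bar>along y\<bar> < a \<and> \<bar>above y - b\<bar> < c}"
  by (intro open_Collect_conj open_Collect_less continuous_intros continuous_coords)

text \<open>
  Points strictly below the graph have a whole neighbourhood below it and so are not in the closure
  of the domain.
\<close>
lemma frontier_graph:
  assumes "\<bar>along y\<bar> < r" "\<bar>above y\<bar> < h" "y \<in> frontier \<Omega>"
  shows "above y = \<phi> (along y)"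
proof -
  have "y \<notin> \<Omega>" using assms(3) op by (simp add: frontier_def interior_open)
  then have "\<not> \<phi> (along y) < above y" using graph assms by auto
  moreover have "\<not> above y < \<phi> (along y)"
  proof
    assume lt: "above y < \<phi> (along y)"
    have "isCont \<phi> (along y)"
      using lipschitz_on_continuous_on[OF lip] assms(1)
      by (auto simp: continuous_on_eq_continuous_at abs_less_iff)
    then have "isCont (\<lambda>y. \<phi> (along y) - above y) y" using continuous_coords
      by (intro continuous_intros continuous_at_compose[unfolded o_def, of y along \<phi>]) auto
    then have "\<forall>\<^sub>F y' in nhds y. 0 < \<phi> (along y') - above y'"
      using lt by (intro order_tendstoD(1)[of "\<lambda>y. \<phi> (along y) - above y"]) (auto simp: continuous_at tendsto_nhds_iff)
    moreover have "\<forall>\<^sub>F y' in nhds y. y' \<in> {y. \<bar>along y\<bar> < r \<and> \<bar>above y - 0\<bar> < h}"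
      using assms by (intro eventually_nhds_in_open open_box) auto
    ultimately have "\<forall>\<^sub>F y' in nhds y. y' \<notin> \<Omega>"
      by eventually_elim (auto simp: graph)
    then obtain U where "open U" "y \<in> U" "\<And>y'. y' \<in> U \<Longrightarrow> y' \<notin> \<Omega>" unfolding eventually_nhds by blast
    moreover have "y \<in> closure \<Omega>" using assms(3) by (simp add: frontier_def)
    ultimately show False using open_Int_closure_eq_empty[of U \<Omega>] by blast
  qed
  ultimately show ?thesis by simp
qed

lemma \<phi>0: "\<phi> 0 = 0" using frontier_graph[of x] x rh by simp

lemma lip_le: "\<bar>s\<bar> < r \<Longrightarrow> \<bar>s'\<bar> < r \<Longrightarrow> \<bar>\<phi> s - \<phi> s'\<bar> \<le> L * \<bar>s - s'\<bar>"
  using lipschitz_onD[OF lip, of s s'] by (auto simp: dist_real_def abs_less_iff)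

definition dir :: "real \<Rightarrow> point" where "dir c = e + (c * slope) *\<^sub>R rot90 e"

lemma coords_dir [simp]: "along (y + a *\<^sub>R dir c) = along y + a * c * slope" "above (y + a *\<^sub>R dir c) = above y + a"
proof -
  have "y + a *\<^sub>R dir c = (y + a *\<^sub>R e) + (a * c * slope) *\<^sub>R rot90 e" by (simp add: dir_def algebra_simps)
  then show "along (y + a *\<^sub>R dir c) = along y + a * c * slope" "above (y + a *\<^sub>R dir c) = above y + a"
    by (simp_all only: coords_add)
qed

lemma coords_cone:
  "along (z + a *\<^sub>R dir 1 + b *\<^sub>R dir (-1)) = along z + (a - b) * slope"
  "above (z + a *\<^sub>R dir 1 + b *\<^sub>R dir (-1)) = above z + (a + b)"
  by (simp_all only: coords_dir) (simp_all add: left_diff_distrib)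

lemma dir_independent: "rot90 (dir 1) \<bullet> dir (-1) \<noteq> 0"
proof -
  have "rot90 (dir 1) \<bullet> dir (-1) = - 2 * slope * (e $ 1 * e $ 1 + e $ 2 * e $ 2)"
    by (simp add: dir_def inner_point) algebra
  then show ?thesis using e2 slope by simp
qed

text \<open>
  The directions \<open>dir 1\<close> and \<open>dir (-1)\<close> are steeper than the graph, as
  \<open>L * slope < 1\<close>; so the cone they span at a point above the graph stays above it.
\<close>
lemma up_cone:
  assumes z: "z \<in> \<Omega>" "\<bar>along z\<bar> < r" "\<bar>above z\<bar> < h" and ab: "0 \<le> a" "0 \<le> b"
    and y: "y = z + a *\<^sub>R dir 1 + b *\<^sub>R dir (-1)" "\<bar>along y\<bar> < r" "\<bar>above y\<bar> < h"
  shows "y \<in> \<Omega>"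
proof -
  have along: "along y = along z + (a - b) * slope" and above: "above y = above z + (a + b)"
    unfolding y(1) by (rule coords_cone)+
  have "\<phi> (along y) \<le> \<phi> (along z) + L * \<bar>along y - along z\<bar>" using lip_le[OF y(2) z(2)] by linarith
  also have "L * \<bar>along y - along z\<bar> = (L * slope) * \<bar>a - b\<bar>" using slope by (simp add: along abs_mult)
  also have "\<dots> \<le> 1 * \<bar>a - b\<bar>" using slope by (intro mult_right_mono) auto
  also have "\<dots> \<le> a + b" using ab by auto
  also have "\<phi> (along z) < above z" using graph z by blast
  finally have "\<phi> (along y) < above y" using above by linarith
  then show ?thesis using graph y by blast
qed

text \<open>
  A neighbourhood of the boundary point is linked to a ball further up: the ball lies in the cone
  spanned by the two directions at each point of the neighbourhood. Only paths going up are used, as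
  paths along the boundary may leave the domain.
\<close>
lemma boundary_link:
  "\<exists>U y. open U \<and> x \<in> U \<and> bounded U \<and> y \<in> \<Omega> \<and> (\<exists>\<rho>>0. corner_linked \<Omega> (U \<inter> \<Omega>) (ball y \<rho>) (dir 1) (dir (-1)))"
proof -
  define t where "t = min r h / 4"
  define d where "d = t * slope / 8"
  have t: "t > 0" "4 * t \<le> r" "4 * t \<le> h" using rh by (auto simp: t_def)
  have d: "d > 0" "8 * d \<le> t" using t slope by (auto simp: d_def)
  define U where "U = {y. \<bar>along y\<bar> < d \<and> \<bar>above y - 0\<bar> < d}"
  define B where "B = {y. \<bar>along y\<bar> < d \<and> \<bar>above y - t\<bar> < d}"
  define y where "y = x + t *\<^sub>R e"
  have y: "along y = 0" "above y = t" by (simp_all add: y_def)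
  have "y \<in> B" using y d by (simp add: B_def)
  moreover have "open B" unfolding B_def by (rule open_box)
  ultimately obtain \<rho> where \<rho>: "\<rho> > 0" "ball y \<rho> \<subseteq> B" using open_contains_ball by blast
  have "bounded U"
  proof (rule boundedI)
    fix v assume "v \<in> U"
    then have v: "\<bar>along v\<bar> < d" "\<bar>above v\<bar> < d" by (auto simp: U_def)
    have "norm v \<le> norm x + norm (along v *\<^sub>R rot90 e) + norm (above v *\<^sub>R e)"
      by (subst coords[of v]) (meson norm_triangle_ineq norm_triangle_mono order_refl)
    then show "norm v \<le> norm x + 2 * d" using v e by simp
  qed
  moreover have "open U" unfolding U_def by (rule open_box)
  moreover have "x \<in> U" using d by (simp add: U_def)
  moreover have "y \<in> \<Omega>" using graph[of y] y t d \<phi>0 rh by simp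
  moreover have "corner_linked \<Omega> (U \<inter> \<Omega>) (ball y \<rho>) (dir 1) (dir (-1))"
    unfolding corner_linked_def
  proof (intro ballI)
    fix z z' assume "z \<in> U \<inter> \<Omega>" and "z' \<in> ball y \<rho>"
    then have z: "z \<in> \<Omega>" "\<bar>along z\<bar> < d" "\<bar>above z\<bar> < d" and z': "\<bar>along z'\<bar> < d" "\<bar>above z' - t\<bar> < d"
      using \<rho> by (auto simp: U_def B_def)
    define p q where "p = along z' - along z" and "q = above z' - above z"
    define a b where "a = (q + p / slope) / 2" and "b = (q - p / slope) / 2"
    have p: "\<bar>p\<bar> < 2 * d" and q: "t - 2 * d < q" "q < t + 2 * d" using z z' by (auto simp: p_def q_def)
    have "\<bar>p / slope\<bar> < 2 * d / slope" using p slope by (simp add: divide_strict_right_mono)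
    also have "2 * d / slope = t / 4" using slope by (simp add: d_def)
    finally have "\<bar>p / slope\<bar> < q" using q d by linarith
    then have "0 \<le> q + p / slope" "0 \<le> q - p / slope" unfolding abs_less_iff by simp_all
    then have ab: "0 \<le> a" "0 \<le> b" by (simp_all add: a_def b_def)
    have apb: "a + b = q" and amb: "(a - b) * slope = p" using slope by (auto simp: a_def b_def field_simps)
    have zz: "z' = z + a *\<^sub>R dir 1 + b *\<^sub>R dir (-1)"
    proof -
      have "along (z + a *\<^sub>R dir 1 + b *\<^sub>R dir (-1)) = along z'"
        unfolding coords_cone using amb by (simp add: p_def)
      moreover have "above (z + a *\<^sub>R dir 1 + b *\<^sub>R dir (-1)) = above z'"
        unfolding coords_cone using apb by (simp add: q_def)
      ultimately show ?thesis using coords by metis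
    qed
    have inside: "z + a' *\<^sub>R dir 1 + b' *\<^sub>R dir (-1) \<in> \<Omega>" if "0 \<le> a'" "a' \<le> a" "0 \<le> b'" "b' \<le> b" for a' b'
    proof (rule up_cone[OF z(1) _ _ that(1,3) refl])
      let ?y = "z + a' *\<^sub>R dir 1 + b' *\<^sub>R dir (-1)"
      have above: "above ?y = above z + (a' + b')" and along: "along ?y = along z + (a' - b') * slope" by (rule coords_cone)+
      have "\<bar>(a' - b') * slope\<bar> \<le> \<bar>a' - b'\<bar> * 1" unfolding abs_mult using slope by (intro mult_left_mono) auto
      also have "\<dots> \<le> a' + b'" using that by auto
      also have "\<dots> \<le> q" using that apb by linarith
      finally show "\<bar>along ?y\<bar> < r" unfolding along using z(2) q d t by linarith
      show "\<bar>above ?y\<bar> < h" unfolding above using z(3) q d t that apb by linarith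
    qed (use z d t in auto)
    have seg: "y \<in> \<Omega>" if y: "y \<in> closed_segment (z + a1 *\<^sub>R dir 1 + b1 *\<^sub>R dir (-1)) (z + a2 *\<^sub>R dir 1 + b2 *\<^sub>R dir (-1))"
      and "a1 \<in> {0..a}" "a2 \<in> {0..a}" "b1 \<in> {0..b}" "b2 \<in> {0..b}" for y a1 a2 b1 b2
    proof -
      obtain u where u: "0 \<le> u" "u \<le> 1" "y = (1 - u) *\<^sub>R (z + a1 *\<^sub>R dir 1 + b1 *\<^sub>R dir (-1)) + u *\<^sub>R (z + a2 *\<^sub>R dir 1 + b2 *\<^sub>R dir (-1))"
        using y by (auto simp: in_segment)
      have "y = z + ((1 - u) * a1 + u * a2) *\<^sub>R dir 1 + ((1 - u) * b1 + u * b2) *\<^sub>R dir (-1)"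
        unfolding u(3) by (simp add: algebra_simps)
      moreover have "(1 - u) * a1 + u * a2 \<in> {0..a}" "(1 - u) * b1 + u * b2 \<in> {0..b}"
        using that(2-5) u(1,2) convexD_alt[of "{0..a}" a1 a2 u] convexD_alt[of "{0..b}" b1 b2 u] by auto
      ultimately show ?thesis using inside by auto
    qed
    show "\<exists>s t. z' = z + s *\<^sub>R dir 1 + t *\<^sub>R dir (-1) \<and>
      closed_segment z (z + s *\<^sub>R dir 1) \<union> closed_segment (z + s *\<^sub>R dir 1) z' \<subseteq> \<Omega> \<and>
      closed_segment z (z + t *\<^sub>R dir (-1)) \<union> closed_segment (z + t *\<^sub>R dir (-1)) z' \<subseteq> \<Omega>"
      using seg[of _ 0 0 a 0] seg[of _ a 0 a b] seg[of _ 0 0 0 b] seg[of _ 0 b a b] ab zz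
      by (intro exI[of _ a] exI[of _ b] conjI Un_least subsetI) auto
  qed
  ultimately show ?thesis using \<rho>(1) by blast
qed

text \<open>
  If the boundary near \<open>x\<close> contains a segment, then the graph is linear there, all its
  points are flat, and the lines in the directions \<open>dir 1\<close> and \<open>dir (-1)\<close>
  going down from a small ball above \<open>x\<close> leave the domain through the segment.
\<close>
lemma anchor:
  assumes w: "w \<noteq> 0" and \<delta>: "\<delta> > 0" and bd: "\<And>l. \<bar>l\<bar> < \<delta> \<Longrightarrow> x + l *\<^sub>R w \<in> frontier \<Omega>"
    and Z: "Z = {x + l *\<^sub>R w | l. \<bar>l\<bar> < \<delta>} \<inter> {y. flat_point \<Omega> y}"
  shows "\<exists>z \<rho>. z \<in> \<Omega> \<and> \<rho> > 0 \<and> sobolev_set \<Omega> Z (ball z \<rho>)"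
proof -
  define w1 w2 where "w1 = w \<bullet> rot90 e" and "w2 = w \<bullet> e"
  have w12: "w = w1 *\<^sub>R rot90 e + w2 *\<^sub>R e" unfolding w1_def w2_def by (rule orthonormal_expansion)
  have coordsw: "along (x + l *\<^sub>R w) = l * w1" "above (x + l *\<^sub>R w) = l * w2" for l
    by (simp_all add: along_def above_def w1_def w2_def)
  have lin: "l * w2 = \<phi> (l * w1)" if "\<bar>l\<bar> < \<delta>" "\<bar>l * w1\<bar> < r" "\<bar>l * w2\<bar> < h" for l
    using frontier_graph[of "x + l *\<^sub>R w"] bd that by (simp add: coordsw)
  have w1: "w1 \<noteq> 0"
  proof
    assume 0: "w1 = 0"
    define l where "l = min (\<delta> / 2) (h / (2 * (\<bar>w2\<bar> + 1)))"
    have "l \<le> \<delta> / 2" unfolding l_def by (rule min.cobounded1)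
    then have l: "l > 0" "l < \<delta>" using \<delta> rh by (auto simp: l_def)
    have "l * \<bar>w2\<bar> \<le> h / (2 * (\<bar>w2\<bar> + 1)) * \<bar>w2\<bar>" by (intro mult_right_mono) (auto simp: l_def)
    also have "\<dots> < h" using rh by (simp add: field_simps add_nonneg_pos)
    finally have "l * w2 = \<phi> 0" using lin[of l] l 0 rh by (simp add: abs_mult)
    then have "w2 = 0" using l \<phi>0 by simp
    then show False using w12 0 w by simp
  qed
  define m where "m = w2 / w1"
  define \<eta> where "\<eta> = min (\<delta> * \<bar>w1\<bar>) (min r (h / (\<bar>m\<bar> + 1)))"
  have \<eta>: "\<eta> > 0" "\<eta> \<le> \<delta> * \<bar>w1\<bar>" "\<eta> \<le> r" "\<eta> \<le> h / (\<bar>m\<bar> + 1)" using \<delta> w1 rh by (auto simp: \<eta>_def)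
  have \<phi>m: "\<phi> s = m * s" if s: "\<bar>s\<bar> < \<eta>" for s
  proof -
    have "\<bar>s / w1\<bar> < \<delta>" using s \<eta>(2) w1 by (simp add: pos_divide_less_eq)
    moreover have "\<bar>s / w1 * w1\<bar> < r" using s \<eta>(3) w1 by simp
    moreover have "\<bar>s / w1 * w2\<bar> < h"
    proof -
      have "\<bar>s / w1 * w2\<bar> = \<bar>m\<bar> * \<bar>s\<bar>" by (simp add: m_def abs_mult)
      also have "\<dots> \<le> \<bar>m\<bar> * (h / (\<bar>m\<bar> + 1))" using s \<eta>(4) by (intro mult_left_mono) auto
      also have "\<dots> < h" using rh by (simp add: field_simps)
      finally show ?thesis .
    qed
    ultimately have "s / w1 * w2 = \<phi> (s / w1 * w1)" by (rule lin)
    then show ?thesis using w1 by (simp add: m_def mult.commute)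
  qed
  have mL: "\<bar>m\<bar> \<le> L"
  proof -
    have "\<bar>\<phi> (\<eta> / 2) - \<phi> 0\<bar> \<le> L * \<bar>\<eta> / 2 - 0\<bar>" using \<eta> rh by (intro lip_le) auto
    then have "\<bar>m\<bar> * (\<eta> / 2) \<le> L * (\<eta> / 2)" using \<phi>m[of "\<eta> / 2"] \<phi>0 \<eta>(1) by (simp add: abs_mult)
    then show ?thesis using \<eta>(1) by simp
  qed
  define t where "t = slope * min \<eta> h / 8"
  define d where "d = t * slope / 2"
  have t: "t > 0" using \<eta> rh slope by (simp add: t_def)
  have tk: "8 * (t / slope) \<le> \<eta>" "8 * (t / slope) \<le> h" using slope by (auto simp: t_def)
  have ttk: "t \<le> t / slope" using t slope by (simp add: field_simps)
  have d: "d > 0" "2 * d \<le> t" using t slope by (auto simp: d_def)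
  have Ld: "L * d \<le> t / 2 - d"
  proof -
    have "L * d = (L * slope) * t / 2" by (simp add: d_def)
    also have "\<dots> = t / 2 - d" unfolding slope(3) d_def by (simp add: field_simps)
    finally show ?thesis by simp
  qed
  define A where "A = {y. \<bar>along y\<bar> < d \<and> \<bar>above y - t\<bar> < d}"
  have oA: "open A" unfolding A_def by (rule open_box)
  define y where "y = x + t *\<^sub>R e"
  have ycoords: "along y = 0" "above y = t" by (simp_all add: y_def)
  have "y \<in> A" using ycoords d by (simp add: A_def)
  then obtain \<rho> where \<rho>: "\<rho> > 0" "ball y \<rho> \<subseteq> A" using oA open_contains_ball by blast
  have y\<Omega>: "y \<in> \<Omega>" using graph[of y] ycoords t ttk tk \<phi>0 rh by simp
  have "sobolev_set \<Omega> Z (ball y \<rho>)"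
  proof (rule sobolev_set_anchor[OF op _ _ dir_independent])
    fix z g assume "z \<in> ball y \<rho>" and "g \<in> {dir 1, dir (-1)}"
    then have z: "\<bar>along z\<bar> < d" "\<bar>above z - t\<bar> < d" using \<rho> by (auto simp: A_def)
    obtain c where c: "c = 1 \<or> c = -1" "g = dir c" using \<open>g \<in> _\<close> by blast
    \<comment> \<open>\<open>n\<close> is the rate at which the height over the graph decreases along \<open>-
      g\<close>, so the line from \<open>z\<close> reaches the graph after time \<open>g0 / n\<close>.\<close>
    define n where "n = 1 - c * m * slope"
    have n: "slope \<le> n"
    proof -
      have "c * m * slope \<le> L * slope" using c mL slope by (intro mult_right_mono) auto
      then show ?thesis using slope(3) by (simp add: n_def)
    qed
    define g0 where "g0 = above z - m * along z"
    have mS: "\<bar>m * along z\<bar> \<le> t / 2 - d"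
    proof -
      have "\<bar>m * along z\<bar> \<le> L * d" unfolding abs_mult using mL z d by (intro mult_mono) auto
      then show ?thesis using Ld by simp
    qed
    have g0: "0 < g0" "g0 \<le> 2 * t" using mS z(2) d t unfolding g0_def by linarith+
    define s where "s = g0 / n"
    have s: "0 < s" "s \<le> 2 * (t / slope)" 
      using g0 n slope t by (auto simp: s_def intro!: divide_pos_pos order_trans[OF frac_le[OF _ g0(2) slope(1) n]])
    have coordsy: "along (z - a *\<^sub>R g) = along z - a * c * slope" "above (z - a *\<^sub>R g) = above z - a" for a
      using coords_dir[of z "-a" c] c(2) by simp_all
    have bnd: "\<bar>along (z - a *\<^sub>R g)\<bar> < \<eta>" "\<bar>above (z - a *\<^sub>R g)\<bar> < h" if "0 \<le> a" "a \<le> s" for a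
    proof -
      have "\<bar>a * c * slope\<bar> = a * slope" using c that slope by (auto simp: abs_mult)
      also have "\<dots> \<le> a * 1" using slope that by (intro mult_left_mono) auto
      finally have "\<bar>a * c * slope\<bar> \<le> 2 * (t / slope)" using that s by linarith
      then show "\<bar>along (z - a *\<^sub>R g)\<bar> < \<eta>" unfolding coordsy using z(1) d tk ttk t by linarith
      show "\<bar>above (z - a *\<^sub>R g)\<bar> < h" unfolding coordsy using z(2) d tk ttk t that s by linarith
    qed
    have TmS: "above (z - a *\<^sub>R g) - m * along (z - a *\<^sub>R g) = g0 - a * n" for a
      unfolding coordsy g0_def n_def by (simp add: algebra_simps)
    define v where "v = z - s *\<^sub>R g"
    have vS: "\<bar>along v\<bar> < \<eta>" "\<bar>above v\<bar> < h" using bnd[of s] s by (simp_all add: v_def)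
    have vT: "above v = m * along v" using TmS[of s] n slope by (simp add: v_def s_def)
    have "flat_point \<Omega> v"
    proof -
      have "open {y. \<bar>along y\<bar> < \<eta> \<and> \<bar>above y - 0\<bar> < h}" by (rule open_box)
      moreover have "v \<in> {y. \<bar>along y\<bar> < \<eta> \<and> \<bar>above y - 0\<bar> < h}" using vS by simp
      ultimately obtain \<rho>' where \<rho>': "\<rho>' > 0" "ball v \<rho>' \<subseteq> {y. \<bar>along y\<bar> < \<eta> \<and> \<bar>above y - 0\<bar> < h}"
        using open_contains_ball by blast
      have "y \<in> \<Omega> \<longleftrightarrow> 0 < (y - v) \<bullet> (e - m *\<^sub>R rot90 e)" if "y \<in> ball v \<rho>'" for y
      proof -
        have y: "\<bar>along y\<bar> < \<eta>" "\<bar>above y\<bar> < h" using that \<rho>' by auto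
        have "(y - v) \<bullet> (e - m *\<^sub>R rot90 e) = (above y - m * along y) - (above v - m * along v)"
          by (simp add: along_def above_def inner_diff_left inner_diff_right algebra_simps)
        then have "(y - v) \<bullet> (e - m *\<^sub>R rot90 e) = above y - \<phi> (along y)" using vT \<phi>m[OF y(1)] by simp
        then show ?thesis using graph[of y] y \<eta>(3) by auto
      qed
      moreover have "e - m *\<^sub>R rot90 e \<noteq> 0"
      proof
        assume "e - m *\<^sub>R rot90 e = 0"
        then have "(e - m *\<^sub>R rot90 e) \<bullet> e = 0" by simp
        then show False using e_inner by (simp add: inner_diff_left)
      qed
      ultimately show ?thesis unfolding flat_point_def using \<rho>'(1) by blast
    qed
    moreover have "\<exists>l. v = x + l *\<^sub>R w \<and> \<bar>l\<bar> < \<delta>"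
    proof (intro exI conjI)
      show "\<bar>along v / w1\<bar> < \<delta>" using vS(1) \<eta>(2) w1 by (simp add: pos_divide_less_eq)
      have "v = x + along v *\<^sub>R rot90 e + (m * along v) *\<^sub>R e" using coords[of v] vT by simp
      also have "\<dots> = x + (along v / w1) *\<^sub>R w" using w1 by (subst w12) (simp add: m_def algebra_simps)
      finally show "v = x + (along v / w1) *\<^sub>R w" .
    qed
    moreover have "closed_segment v z - {v} \<subseteq> \<Omega>"
    proof
      fix y assume y: "y \<in> closed_segment v z - {v}"
      then obtain u where u: "0 \<le> u" "u \<le> 1" "y = (1 - u) *\<^sub>R v + u *\<^sub>R z" by (auto simp: in_segment)
      then have "u \<noteq> 0" using y by auto
      then have u0: "u > 0" using u by simp
      have yz: "y = z - ((1 - u) * s) *\<^sub>R g" unfolding u(3) v_def by (simp add: algebra_simps)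
      have 1: "0 \<le> (1 - u) * s" "(1 - u) * s \<le> s" using u s by (auto simp: mult_le_cancel_right1)
      have "above y - m * along y = u * g0" using TmS[of "(1 - u) * s"] n slope unfolding yz s_def by (simp add: field_simps)
      then have "m * along y < above y" using mult_pos_pos[OF u0 g0(1)] by linarith
      then have "\<phi> (along y) < above y" using \<phi>m[of "along y"] bnd(1)[OF 1] unfolding yz by simp
      then show "y \<in> \<Omega>" using graph[of y] bnd[OF 1] \<eta>(3) unfolding yz by simp
    qed
    ultimately show "\<exists>s. z - s *\<^sub>R g \<in> Z \<and> closed_segment (z - s *\<^sub>R g) z - {z - s *\<^sub>R g} \<subseteq> \<Omega> \<and> s \<noteq> 0"
      using s by (intro exI[of _ s]) (auto simp: Z v_def)
  qed auto
  then show ?thesis using y\<Omega> \<rho>(1) by blast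
qed

end

text \<open>
  The ball of \<open>anchor\<close> satisfies the inequality, hence so does a ball around each point
  of \<open>\<Omega>\<close>, hence a neighbourhood of each boundary point; compactness of the
  closure leaves finitely many of these sets.
\<close>
lemma sobolev_domain:
  assumes lip: "lipschitz_domain \<Omega>" and bnd: "bounded \<Omega>"
    and w: "w \<noteq> 0" and \<delta>: "\<delta> > 0" and bd: "\<And>l. \<bar>l\<bar> < \<delta> \<Longrightarrow> x + l *\<^sub>R w \<in> frontier \<Omega>"
    and Z: "Z = {x + l *\<^sub>R w | l. \<bar>l\<bar> < \<delta>} \<inter> {y. flat_point \<Omega> y}"
  shows "sobolev_set \<Omega> Z \<Omega>"
proof -
  have op: "open \<Omega>" and con: "connected \<Omega>" using lip by (auto simp: lipschitz_domain_def)
  have chart: "\<exists>e \<phi> L r h. boundary_chart \<Omega> y e \<phi> L r h" if y: "y \<in> frontier \<Omega>" for y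
  proof -
    obtain e \<phi> L r h where "norm e = 1 \<and> 0 < r \<and> 0 < h \<and> L-lipschitz_on {-r<..<r} \<phi> \<and>
        (\<forall>s\<in>{-r<..<r}. \<forall>t\<in>{-h<..<h}. y + s *\<^sub>R rot90 e + t *\<^sub>R e \<in> \<Omega> \<longleftrightarrow> \<phi> s < t)"
      using lip y unfolding lipschitz_domain_def by blast
    then have "boundary_chart \<Omega> y e \<phi> L r h" using op y by unfold_locales auto
    then show ?thesis by blast
  qed
  have "x \<in> frontier \<Omega>" using bd[of 0] \<delta> by simp
  then obtain e \<phi> L r h where "boundary_chart \<Omega> x e \<phi> L r h" using chart by blast
  then obtain z0 \<rho>0 where "z0 \<in> \<Omega>" "\<rho>0 > 0" "sobolev_set \<Omega> Z (ball z0 \<rho>0)"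
    using boundary_chart.anchor[OF _ w \<delta> bd Z] by blast
  then have ball: "\<exists>r>0. sobolev_set \<Omega> Z (ball z r)" if "z \<in> \<Omega>" for z
    using sobolev_interior[OF op con _ _ _ that] by blast
  have loc: "\<exists>U. open U \<and> y \<in> U \<and> sobolev_set \<Omega> Z (U \<inter> \<Omega>)" if y: "y \<in> closure \<Omega>" for y
  proof (cases "y \<in> \<Omega>")
    case True
    then obtain r where "r > 0" "sobolev_set \<Omega> Z (ball y r)" using ball by blast
    then show ?thesis by (intro exI[of _ "ball y r"]) (auto intro: sobolev_set_subset)
  next
    case False
    then have "y \<in> frontier \<Omega>" using y op by (simp add: frontier_def interior_open)
    then obtain e \<phi> L r h where "boundary_chart \<Omega> y e \<phi> L r h" using chart by blast
    then interpret boundary_chart \<Omega> y e \<phi> L r h .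
    obtain U y' \<rho> where U: "open U" "y \<in> U" "bounded U" "y' \<in> \<Omega>" "\<rho> > 0"
        "corner_linked \<Omega> (U \<inter> \<Omega>) (ball y' \<rho>) (dir 1) (dir (-1))"
      using boundary_link by blast
    obtain r' where r': "r' > 0" "sobolev_set \<Omega> Z (ball y' r')" using ball U(4) by blast
    have "sobolev_set \<Omega> Z (U \<inter> \<Omega>)"
    proof (rule sobolev_set_transfer[OF op _ _ dir_independent])
      show "U \<inter> \<Omega> \<in> sets borel" using U(1) op by auto
      show "bounded (U \<inter> \<Omega>)" using U(3) by (rule bounded_subset) auto
      show "ball y' (min \<rho> r') \<noteq> {}" using U(5) r'(1) by simp
      show "sobolev_set \<Omega> Z (ball y' (min \<rho> r'))" by (rule sobolev_set_subset[OF r'(2)]) auto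
      show "corner_linked \<Omega> (U \<inter> \<Omega>) (ball y' (min \<rho> r')) (dir 1) (dir (-1))"
        using U(6) unfolding corner_linked_def by auto
    qed auto
    then show ?thesis using U by blast
  qed
  define \<U> where "\<U> = {U. open U \<and> sobolev_set \<Omega> Z (U \<inter> \<Omega>)}"
  have "compact (closure \<Omega>)" using bnd by (simp add: compact_closure)
  moreover have "\<And>U. U \<in> \<U> \<Longrightarrow> open U" "closure \<Omega> \<subseteq> \<Union>\<U>" using loc by (auto simp: \<U>_def)
  ultimately obtain \<V> where V: "\<V> \<subseteq> \<U>" "finite \<V>" "closure \<Omega> \<subseteq> \<Union>\<V>"
    using compactE[of "closure \<Omega>" \<U>] by metis
  have "sobolev_set \<Omega> Z (\<Union>((\<lambda>U. U \<inter> \<Omega>) ` \<V>))"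
    using V op by (intro sobolev_set_Union) (auto simp: \<U>_def)
  then show ?thesis
    by (rule sobolev_set_subset) (use V(3) closure_subset[of \<Omega>] in auto)
qed

section \<open>From the Sobolev inequality to Lebesgue norms\<close>

lemma Holder_sum:
  fixes w f g :: "'e \<Rightarrow> real"
  assumes fin: "finite E" and nn: "\<And>e. e \<in> E \<Longrightarrow> 0 \<le> w e" "\<And>e. e \<in> E \<Longrightarrow> 0 \<le> f e" "\<And>e. e \<in> E \<Longrightarrow> 0 \<le> g e"
    and p: "1 < p" "1 < p'" "1 / p + 1 / p' = 1"
  shows "(\<Sum>e\<in>E. w e * (f e * g e)) \<le> (\<Sum>e\<in>E. w e * f e powr p) powr (1 / p) * (\<Sum>e\<in>E. w e * g e powr p') powr (1 / p')"
proof -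
  let ?A = "\<Sum>e\<in>E. w e * f e powr p" and ?B = "\<Sum>e\<in>E. w e * g e powr p'"
  have A: "?A \<ge> 0" and B: "?B \<ge> 0" using nn by (auto intro!: sum_nonneg)
  show ?thesis
  proof (cases "?A = 0 \<or> ?B = 0")
    case True
    then have "w e * (f e * g e) = 0" if "e \<in> E" for e
    proof
      assume "?A = 0"
      then have "w e * f e powr p = 0" using that fin nn by (simp add: sum_nonneg_eq_0_iff)
      then show ?thesis by auto
    next
      assume "?B = 0"
      then have "w e * g e powr p' = 0" using that fin nn by (simp add: sum_nonneg_eq_0_iff)
      then show ?thesis by auto
    qed
    then have "(\<Sum>e\<in>E. w e * (f e * g e)) = 0" by (intro sum.neutral) blast
    then show ?thesis by simp
  next
    case False
    then have A0: "?A > 0" and B0: "?B > 0" using A B by auto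
    define a b where "a = ?A powr (1 / p)" and "b = ?B powr (1 / p')"
    have ab: "a > 0" "b > 0" using A0 B0 by (auto simp: a_def b_def)
    have ap: "a powr p = ?A" "b powr p' = ?B" using A0 B0 p by (simp_all add: a_def b_def powr_powr)
    have "(\<Sum>e\<in>E. w e * (f e * g e)) / (a * b) = (\<Sum>e\<in>E. w e * ((f e / a) * (g e / b)))"
      by (simp add: sum_divide_distrib)
    also have "\<dots> \<le> (\<Sum>e\<in>E. w e * ((f e / a) powr p / p + (g e / b) powr p' / p'))"
      using nn ab p by (intro sum_mono mult_left_mono Youngs_inequality) auto
    also have "\<dots> = (\<Sum>e\<in>E. (w e * f e powr p) * (1 / (p * ?A)) + (w e * g e powr p') * (1 / (p' * ?B)))"
      using nn ab by (intro sum.cong refl) (simp add: powr_divide ap ring_distribs mult.commute)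
    also have "\<dots> = ?A * (1 / (p * ?A)) + ?B * (1 / (p' * ?B))"
      by (simp only: sum.distrib sum_distrib_right)
    also have "\<dots> = 1" using A0 B0 p by simp
    finally show ?thesis using ab by (simp add: a_def b_def field_simps)
  qed
qed

text \<open>
  Hoelder's inequality with the constant function \<open>1\<close>; \<open>M\<close> bounds the
  total mass.
\<close>
lemma power_mean_sum:
  fixes m x :: "'i \<Rightarrow> real"
  assumes fin: "finite I" and nn: "\<And>i. i \<in> I \<Longrightarrow> 0 \<le> m i" "\<And>i. i \<in> I \<Longrightarrow> 0 \<le> x i"
    and M: "sum m I \<le> M" and r: "0 < r" "r \<le> R"
  shows "(\<Sum>i\<in>I. m i * x i powr r) \<le> M powr (1 - r / R) * (\<Sum>i\<in>I. m i * x i powr R) powr (r / R)"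
proof (cases "r = R")
  case True
  have M0: "M \<ge> 0" using sum_nonneg[of I m] nn M by force
  show ?thesis
  proof (cases "M = 0")
    case True
    then have "sum m I = 0" using sum_nonneg[of I m] nn M by force
    then have "m i = 0" if "i \<in> I" for i using that fin nn by (simp add: sum_nonneg_eq_0_iff)
    then show ?thesis by simp
  next
    case False
    then show ?thesis using \<open>r = R\<close> r nn M0 by (simp add: sum_nonneg)
  qed
next
  case False
  then have rR: "r < R" using r by simp
  define p p' where "p = R / r" and "p' = R / (R - r)"
  have pp: "1 < p" "1 < p'" "1 / p + 1 / p' = 1" using r rR by (auto simp: p_def p'_def field_simps)
  have "(\<Sum>i\<in>I. m i * (x i powr r * 1)) \<le>
     (\<Sum>i\<in>I. m i * (x i powr r) powr p) powr (1 / p) * (\<Sum>i\<in>I. m i * 1 powr p') powr (1 / p')"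
    using fin nn by (intro Holder_sum pp) auto
  also have "(\<Sum>i\<in>I. m i * (x i powr r) powr p) = (\<Sum>i\<in>I. m i * x i powr R)"
    using r by (simp add: powr_powr p_def)
  also have "1 / p = r / R" by (simp add: p_def)
  also have "1 / p' = 1 - r / R" using r rR by (simp add: p'_def field_simps)
  also have "(\<Sum>i\<in>I. m i * 1 powr p') = sum m I" by simp
  also have "(\<Sum>i\<in>I. m i * x i powr R) powr (r / R) * sum m I powr (1 - r / R)
     \<le> (\<Sum>i\<in>I. m i * x i powr R) powr (r / R) * M powr (1 - r / R)"
    using M nn r rR by (intro mult_left_mono powr_mono2) (auto intro: sum_nonneg)
  finally show ?thesis by (simp add: mult.commute)
qed

lemma abs_powr_diff_le:
  fixes x y s :: real
  assumes s: "1 \<le> s"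
  shows "\<bar>\<bar>x\<bar> powr s - \<bar>y\<bar> powr s\<bar> \<le> s * \<bar>x - y\<bar> * (\<bar>x\<bar> powr (s - 1) + \<bar>y\<bar> powr (s - 1))"
proof -
  have key: "a powr s - b powr s \<le> s * (a - b) * a powr (s - 1)" if ab: "0 \<le> b" "b \<le> a" for a b :: real
  proof (cases "b = 0 \<or> b = a")
    case True
    have "a powr s = a * a powr (s - 1)" if "a > 0" using that by (simp add: powr_diff)
    moreover have "a * a powr (s - 1) \<le> s * (a * a powr (s - 1))"
      using s ab by (intro mult_right_mono[of 1 s, simplified]) auto
    ultimately show ?thesis using True ab s by (cases "a = 0") (auto simp: mult.assoc)
  next
    case False
    then have ab': "0 < b" "b < a" using ab by auto
    have "\<exists>z>b. z < a \<and> a powr s - b powr s = (a - b) * (s * z powr (s - 1))"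
      using ab' by (intro MVT2) (auto intro!: derivative_eq_intros)
    then obtain z where z: "b < z" "z < a" "a powr s - b powr s = (a - b) * (s * z powr (s - 1))" by blast
    have "z powr (s - 1) \<le> a powr (s - 1)" using z ab' s by (intro powr_mono2) auto
    then have "(a - b) * (s * z powr (s - 1)) \<le> (a - b) * (s * a powr (s - 1))"
      using ab' s by (intro mult_left_mono) auto
    then show ?thesis using z(3) by (simp add: ac_simps)
  qed
  have main: "\<bar>a powr s - b powr s\<bar> \<le> s * (a - b) * (a powr (s - 1) + b powr (s - 1))"
    if ab: "0 \<le> b" "b \<le> a" for a b :: real
  proof -
    have "b powr s \<le> a powr s" using ab s by (intro powr_mono2) auto
    moreover have "s * (a - b) * a powr (s - 1) \<le> s * (a - b) * (a powr (s - 1) + b powr (s - 1))"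
      using ab s by (intro mult_left_mono) auto
    ultimately show ?thesis using key[OF ab] by linarith
  qed
  have tri: "s * \<bar>\<bar>x\<bar> - \<bar>y\<bar>\<bar> * (\<bar>x\<bar> powr (s - 1) + \<bar>y\<bar> powr (s - 1)) \<le> s * \<bar>x - y\<bar> * (\<bar>x\<bar> powr (s - 1) + \<bar>y\<bar> powr (s - 1))"
    using s by (intro mult_right_mono mult_left_mono) auto
  show ?thesis
  proof (cases "\<bar>y\<bar> \<le> \<bar>x\<bar>")
    case True
    then show ?thesis using main[of "\<bar>y\<bar>" "\<bar>x\<bar>"] tri by simp
  next
    case False
    then show ?thesis using main[of "\<bar>x\<bar>" "\<bar>y\<bar>"] tri by (simp add: abs_minus_commute add.commute)
  qed
qed

text \<open>
  The power of \<open>\<bar>u\<bar>\<close> to which the Sobolev inequality is applied. For \<open>p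
  < 2\<close> twice this exponent is the critical exponent \<open>p\<^sup>*\<close>; for \<open>p
  \<ge> 2\<close> it only has to be large, and \<open>q + 1\<close> also keeps the exponent
  \<open>r\<close> in the proof of \<open>sobolev_to_Lq\<close> positive.
\<close>
definition lift_exponent :: "real \<Rightarrow> real \<Rightarrow> real" where
  "lift_exponent p q = (if p < 2 then p / (2 - p) else q + 1)"

text \<open>
  Written out to make visible that it depends on the total mass \<open>M\<close> and the Sobolev
  constant \<open>C\<close> only.
\<close>
definition Lq_constant :: "real \<Rightarrow> real \<Rightarrow> real \<Rightarrow> real \<Rightarrow> real" where
  "Lq_constant p q M C = (1 + M) * (C * lift_exponent p q * (2 * (1 + M)))"

lemma Lq_constant_pos:
  assumes "1 \<le> p \<and> p < 2 \<and> 1 \<le> q \<and> q \<le> 2 * p / (2 - p) \<or> 2 \<le> p \<and> 1 \<le> q" "0 \<le> M" "0 < C"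
  shows "0 < Lq_constant p q M C"
proof -
  have "0 < lift_exponent p q" using assms(1) by (auto simp: lift_exponent_def)
  then show ?thesis using assms by (simp add: Lq_constant_def)
qed

text \<open>
  Let \<open>X\<close> be the weighted sum of \<open>\<bar>U\<bar>\<close> to the power \<open>2
  s\<close> and \<open>B\<close> the factor after \<open>Lq_constant\<close>. For \<open>p >
  1\<close> the Sobolev inequality and Hoelder's inequality give \<open>X\<^bsup>1/2\<^esup> \<le> C
  \<cdot> B \<cdot> X\<^bsup>(s-1)/(2s)\<^esup>\<close>, because the exponent \<open>r = (s - 1)
  p'\<close> that Hoelder's inequality produces is at most \<open>2 s\<close>. Dividing leaves
  \<open>X\<^bsup>1/(2s)\<^esup> \<le> C \<cdot> B\<close>, and \<open>q \<le> 2 s\<close>. In the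
  application \<open>w\<close> is the product of the two diagonals of a diamond, \<open>l\<close>
  the length of the edge, \<open>g\<close> the difference quotient across it and \<open>G\<close>
  the gradient term of (R1).
\<close>
lemma sobolev_to_Lq:
  fixes m U :: "'i \<Rightarrow> real" and w g l a b :: "'e \<Rightarrow> real" and p q :: real
  defines "s \<equiv> lift_exponent p q"
  assumes pq: "1 \<le> p \<and> p < 2 \<and> 1 \<le> q \<and> q \<le> 2 * p / (2 - p) \<or> 2 \<le> p \<and> 1 \<le> q" and M: "0 \<le> M" and C0: "0 < C0"
    and fin: "finite I" "finite E" and m: "\<forall>i\<in>I. 0 \<le> m i" "sum m I \<le> M"
    and e: "\<forall>e\<in>E. 0 \<le> w e \<and> 0 \<le> g e \<and> 0 \<le> l e \<and> l e * \<bar>a e - b e\<bar> = w e * g e"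
    and sob: "(\<Sum>i\<in>I. m i * \<bar>U i\<bar> powr (2 * s)) \<le> (C0 * (\<Sum>e\<in>E. l e * \<bar>\<bar>a e\<bar> powr s - \<bar>b e\<bar> powr s\<bar>))\<^sup>2"
    and G: "(\<Sum>e\<in>E. w e * g e powr p) \<le> G" and \<zeta>: "0 < \<zeta>"
    and R2: "\<And>r. 0 < r \<Longrightarrow> (\<Sum>e\<in>E. w e * (\<bar>a e\<bar> powr r + \<bar>b e\<bar> powr r)) \<le> (\<Sum>i\<in>I. m i * \<bar>U i\<bar> powr r) / \<zeta>"
  shows "(\<Sum>i\<in>I. m i * \<bar>U i\<bar> powr q) \<le> (Lq_constant p q M C0 * (G powr (1 / p) / \<zeta> powr ((p - 1) / p))) powr q"
proof -
  have p: "1 \<le> p" and q: "1 \<le> q" using pq by auto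
  have s_eq: "s = (if p < 2 then p / (2 - p) else q + 1)" by (simp add: s_def lift_exponent_def)
  have s: "1 \<le> s" "q \<le> 2 * s" using pq by (auto simp: s_eq field_simps)
  define r where "r = (s - 1) * (p / (p - 1))"
  have r: "0 < r" "r \<le> 2 * s" if "1 < p"
  proof -
    show "0 < r" using that pq by (auto simp: r_def s_eq field_simps)
    show "r \<le> 2 * s"
    proof (cases "p < 2")
      case True
      have "s - 1 = 2 * (p - 1) / (2 - p)" using True by (simp add: s_eq field_simps)
      then have "r = 2 * (p - 1) / (2 - p) * (p / (p - 1))" by (simp add: r_def)
      also have "\<dots> = 2 * (p / (2 - p))"
      proof -
        have "p - 1 \<noteq> 0" using that by simp
        moreover have "2 * (p - 1) / (2 - p) * (p / (p - 1)) = (p - 1) * (2 * p) / ((p - 1) * (2 - p))"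
          by (simp add: ac_simps)
        ultimately show ?thesis by simp
      qed
      finally show ?thesis using True by (simp add: s_eq)
    next
      case False
      have "p / (p - 1) \<le> 2" using False by (simp add: field_simps)
      then have "r \<le> (s - 1) * 2" unfolding r_def using s by (intro mult_left_mono) auto
      then show ?thesis by simp
    qed
  qed
  define C1 where "C1 = C0 * s * (2 * (1 + M))"
  have C1: "C1 > 0" using C0 s M by (simp add: C1_def)
  define X where "X = (\<Sum>i\<in>I. m i * \<bar>U i\<bar> powr (2 * s))"
  define TV where "TV = (\<Sum>e\<in>E. l e * \<bar>\<bar>a e\<bar> powr s - \<bar>b e\<bar> powr s\<bar>)"
  define B where "B = G powr (1 / p) / \<zeta> powr ((p - 1) / p)"
  have X0: "X \<ge> 0" using m by (auto simp: X_def intro!: sum_nonneg)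
  have TV0: "TV \<ge> 0" using e by (auto simp: TV_def intro!: sum_nonneg)
  have G0': "(\<Sum>e\<in>E. w e * g e powr p) \<ge> 0" using e by (auto intro!: sum_nonneg)
  then have G0: "G \<ge> 0" using G by simp
  have B0: "B \<ge> 0" by (simp add: B_def)
  have XTV: "X powr (1/2) \<le> C0 * TV"
  proof -
    have "X powr (1/2) \<le> ((C0 * TV)\<^sup>2) powr (1/2)" using sob X0 by (intro powr_mono2) (auto simp: X_def TV_def)
    also have "\<dots> = C0 * TV" using C0 TV0 by (simp add: powr_half_sqrt)
    finally show ?thesis .
  qed
  have TV1: "TV \<le> s * (\<Sum>e\<in>E. w e * (g e * (\<bar>a e\<bar> powr (s - 1) + \<bar>b e\<bar> powr (s - 1))))"
    unfolding TV_def sum_distrib_left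
  proof (rule sum_mono)
    fix x assume x: "x \<in> E"
    have "l x * \<bar>\<bar>a x\<bar> powr s - \<bar>b x\<bar> powr s\<bar> \<le> l x * (s * \<bar>a x - b x\<bar> * (\<bar>a x\<bar> powr (s - 1) + \<bar>b x\<bar> powr (s - 1)))"
      using e x by (intro mult_left_mono abs_powr_diff_le s) auto
    also have "\<dots> = s * ((l x * \<bar>a x - b x\<bar>) * (\<bar>a x\<bar> powr (s - 1) + \<bar>b x\<bar> powr (s - 1)))" by simp
    also have "l x * \<bar>a x - b x\<bar> = w x * g x" using e x by blast
    finally show "l x * \<bar>\<bar>a x\<bar> powr s - \<bar>b x\<bar> powr s\<bar> \<le> s * (w x * (g x * (\<bar>a x\<bar> powr (s - 1) + \<bar>b x\<bar> powr (s - 1))))"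
      by (simp add: mult.assoc)
  qed
  have key: "X powr (1 / (2 * s)) \<le> C1 * B"
  proof (cases "p = 1")
    case True
    then have s1: "s = 1" by (simp add: s_eq)
    have "TV = (\<Sum>e\<in>E. l e * \<bar>\<bar>a e\<bar> - \<bar>b e\<bar>\<bar>)" by (simp add: TV_def s1)
    also have "\<dots> \<le> (\<Sum>e\<in>E. w e * g e)"
    proof (rule sum_mono)
      fix x assume x: "x \<in> E"
      have "l x * \<bar>\<bar>a x\<bar> - \<bar>b x\<bar>\<bar> \<le> l x * \<bar>a x - b x\<bar>" using e x by (intro mult_left_mono) auto
      then show "l x * \<bar>\<bar>a x\<bar> - \<bar>b x\<bar>\<bar> \<le> w x * g x" using e x by auto
    qed
    also have "\<dots> \<le> G" using G e True by simp
    finally have "C0 * TV \<le> C0 * G" using C0 by simp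
    then have "X powr (1/2) \<le> C0 * G" using XTV by simp
    also have "\<dots> = C0 * B" using True G0 \<zeta> by (simp add: B_def)
    also have "\<dots> \<le> C1 * B" using C0 M s B0 unfolding C1_def s1 by (intro mult_right_mono) (auto simp: mult_le_cancel_left1)
    finally show ?thesis by (simp add: s1)
  next
    case False
    then have p1: "1 < p" using p by simp
    define p' where "p' = p / (p - 1)"
    have p': "1 < p'" "1 / p + 1 / p' = 1" "1 / p' = (p - 1) / p" using p1 by (auto simp: p'_def field_simps)
    let ?h = "\<lambda>e. \<bar>a e\<bar> powr (s - 1) + \<bar>b e\<bar> powr (s - 1)"
    define Y where "Y = (\<Sum>i\<in>I. m i * \<bar>U i\<bar> powr r)"
    have Y0: "Y \<ge> 0" using m by (auto simp: Y_def intro!: sum_nonneg)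
    have Y: "Y \<le> M powr (1 - r / (2 * s)) * X powr (r / (2 * s))"
      unfolding Y_def X_def using m fin r[OF p1] by (intro power_mean_sum) auto
    have h: "?h x powr p' \<le> 2 powr p' * (\<bar>a x\<bar> powr r + \<bar>b x\<bar> powr r)" for x
    proof -
      have "?h x powr p' \<le> (2 * max (\<bar>a x\<bar> powr (s - 1)) (\<bar>b x\<bar> powr (s - 1))) powr p'"
        using p'(1) by (intro powr_mono2) auto
      also have "\<dots> = 2 powr p' * (max (\<bar>a x\<bar> powr (s - 1)) (\<bar>b x\<bar> powr (s - 1)) powr p')"
        by (simp add: powr_mult)
      also have "max (\<bar>a x\<bar> powr (s - 1)) (\<bar>b x\<bar> powr (s - 1)) powr p' \<le> \<bar>a x\<bar> powr r + \<bar>b x\<bar> powr r"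
        by (auto simp: max_def powr_powr r_def p'_def)
      finally show ?thesis by simp
    qed
    have H: "(\<Sum>e\<in>E. w e * ?h e powr p') \<le> 2 powr p' * (Y / \<zeta>)"
    proof -
      have "(\<Sum>e\<in>E. w e * ?h e powr p') \<le> (\<Sum>e\<in>E. w e * (2 powr p' * (\<bar>a e\<bar> powr r + \<bar>b e\<bar> powr r)))"
        using e h by (intro sum_mono mult_left_mono) auto
      also have "\<dots> = 2 powr p' * (\<Sum>e\<in>E. w e * (\<bar>a e\<bar> powr r + \<bar>b e\<bar> powr r))"
        by (simp add: sum_distrib_left mult.left_commute)
      also have "\<dots> \<le> 2 powr p' * (Y / \<zeta>)" unfolding Y_def using R2 r(1)[OF p1] by (intro mult_left_mono) auto
      finally show ?thesis .
    qed
    have "(\<Sum>e\<in>E. w e * (g e * ?h e)) \<le> (\<Sum>e\<in>E. w e * g e powr p) powr (1 / p) * (\<Sum>e\<in>E. w e * ?h e powr p') powr (1 / p')"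
      using fin(2) e by (intro Holder_sum p1 p') auto
    also have "\<dots> \<le> G powr (1 / p) * (2 powr p' * (Y / \<zeta>)) powr (1 / p')"
      using G G0' H p1 p' e by (intro mult_mono powr_mono2) (auto intro!: sum_nonneg)
    also have "(2 powr p' * (Y / \<zeta>)) powr (1 / p') = 2 * (Y powr (1 / p') / \<zeta> powr (1 / p'))"
    proof -
      have two: "(2 powr p') powr (1 / p') = (2 :: real)" using p'(1) by (simp add: powr_powr)
      have "(2 powr p' * (Y / \<zeta>)) powr (1 / p') = (2 powr p') powr (1 / p') * (Y / \<zeta>) powr (1 / p')"
        by (rule powr_mult)
      then show ?thesis unfolding two by (simp add: powr_divide)
    qed
    also have "G powr (1 / p) * (2 * (Y powr (1 / p') / \<zeta> powr (1 / p'))) = 2 * B * Y powr (1 / p')"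
      by (simp add: B_def p'(3))
    also have "Y powr (1 / p') \<le> (1 + M) * X powr ((s - 1) / (2 * s))"
    proof -
      have "Y powr (1 / p') \<le> (M powr (1 - r / (2 * s)) * X powr (r / (2 * s))) powr (1 / p')"
        using Y Y0 p' p1 by (intro powr_mono2) auto
      also have "\<dots> = (M powr (1 - r / (2 * s))) powr (1 / p') * X powr (r / (2 * s) * (1 / p'))"
        by (simp add: powr_mult powr_powr)
      also have "r / (2 * s) * (1 / p') = (s - 1) / (2 * s)" using p1 by (simp add: r_def p'_def)
      also have "(M powr (1 - r / (2 * s))) powr (1 / p') \<le> 1 + M"
      proof -
        have "(M powr (1 - r / (2 * s))) powr (1 / p') = M powr ((1 - r / (2 * s)) * (1 / p'))" by (simp add: powr_powr)
        also have "\<dots> \<le> (1 + M) powr ((1 - r / (2 * s)) * (1 / p'))"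
          using M s r[OF p1] p' by (intro powr_mono2 mult_nonneg_nonneg) (auto simp: field_simps)
        also have "\<dots> \<le> (1 + M) powr 1"
        proof (intro powr_mono)
          have "0 \<le> r / (2 * s)" using r[OF p1] s by simp
          then have "(1 - r / (2 * s)) * (1 / p') \<le> 1 * 1" using p' p1 by (intro mult_mono) (auto simp: field_simps)
          then show "(1 - r / (2 * s)) * (1 / p') \<le> 1" by simp
        qed (use M in auto)
        finally show ?thesis using M by simp
      qed
      finally show ?thesis by (simp add: mult_right_mono)
    qed
    finally have "TV \<le> s * (2 * B * ((1 + M) * X powr ((s - 1) / (2 * s))))"
      using TV1 s B0 by (smt (verit, ccfv_SIG) mult_left_mono mult_nonneg_nonneg)
    then have "C0 * TV \<le> C1 * B * X powr ((s - 1) / (2 * s))"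
    proof -
      assume "TV \<le> s * (2 * B * ((1 + M) * X powr ((s - 1) / (2 * s))))"
      then have "C0 * TV \<le> C0 * (s * (2 * B * ((1 + M) * X powr ((s - 1) / (2 * s)))))"
        using C0 by (intro mult_left_mono) auto
      also have "\<dots> = C1 * B * X powr ((s - 1) / (2 * s))" unfolding C1_def by (simp only: ac_simps)
      finally show ?thesis .
    qed
    then have le: "X powr (1 / 2) \<le> C1 * B * X powr ((s - 1) / (2 * s))" using XTV by simp
    show ?thesis
    proof (cases "X = 0")
      case True
      then show ?thesis using C1 B0 by simp
    next
      case False
      then have Xp: "X > 0" using X0 by simp
      have "X powr (1 / (2 * s)) * X powr ((s - 1) / (2 * s)) = X powr (1 / 2)"
        using s by (simp add: field_simps flip: powr_add)
      then have "X powr (1 / (2 * s)) * X powr ((s - 1) / (2 * s)) \<le> C1 * B * X powr ((s - 1) / (2 * s))" using le by simp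
      then show ?thesis using Xp by simp
    qed
  qed
  have "(\<Sum>i\<in>I. m i * \<bar>U i\<bar> powr q) \<le> M powr (1 - q / (2 * s)) * X powr (q / (2 * s))"
    unfolding X_def using m fin q s by (intro power_mean_sum) auto
  also have "X powr (q / (2 * s)) = (X powr (1 / (2 * s))) powr q" by (simp add: powr_powr)
  also have "M powr (1 - q / (2 * s)) * (X powr (1 / (2 * s))) powr q \<le> (1 + M) powr q * (C1 * B) powr q"
  proof (intro mult_mono)
    have "M powr (1 - q / (2 * s)) \<le> (1 + M) powr (1 - q / (2 * s))"
      using M s q by (intro powr_mono2) (auto simp: field_simps)
    also have "\<dots> \<le> (1 + M) powr q"
    proof (intro powr_mono)
      have "0 \<le> q / (2 * s)" using q s by simp
      then show "1 - q / (2 * s) \<le> q" using q by linarith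
    qed (use M in auto)
    finally show "M powr (1 - q / (2 * s)) \<le> (1 + M) powr q" .
    show "(X powr (1 / (2 * s))) powr q \<le> (C1 * B) powr q" using key q by (intro powr_mono2) auto
  qed auto
  also have "\<dots> = (Lq_constant p q M C0 * (G powr (1 / p) / \<zeta> powr ((p - 1) / p))) powr q"
    unfolding powr_mult[symmetric] B_def Lq_constant_def C1_def s_def by (simp only: mult.assoc)
  finally show ?thesis .
qed

section \<open>Flat boundary points and functions constant on cells\<close>

lemma flat_pointE:
  assumes "flat_point \<Omega> x"
  obtains n \<rho> where "\<rho> > 0" "n \<noteq> 0" "\<And>y. y \<in> ball x \<rho> \<Longrightarrow> y \<in> \<Omega> \<longleftrightarrow> 0 < (y - x) \<bullet> n"
    "\<And>y. y \<in> ball x \<rho> \<Longrightarrow> y \<in> closure \<Omega> \<Longrightarrow> 0 \<le> (y - x) \<bullet> n"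
proof -
  from assms obtain n \<rho> where n: "\<rho> > 0" "n \<noteq> 0" "\<And>y. y \<in> ball x \<rho> \<Longrightarrow> y \<in> \<Omega> \<longleftrightarrow> 0 < (y - x) \<bullet> n"
    unfolding flat_point_def by blast
  have "0 \<le> (y - x) \<bullet> n" if "y \<in> ball x \<rho>" "y \<in> closure \<Omega>" for y
  proof (rule ccontr)
    assume "\<not> 0 \<le> (y - x) \<bullet> n"
    moreover have "open (ball x \<rho> \<inter> {y. (y - x) \<bullet> n < 0})"
      by (intro open_Int open_Collect_less continuous_intros) auto
    ultimately have "(ball x \<rho> \<inter> {y. (y - x) \<bullet> n < 0}) \<inter> \<Omega> \<noteq> {}"
      using that open_Int_closure_eq_empty[of "ball x \<rho> \<inter> {y. (y - x) \<bullet> n < 0}" \<Omega>] by auto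
    then show False using n(3) by fastforce
  qed
  then show thesis using that n by blast
qed

lemma flat_point_outside: "flat_point \<Omega> x \<Longrightarrow> x \<notin> \<Omega>"
  by (auto simp: flat_point_def)

text \<open>
  Rules out cells on both sides of a boundary edge.
\<close>
lemma flat_point_not_interior_closure:
  assumes "flat_point \<Omega> x" "\<rho> > 0"
  shows "\<not> ball x \<rho> \<subseteq> closure \<Omega>"
proof
  assume sub: "ball x \<rho> \<subseteq> closure \<Omega>"
  obtain n r where n: "r > 0" "n \<noteq> 0" "\<And>y. y \<in> ball x r \<Longrightarrow> y \<in> closure \<Omega> \<Longrightarrow> 0 \<le> (y - x) \<bullet> n"
    using flat_pointE[OF assms(1)] by metis
  define t where "t = min r \<rho> / (2 * norm n)"
  have t: "t > 0" using n assms(2) by (simp add: t_def)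
  define y where "y = x - t *\<^sub>R n"
  have "dist x y = t * norm n" using t by (simp add: y_def dist_norm)
  also have "\<dots> = min r \<rho> / 2" using n by (simp add: t_def)
  finally have "dist x y = min r \<rho> / 2" .
  moreover have "0 < min r \<rho>" using n(1) assms(2) by simp
  ultimately have "dist x y < min r \<rho>" by linarith
  then have "0 \<le> (y - x) \<bullet> n" using n(3)[of y] sub by auto
  moreover have "(y - x) \<bullet> n = - (t * (n \<bullet> n))" by (simp add: y_def)
  moreover have "t * (n \<bullet> n) > 0" using t n by simp
  ultimately show False by simp
qed

definition cell_fun :: "'i set \<Rightarrow> ('i \<Rightarrow> point set) \<Rightarrow> ('i \<Rightarrow> real) \<Rightarrow> point \<Rightarrow> real" where
  "cell_fun I V c x = (\<Sum>i\<in>I. c i * indicator (V i) x)"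

lemma cell_fun_eq:
  assumes "open_partition \<Omega> I V" "i \<in> I" "x \<in> V i"
  shows "cell_fun I V c x = c i"
proof -
  have fin: "finite I" and dj: "disjoint_family_on V I" using assms(1) by (auto simp: open_partition_def)
  have "cell_fun I V c x = (\<Sum>j\<in>I. if j = i then c i else 0)"
    unfolding cell_fun_def using dj assms(2,3)
    by (intro sum.cong refl) (auto simp: indicator_def disjoint_family_on_def)
  then show ?thesis using fin assms(2) by simp
qed

lemma cell_fun_measurable:
  assumes "open_partition \<Omega> I V"
  shows "cell_fun I V c \<in> borel_measurable borel"
  unfolding cell_fun_def
  by (intro borel_measurable_sum borel_measurable_times borel_measurable_const borel_measurable_indicator)
     (use assms in \<open>auto simp: open_partition_def\<close>)

lemma cell_fun_outside: "x \<notin> (\<Union>i\<in>I. V i) \<Longrightarrow> cell_fun I V c x = 0"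
  unfolding cell_fun_def by (intro sum.neutral) (auto simp: indicator_def)

lemma cell_lmeasurable:
  assumes "open_partition \<Omega> I V" "bounded \<Omega>" "i \<in> I"
  shows "V i \<in> lmeasurable"
  using assms by (auto simp: open_partition_def intro!: lmeasurable_open bounded_subset[OF assms(2)])

lemma cell_sum_le_integral:
  assumes part: "open_partition \<Omega> I V" and bnd: "bounded \<Omega>" and g: "\<And>i. i \<in> I \<Longrightarrow> 0 \<le> g (c i)" 
    and le: "(\<integral>\<^sup>+ z. ennreal (g (cell_fun I V c z)) * indicator \<Omega> z \<partial>lborel) \<le> ennreal K" and K: "0 \<le> K"
  shows "(\<Sum>i\<in>I. measure lebesgue (V i) * g (c i)) \<le> K"
proof -
  have fin: "finite I" and dj: "disjoint_family_on V I" and V: "\<And>i. i \<in> I \<Longrightarrow> open (V i) \<and> V i \<subseteq> \<Omega>"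
    using part by (auto simp: open_partition_def)
  have em: "emeasure lborel (V i) = ennreal (measure lebesgue (V i))" if "i \<in> I" for i
  proof -
    have "emeasure lebesgue (V i) = ennreal (measure lebesgue (V i))"
      using cell_lmeasurable[OF part bnd that] by (intro emeasure_eq_measure2) (auto simp: fmeasurable_def)
    then show ?thesis using V[OF that] by simp
  qed
  have "ennreal (\<Sum>i\<in>I. measure lebesgue (V i) * g (c i)) = (\<Sum>i\<in>I. ennreal (g (c i)) * emeasure lborel (V i))"
    using g by (subst sum_ennreal[symmetric]) (auto intro!: sum.cong simp: em ennreal_mult mult.commute)
  also have "\<dots> = (\<integral>\<^sup>+ z. (\<Sum>i\<in>I. ennreal (g (c i)) * indicator (V i) z) \<partial>lborel)"
    using V by (subst nn_integral_sum) (auto simp: nn_integral_cmult_indicator)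
  also have "\<dots> \<le> (\<integral>\<^sup>+ z. ennreal (g (cell_fun I V c z)) * indicator \<Omega> z \<partial>lborel)"
  proof (rule nn_integral_mono)
    fix z
    show "(\<Sum>i\<in>I. ennreal (g (c i)) * indicator (V i) z) \<le> ennreal (g (cell_fun I V c z)) * indicator \<Omega> z"
    proof (cases "\<exists>i\<in>I. z \<in> V i")
      case True
      then obtain i where i: "i \<in> I" "z \<in> V i" by blast
      have "(\<Sum>j\<in>I. ennreal (g (c j)) * indicator (V j) z) = (\<Sum>j\<in>I. if j = i then ennreal (g (c i)) else 0)"
        using dj i by (intro sum.cong refl) (auto simp: indicator_def disjoint_family_on_def)
      also have "\<dots> = ennreal (g (c i))" using fin i by simp
      also have "\<dots> = ennreal (g (cell_fun I V c z)) * indicator \<Omega> z"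
        using cell_fun_eq[OF part i, of c] V[OF i(1)] i(2) by (auto simp: indicator_def)
      finally show ?thesis by simp
    next
      case False
      then have "(\<Sum>i\<in>I. ennreal (g (c i)) * indicator (V i) z) = 0" by (intro sum.neutral) auto
      then show ?thesis by simp
    qed
  qed
  also note le
  finally show ?thesis using K by (simp add: ennreal_le_iff)
qed

lemma Lp_norm_cell_fun:
  assumes part: "open_partition \<Omega> I V" and bnd: "bounded \<Omega>" and q: "0 < q"
  shows "Lp_norm q \<Omega> (cell_fun I V c) powr q = (\<Sum>i\<in>I. measure lebesgue (V i) * \<bar>c i\<bar> powr q)"
proof -
  have fin: "finite I" and dj: "disjoint_family_on V I" and V: "\<And>i. i \<in> I \<Longrightarrow> open (V i) \<and> V i \<subseteq> \<Omega>"
    using part by (auto simp: open_partition_def)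
  have eq: "indicator \<Omega> z *\<^sub>R (\<bar>cell_fun I V c z\<bar> powr q) = (\<Sum>i\<in>I. \<bar>c i\<bar> powr q * indicator (V i) z)" for z
  proof (cases "\<exists>i\<in>I. z \<in> V i")
    case True
    then obtain i where i: "i \<in> I" "z \<in> V i" by blast
    have "(\<Sum>j\<in>I. \<bar>c j\<bar> powr q * indicator (V j) z) = (\<Sum>j\<in>I. if j = i then \<bar>c i\<bar> powr q else 0)"
      using dj i by (intro sum.cong refl) (auto simp: indicator_def disjoint_family_on_def)
    then show ?thesis using cell_fun_eq[OF part i, of c] V[OF i(1)] i fin by (auto simp: indicator_def)
  next
    case False
    then have "(\<Sum>i\<in>I. \<bar>c i\<bar> powr q * indicator (V i) z) = 0" by (intro sum.neutral) auto
    then show ?thesis using cell_fun_outside[of z V I c] False q by simp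
  qed
  have int: "integrable lebesgue (\<lambda>z. \<bar>c i\<bar> powr q * indicator (V i) z)" if "i \<in> I" for i
    using cell_lmeasurable[OF part bnd that]
    by (intro integrable_mult_right integrable_real_indicator) (auto simp: fmeasurable_def)
  have "(LINT x:\<Omega>|lebesgue. \<bar>cell_fun I V c x\<bar> powr q) = (LINT x|lebesgue. (\<Sum>i\<in>I. \<bar>c i\<bar> powr q * indicator (V i) x))"
    unfolding set_lebesgue_integral_def eq ..
  also have "\<dots> = (\<Sum>i\<in>I. measure lebesgue (V i) * \<bar>c i\<bar> powr q)"
    using int by (subst Bochner_Integration.integral_sum) (auto simp: mult.commute intro!: sum.cong)
  finally show ?thesis unfolding Lp_norm_def using q by (simp add: powr_powr sum_nonneg)
qed

text \<open>
  Double counting: each edge is charged to the cells it belongs to. This is how (R2) is used.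
\<close>
lemma incidence_sum:
  fixes w :: "'d \<Rightarrow> real"
  assumes fin: "finite I" "finite D" and w: "\<And>d. d \<in> D \<Longrightarrow> 0 \<le> w d" and X: "\<And>i. i \<in> I \<Longrightarrow> 0 \<le> X i"
    and \<phi>: "\<And>d. d \<in> D \<Longrightarrow> \<phi> d \<le> (\<Sum>i\<in>{i\<in>I. inc i d}. X i)"
    and m: "\<And>i. i \<in> I \<Longrightarrow> (\<Sum>d\<in>{d\<in>D. inc i d}. w d) \<le> m i / \<zeta>"
  shows "(\<Sum>d\<in>D. w d * \<phi> d) \<le> (\<Sum>i\<in>I. m i * X i) / \<zeta>"
proof -
  have "(\<Sum>d\<in>D. w d * \<phi> d) \<le> (\<Sum>d\<in>D. \<Sum>i\<in>{i\<in>I. inc i d}. w d * X i)"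
    using w \<phi> by (auto intro!: sum_mono mult_left_mono simp flip: sum_distrib_left)
  also have "\<dots> = (\<Sum>d\<in>D. \<Sum>i\<in>I. if inc i d then w d * X i else 0)"
    using fin by (simp add: sum.inter_filter)
  also have "\<dots> = (\<Sum>i\<in>I. \<Sum>d\<in>D. if inc i d then w d * X i else 0)" by (rule sum.swap)
  also have "\<dots> = (\<Sum>i\<in>I. (\<Sum>d\<in>{d\<in>D. inc i d}. w d) * X i)"
  proof (rule sum.cong[OF refl])
    fix i
    have "(\<Sum>d\<in>{d\<in>D. inc i d}. w d) * X i = (\<Sum>d\<in>{d\<in>D. inc i d}. w d * X i)" by (rule sum_distrib_right)
    also have "\<dots> = (\<Sum>d\<in>D. if inc i d then w d * X i else 0)" by (rule sum.inter_filter[OF fin(2)])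
    finally show "(\<Sum>d\<in>D. if inc i d then w d * X i else 0) = (\<Sum>d\<in>{d\<in>D. inc i d}. w d) * X i" by simp
  qed
  also have "\<dots> \<le> (\<Sum>i\<in>I. m i / \<zeta> * X i)" using m X by (intro sum_mono mult_right_mono) auto
  also have "\<dots> = (\<Sum>i\<in>I. m i * X i) / \<zeta>" by (simp add: sum_divide_distrib)
  finally show ?thesis .
qed

lemma open_meets_closure: "open V \<Longrightarrow> y \<in> V \<Longrightarrow> y \<in> closure W \<Longrightarrow> V \<inter> W \<noteq> {}"
  using open_Int_closure_eq_empty[of V W] by blast

lemma total_variation_image_le:
  assumes "finite D"
  shows "total_variation ((\<lambda>d. (a d, b d, p d, q d)) ` D) \<le> (\<Sum>d\<in>D. dist (a d) (b d) * \<bar>p d - q d\<bar>)"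
proof -
  have "total_variation ((\<lambda>d. (a d, b d, p d, q d)) ` D)
     \<le> sum ((\<lambda>(a, b, p, q). dist a b * \<bar>p - q\<bar>) \<circ> (\<lambda>d. (a d, b d, p d, q d))) D"
    unfolding total_variation_def using assms by (intro sum_image_le) auto
  then show ?thesis by (simp add: o_def)
qed

section \<open>Geometry of a mesh\<close>

locale ddfv =
  fixes \<Omega> :: "point set" and T :: mesh
  assumes op: "open \<Omega>" and bounded: "bounded \<Omega>" and mesh: "ddfv_mesh \<Omega> T"
begin

lemma is_primal_mesh: "primal_mesh \<Omega> T" and is_diamond_mesh: "diamond_mesh \<Omega> T" and is_dual_mesh: "dual_mesh \<Omega> T"
  using mesh unfolding ddfv_mesh_def by blast+

lemma primal_partition: "open_partition \<Omega> (primal T) (\<lambda>K. K)"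
  and dual_partition: "open_partition \<Omega> (vertices T) (dual_cell T)"
  and diamond_partition: "open_partition \<Omega> (diamonds T) (diamond_region T)"
  by (rule conjunct1[OF is_primal_mesh[unfolded primal_mesh_def]], rule conjunct1[OF is_dual_mesh[unfolded dual_mesh_def]],
      rule conjunct2[OF conjunct2[OF is_diamond_mesh[unfolded diamond_mesh_def]]])

lemma finite_diamonds: "finite (diamonds T)" and finite_primal: "finite (primal T)"
  and finite_vertices: "finite (vertices T)"
  using primal_partition dual_partition diamond_partition by (auto simp: open_partition_def)

lemma frontier_outside: "x \<in> frontier \<Omega> \<Longrightarrow> x \<notin> \<Omega>"
  using op by (simp add: frontier_def interior_open)

lemma primal_cell:
  assumes "K \<in> primal T"
  shows "open K" "K \<subseteq> \<Omega>" "center T K \<in> K" "simple_polygon (primal_verts T K)"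
    "frontier K = path_image (boundary_path (primal_verts T K))"
proof -
  have *: "simple_polygon (primal_verts T K)" "K = polygon_region (primal_verts T K)" "star_shaped_at (center T K) K"
    using bspec[OF conjunct1[OF conjunct2[OF is_primal_mesh[unfolded primal_mesh_def]]] assms] by blast+
  show "open K" "K \<subseteq> \<Omega>" using assms primal_partition by (auto simp: open_partition_def)
  show c: "center T K \<in> K" using *(3) by (simp add: star_shaped_at_def)
  show "simple_polygon (primal_verts T K)" by fact
  show "frontier K = path_image (boundary_path (primal_verts T K))"
    using frontier_polygon_region[OF *(1)] *(2) c by (metis empty_iff)
qed

lemma primal_disjoint: "K \<in> primal T \<Longrightarrow> L \<in> primal T \<Longrightarrow> K \<noteq> L \<Longrightarrow> K \<inter> L = {}"
  using primal_partition by (auto simp: open_partition_def disjoint_family_on_def)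

lemma primal_closure: "K \<in> primal T \<Longrightarrow> closure K \<subseteq> closure \<Omega>"
  by (rule closure_mono[OF primal_cell(2)])

lemma primal_edge_frontier:
  assumes "K \<in> primal T" "{a, b} \<in> polygon_edges (primal_verts T K)"
  shows "closed_segment a b \<subseteq> frontier K"
  using primal_cell(5)[OF assms(1)] path_image_boundary_path[OF primal_cell(4)[OF assms(1)]] assms(2) by blast

lemma primal_triangle:
  assumes "K \<in> primal T" "{a, b} \<in> polygon_edges (primal_verts T K)"
  shows "convex hull {a, b, center T K} \<subseteq> closure K"
proof (rule star_triangle_subset)
  have "star_shaped_at (center T K) K"
    using bspec[OF conjunct1[OF conjunct2[OF is_primal_mesh[unfolded primal_mesh_def]]] assms(1)] by blast
  then show "\<And>x. x \<in> closure K \<Longrightarrow> closed_segment (center T K) x \<subseteq> closure K" by (rule closure_star_shaped)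
  show "closed_segment a b \<subseteq> closure K" using primal_edge_frontier[OF assms] by (auto simp: frontier_def)
qed

lemma boundary_primalD:
  assumes "K \<in> boundary_primal \<Omega> T"
  shows "K \<subseteq> frontier \<Omega>" "center T K \<in> K" "K \<notin> primal T" "\<And>a b. K = open_segment a b \<Longrightarrow> a \<in> frontier \<Omega> \<and> b \<in> frontier \<Omega>"
proof -
  show s: "K \<subseteq> frontier \<Omega>" using assms by (auto simp: boundary_primal_def)
  show c: "center T K \<in> K" by (rule bspec[OF conjunct2[OF conjunct2[OF is_primal_mesh[unfolded primal_mesh_def]]] assms])
  show "K \<notin> primal T"
  proof
    assume "K \<in> primal T"
    then have "K \<subseteq> \<Omega>" by (rule primal_cell)
    then show False using s c frontier_outside by blast
  qed
  fix a b assume K: "K = open_segment a b"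
  then have "a \<noteq> b" using c by auto
  then have "closure K = closed_segment a b" using K by simp
  moreover have "closure K \<subseteq> frontier \<Omega>" using s by (intro closure_minimal) auto
  ultimately show "a \<in> frontier \<Omega> \<and> b \<in> frontier \<Omega>" by auto
qed

lemma diamondD:
  assumes d: "d \<in> diamonds T"
  shows "cellK d \<in> primal T" "cellL d \<in> primal T \<or> cellL d \<in> boundary_primal \<Omega> T"
    "cellK d \<noteq> cellL d" "{vertK d, vertL d} \<in> polygon_edges (primal_verts T (cellK d))"
    "cellL d \<in> primal T \<Longrightarrow> {vertK d, vertL d} \<in> polygon_edges (primal_verts T (cellL d))"
    "cellL d \<in> boundary_primal \<Omega> T \<Longrightarrow> cellL d = open_segment (vertK d) (vertL d)"
    "simple_polygon (diamond_verts T d)"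
proof -
  have *: "cellK d \<in> primal T \<and> cellL d \<in> primal T \<union> boundary_primal \<Omega> T \<and> cellK d \<noteq> cellL d \<and>
        has_edge \<Omega> T (cellK d) (vertK d) (vertL d) \<and>
        has_edge \<Omega> T (cellL d) (vertK d) (vertL d) \<and>
        simple_polygon (diamond_verts T d)"
    by (rule bspec[OF conjunct1[OF is_diamond_mesh[unfolded diamond_mesh_def]] d])
  show "cellK d \<in> primal T" "cellL d \<in> primal T \<or> cellL d \<in> boundary_primal \<Omega> T" "cellK d \<noteq> cellL d"
     "simple_polygon (diamond_verts T d)" using * by auto
  show "{vertK d, vertL d} \<in> polygon_edges (primal_verts T (cellK d))"
    using * boundary_primalD(3) by (auto simp: has_edge_def)
  show "cellL d \<in> primal T \<Longrightarrow> {vertK d, vertL d} \<in> polygon_edges (primal_verts T (cellL d))"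
    using * boundary_primalD(3) by (auto simp: has_edge_def)
  show "cellL d \<in> boundary_primal \<Omega> T \<Longrightarrow> cellL d = open_segment (vertK d) (vertL d)"
    using * boundary_primalD(3) by (auto simp: has_edge_def)
qed

lemma edge_eq_cases: "edge d = {a, b} \<longleftrightarrow> vertK d = a \<and> vertL d = b \<or> vertK d = b \<and> vertL d = a"
  unfolding edge_def doubleton_eq_iff by blast

lemma segments_of_edge:
  assumes "edge d = {a, b}"
  shows "closed_segment (vertK d) (vertL d) = closed_segment a b" "open_segment (vertK d) (vertL d) = open_segment a b"
  using assms unfolding edge_eq_cases by (elim disjE conjE; simp add: closed_segment_commute open_segment_commute)+

lemma diamond_edges:
  assumes "v \<in> edge d" "c \<in> dual_edge T d"
  shows "{v, c} \<in> polygon_edges (diamond_verts T d)" "{c, v} \<in> polygon_edges (diamond_verts T d)"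
    "v \<in> set (diamond_verts T d)" "c \<in> set (diamond_verts T d)"
proof -
  have v: "v = vertK d \<or> v = vertL d" and c: "c = center T (cellK d) \<or> c = center T (cellL d)"
    using assms by (simp_all add: edge_def dual_edge_def)
  show "{v, c} \<in> polygon_edges (diamond_verts T d)"
    using v c unfolding diamond_verts_def polygon_edges_4
    by (elim disjE) (simp_all add: doubleton_eq_iff)
  then show "{c, v} \<in> polygon_edges (diamond_verts T d)" by (simp add: insert_commute)
  show "v \<in> set (diamond_verts T d)" "c \<in> set (diamond_verts T d)"
    using v c by (auto simp: diamond_verts_def)
qed

lemma
  assumes d: "d \<in> diamonds T"
  shows verts_distinct: "vertK d \<noteq> vertL d" and centers_distinct: "center T (cellK d) \<noteq> center T (cellL d)"
    and edge_length_pos: "0 < edge_length d" and dual_edge_length_pos: "0 < dual_edge_length T d"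
proof -
  have "distinct (diamond_verts T d)" by (rule simple_polygon_distinct[OF diamondD(7)[OF d]])
  then show "vertK d \<noteq> vertL d" "center T (cellK d) \<noteq> center T (cellL d)" by (simp_all add: diamond_verts_def)
  then show "0 < edge_length d" "0 < dual_edge_length T d" by (simp_all add: edge_length_def dual_edge_length_def)
qed

lemmas lengths_positive = edge_length_pos dual_edge_length_pos

text \<open>
  A center on the line through an edge of its cell would either lie on the edge, hence on the
  frontier of the open cell, or make the diamond polygon run through one of its own vertices.
\<close>
lemma center_off_edge:
  assumes d: "d \<in> diamonds T" and V: "V \<in> {cellK d, cellL d}" "V \<in> primal T"
  shows "cross (vertK d) (vertL d) (center T V) \<noteq> 0"
proof
  assume 0: "cross (vertK d) (vertL d) (center T V) = 0"
  have "center T V \<in> open_segment (vertK d) (vertL d)"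
  proof -
    have e: "vertK d \<in> edge d" "vertL d \<in> edge d" by (auto simp: edge_def)
    have c: "center T V \<in> dual_edge T d" using V(1) by (auto simp: dual_edge_def)
    show ?thesis
      by (rule simple_polygon_flat_vertex[OF diamondD(7)[OF d] diamond_edges(1)[OF e(1) c] diamond_edges(2)[OF e(2) c]
          diamond_edges(3)[OF e(1) c] diamond_edges(3)[OF e(2) c] verts_distinct[OF d] 0])
  qed
  moreover have "{vertK d, vertL d} \<in> polygon_edges (primal_verts T V)"
    using V diamondD(4,5)[OF d] by auto
  ultimately have "center T V \<in> frontier V"
    using primal_edge_frontier[OF V(2)] open_closed_segment by blast
  then show False using primal_cell(1,3)[OF V(2)] by (simp add: frontier_def interior_open)
qed

lemma center_on_boundary_edge:
  assumes d: "d \<in> diamonds T" and L: "cellL d \<in> boundary_primal \<Omega> T"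
  shows "center T (cellL d) \<in> open_segment (vertK d) (vertL d)" "cross (vertK d) (vertL d) (center T (cellL d)) = 0"
proof -
  show *: "center T (cellL d) \<in> open_segment (vertK d) (vertL d)"
    using boundary_primalD(2)[OF L] diamondD(6)[OF d L] by simp
  show "cross (vertK d) (vertL d) (center T (cellL d)) = 0"
    by (intro cross_on_segment open_closed_segment *)
qed

lemma centers_opposite:
  assumes d: "d \<in> diamonds T" and L: "cellL d \<in> primal T"
  shows "cross (vertK d) (vertL d) (center T (cellK d)) * cross (vertK d) (vertL d) (center T (cellL d)) < 0"
proof -
  have K: "cellK d \<in> primal T" by (rule diamondD(1)[OF d])
  have "cellL d \<inter> cellK d = {}" using primal_disjoint[OF L K] diamondD(3)[OF d] by auto
  then show ?thesis
    using disjoint_triangles_opposite[OF primal_cell(1)[OF K] _ primal_cell(1)[OF L]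
        primal_triangle[OF K diamondD(4)[OF d]] primal_triangle[OF L diamondD(5)[OF d L]] verts_distinct[OF d]
        center_off_edge[OF d _ K] center_off_edge[OF d _ L]] by blast
qed

text \<open>
  The boundary pieces of a dual cell that do not come from dual edges lie on the frontier of
  \<open>\<Omega>\<close> and occur only at boundary vertices; the eighth fact records this.
\<close>
lemma dual_cellD:
  assumes v: "v \<in> vertices T"
  shows "open (dual_cell T v)" "dual_cell T v \<subseteq> \<Omega>" "v \<in> closure (dual_cell T v)" "simple_polygon (dual_verts T v)"
    "frontier (dual_cell T v) = path_image (boundary_path (dual_verts T v))"
    "\<And>x. x \<in> closure (dual_cell T v) \<Longrightarrow> closed_segment v x \<subseteq> closure (dual_cell T v)"
    "v \<in> frontier \<Omega> \<Longrightarrow> v \<in> set (dual_verts T v)"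
    "\<And>x. x \<in> frontier (dual_cell T v) \<Longrightarrow>
       (\<exists>d\<in>diamonds T. v \<in> edge d \<and> x \<in> closed_segment (center T (cellK d)) (center T (cellL d)))
       \<or> (v \<in> frontier \<Omega> \<and> x \<in> frontier \<Omega>)"
    "\<And>d. d \<in> diamonds T \<Longrightarrow> v \<in> edge d \<Longrightarrow> dual_edge T d \<in> polygon_edges (dual_verts T v)"
    "v \<in> \<Omega> \<Longrightarrow> v \<in> dual_cell T v"
proof -
  have *: "simple_polygon (dual_verts T v)"
     "set (dual_verts T v) =
          {center T V | V. V \<in> primal T \<union> boundary_primal \<Omega> T \<and> has_vertex \<Omega> T V v} \<union>
          (if v \<in> frontier \<Omega> then {v} else {})"
     "polygon_edges (dual_verts T v) =
          {dual_edge T d | d. d \<in> diamonds T \<and> v \<in> edge d} \<union>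
          {{v, center T V} | V. V \<in> boundary_primal \<Omega> T \<and> has_vertex \<Omega> T V v}"
     "v \<in> \<Omega> \<longrightarrow> v \<in> dual_cell T v" "star_shaped_at v (closure (dual_cell T v))"
    using bspec[OF conjunct2[OF is_dual_mesh[unfolded dual_mesh_def]] v] by - (elim conjE, assumption)+
  show "open (dual_cell T v)" "dual_cell T v \<subseteq> \<Omega>" using v dual_partition by (auto simp: open_partition_def)
  show vc: "v \<in> closure (dual_cell T v)" using *(5) by (simp add: star_shaped_at_def)
  show "simple_polygon (dual_verts T v)" by fact
  have "dual_cell T v \<noteq> {}" using vc by auto
  then show fr: "frontier (dual_cell T v) = path_image (boundary_path (dual_verts T v))"
    using frontier_polygon_region[OF *(1)] by (simp add: dual_cell_def)
  show "\<And>x. x \<in> closure (dual_cell T v) \<Longrightarrow> closed_segment v x \<subseteq> closure (dual_cell T v)"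
    using *(5) by (simp add: star_shaped_at_def)
  show "v \<in> frontier \<Omega> \<Longrightarrow> v \<in> set (dual_verts T v)" using *(2) by auto
  show "v \<in> \<Omega> \<Longrightarrow> v \<in> dual_cell T v" using *(4) by blast
  show "\<And>d. d \<in> diamonds T \<Longrightarrow> v \<in> edge d \<Longrightarrow> dual_edge T d \<in> polygon_edges (dual_verts T v)"
    using *(3) by blast
  fix x assume "x \<in> frontier (dual_cell T v)"
  then obtain a b where ab: "{a, b} \<in> polygon_edges (dual_verts T v)" "x \<in> closed_segment a b"
    unfolding fr path_image_boundary_path[OF *(1)] by blast
  then consider d where "{a, b} = dual_edge T d" "d \<in> diamonds T" "v \<in> edge d"
    | V where "{a, b} = {v, center T V}" "V \<in> boundary_primal \<Omega> T" "has_vertex \<Omega> T V v"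
    unfolding *(3) by blast
  then show "(\<exists>d\<in>diamonds T. v \<in> edge d \<and> x \<in> closed_segment (center T (cellK d)) (center T (cellL d)))
       \<or> (v \<in> frontier \<Omega> \<and> x \<in> frontier \<Omega>)"
  proof cases
    case 1
    then have "x \<in> closed_segment (center T (cellK d)) (center T (cellL d))"
      using ab(2) by (auto simp: dual_edge_def doubleton_eq_iff closed_segment_commute)
    then show ?thesis using 1 by blast
  next
    case 2
    obtain w where w: "V = open_segment v w" using 2(2,3) boundary_primalD(3)[OF 2(2)]
      by (auto simp: has_vertex_def has_edge_def)
    have c: "center T V \<in> open_segment v w" using boundary_primalD(2)[OF 2(2)] w by simp
    have "x \<in> closed_segment v (center T V)" using ab(2) 2(1) by (auto simp: doubleton_eq_iff closed_segment_commute)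
    also have "\<dots> \<subseteq> closed_segment v w" using c by (meson ends_in_segment(1) open_closed_segment subset_closed_segment)
    also have "\<dots> = closure V" using c w by auto
    also have "\<dots> \<subseteq> frontier \<Omega>" using boundary_primalD(1)[OF 2(2)] by (intro closure_minimal) auto
    finally show ?thesis using boundary_primalD(4)[OF 2(2) w] by blast
  qed
qed

lemma dual_disjoint: "v \<in> vertices T \<Longrightarrow> w \<in> vertices T \<Longrightarrow> v \<noteq> w \<Longrightarrow> dual_cell T v \<inter> dual_cell T w = {}"
  using dual_partition by (auto simp: open_partition_def disjoint_family_on_def)

lemma edge_vertices:
  assumes d: "d \<in> diamonds T" and v: "v \<in> edge d"
  shows "v \<in> vertices T"
proof -
  have K: "cellK d \<in> primal T" and e: "edge d \<in> polygon_edges (primal_verts T (cellK d))"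
    using diamondD(1,4)[OF d] by (auto simp: edge_def)
  have "\<exists>i < length (primal_verts T (cellK d)). edge d = {primal_verts T (cellK d) ! i, primal_verts T (cellK d) ! (Suc i mod length (primal_verts T (cellK d)))}"
    using e by (auto simp: polygon_edges_def)
  then obtain i where i: "i < length (primal_verts T (cellK d))"
     "edge d = {primal_verts T (cellK d) ! i, primal_verts T (cellK d) ! (Suc i mod length (primal_verts T (cellK d)))}" by blast
  then have "Suc i mod length (primal_verts T (cellK d)) < length (primal_verts T (cellK d))" by (intro mod_less_divisor) auto
  then have "v \<in> set (primal_verts T (cellK d))" using v i by auto
  then show ?thesis using K by (auto simp: vertices_def)
qed

lemma vertex_in_closure: 
  assumes "d \<in> diamonds T" "v \<in> edge d" "v \<notin> \<Omega>" shows "v \<in> frontier \<Omega>"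
proof -
  have "v \<in> closed_segment (vertK d) (vertL d)" using assms(2) by (auto simp: edge_def)
  then have "v \<in> frontier (cellK d)" using primal_edge_frontier[OF diamondD(1,4)[OF assms(1)]] by blast
  then have "v \<in> closure \<Omega>" using primal_closure[OF diamondD(1)[OF assms(1)]] by (auto simp: frontier_def)
  then show ?thesis using assms(3) op by (simp add: frontier_def interior_open)
qed

lemma dual_edge_frontier:
  assumes d: "d \<in> diamonds T" and v: "v \<in> edge d"
  shows "closed_segment (center T (cellK d)) (center T (cellL d)) \<subseteq> frontier (dual_cell T v)"
proof -
  have vT: "v \<in> vertices T" by (rule edge_vertices[OF d v])
  have "{center T (cellK d), center T (cellL d)} \<in> polygon_edges (dual_verts T v)"
    using dual_cellD(9)[OF vT d v] by (simp add: dual_edge_def)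
  then show ?thesis using path_image_boundary_path[OF dual_cellD(4)[OF vT]] dual_cellD(5)[OF vT] by blast
qed

lemma dual_triangle:
  assumes d: "d \<in> diamonds T" and v: "v \<in> edge d"
  shows "convex hull {center T (cellK d), center T (cellL d), v} \<subseteq> closure (dual_cell T v)"
proof (rule star_triangle_subset)
  show "\<And>x. x \<in> closure (dual_cell T v) \<Longrightarrow> closed_segment v x \<subseteq> closure (dual_cell T v)"
    by (rule dual_cellD(6)[OF edge_vertices[OF d v]])
  show "closed_segment (center T (cellK d)) (center T (cellL d)) \<subseteq> closure (dual_cell T v)"
    using dual_edge_frontier[OF d v] by (auto simp: frontier_def)
qed

text \<open>
  As the diamond is simple, such a vertex would lie between the two centers. This is impossible for
  an interior vertex, which is in its open dual cell, for a boundary vertex, which is a corner of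
  its dual cell and not inside one of its edges, and at a boundary edge, where the line through the
  vertices contains one center but not the other.
\<close>
lemma vertex_off_dual_edge:
  assumes d: "d \<in> diamonds T" and v: "v \<in> edge d"
  shows "cross (center T (cellK d)) (center T (cellL d)) v \<noteq> 0"
proof
  let ?k = "center T (cellK d)" and ?l = "center T (cellL d)"
  have vT: "v \<in> vertices T" by (rule edge_vertices[OF d v])
  assume 0: "cross ?k ?l v = 0"
  have c: "?k \<in> dual_edge T d" "?l \<in> dual_edge T d" by (auto simp: dual_edge_def)
  have os: "v \<in> open_segment ?k ?l"
    by (rule simple_polygon_flat_vertex[OF diamondD(7)[OF d] diamond_edges(2)[OF v c(1)] diamond_edges(1)[OF v c(2)]
          diamond_edges(4)[OF v c(1)] diamond_edges(4)[OF v c(2)] centers_distinct[OF d] 0])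
  show False
  proof (cases "cellL d \<in> primal T")
    case False
    then have L: "cellL d \<in> boundary_primal \<Omega> T" using diamondD(2)[OF d] by blast
    obtain u where u: "0 < u" "u < 1" "v = (1 - u) *\<^sub>R ?k + u *\<^sub>R ?l" using os by (auto simp: in_segment)
    have "cross (vertK d) (vertL d) v = (1 - u) * cross (vertK d) (vertL d) ?k"
      unfolding u(3) cross_affine using center_on_boundary_edge(2)[OF d L] by simp
    moreover have "cross (vertK d) (vertL d) v = 0" using v by (auto simp: edge_def)
    ultimately show False using u center_off_edge[OF d, of "cellK d"] diamondD(1)[OF d] by simp
  next
    case True
    have cs: "v \<in> closed_segment ?k ?l" using os by (rule open_closed_segment)
    show False
    proof (cases "v \<in> \<Omega>")
      case True
      then show False using dual_edge_frontier[OF d v] cs dual_cellD(1,10)[OF vT] by (auto simp: frontier_def interior_open)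
    next
      case False
      then have "v \<in> set (dual_verts T v)" using dual_cellD(7)[OF vT] vertex_in_closure[OF d v] by blast
      moreover have "{?k, ?l} \<in> polygon_edges (dual_verts T v)"
        using dual_cellD(9)[OF vT d v] by (simp add: dual_edge_def)
      ultimately have "v = ?k \<or> v = ?l" using simple_polygon_vertex_on_edge[OF dual_cellD(4)[OF vT]] cs by blast
      then show False using os by (auto simp: open_segment_def)
    qed
  qed
qed

lemma vertices_opposite:
  assumes d: "d \<in> diamonds T"
  shows "cross (center T (cellK d)) (center T (cellL d)) (vertK d) * cross (center T (cellK d)) (center T (cellL d)) (vertL d) < 0"
proof -
  have e: "vertK d \<in> edge d" "vertL d \<in> edge d" by (auto simp: edge_def)
  note vT = edge_vertices[OF d e(1)] edge_vertices[OF d e(2)]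
  have "dual_cell T (vertL d) \<inter> dual_cell T (vertK d) = {}"
    using dual_disjoint[OF vT] verts_distinct[OF d] by blast
  then show ?thesis
    by (rule disjoint_triangles_opposite[OF dual_cellD(1)[OF vT(1)] _ dual_cellD(1)[OF vT(2)]
        dual_triangle[OF d e(1)] dual_triangle[OF d e(2)] centers_distinct[OF d]
        vertex_off_dual_edge[OF d e(1)] vertex_off_dual_edge[OF d e(2)]])
qed

text \<open>
  The angle is defined by its cosine; the sine comes from the Pythagorean identity.
\<close>
lemma sin_diamond_angle:
  assumes d: "d \<in> diamonds T"
  shows "\<bar>rot90 (vertL d - vertK d) \<bullet> (center T (cellL d) - center T (cellK d))\<bar>
     = edge_length d * dual_edge_length T d * sin (diamond_angle T d)" "0 \<le> sin (diamond_angle T d)"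
proof -
  let ?a = "center T (cellL d) - center T (cellK d)" and ?b = "vertL d - vertK d"
  have n: "norm ?a = dual_edge_length T d" "norm ?b = edge_length d"
    by (auto simp: dual_edge_length_def edge_length_def dist_norm norm_minus_commute)
  have pos: "norm ?a > 0" "norm ?b > 0" using lengths_positive[OF d] n by auto
  define x where "x = \<bar>?a \<bullet> ?b\<bar> / (norm ?a * norm ?b)"
  have x: "0 \<le> x" "x \<le> 1" using Cauchy_Schwarz_ineq2[of ?a ?b] pos by (auto simp: x_def)
  have s: "sin (diamond_angle T d) = sqrt (1 - x\<^sup>2)"
    unfolding diamond_angle_def line_angle_def x_def[symmetric] using x by (intro sin_arccos) auto
  then show "0 \<le> sin (diamond_angle T d)" using x by (simp add: power_le_one)
  have "(norm ?a * norm ?b)\<^sup>2 * (1 - x\<^sup>2) = (norm ?a * norm ?b)\<^sup>2 - (?b \<bullet> ?a)\<^sup>2"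
    using pos by (simp add: x_def power_divide power_mult_distrib inner_commute right_diff_distrib)
  then have "(rot90 ?b \<bullet> ?a)\<^sup>2 = (norm ?a * norm ?b)\<^sup>2 * (1 - x\<^sup>2)"
    using rot90_inner_Pythagoras[of ?b ?a] by (simp add: power_mult_distrib mult.commute)
  then have "sqrt ((rot90 ?b \<bullet> ?a)\<^sup>2) = sqrt ((norm ?a * norm ?b)\<^sup>2 * (1 - x\<^sup>2))" by simp
  then show "\<bar>rot90 ?b \<bullet> ?a\<bar> = edge_length d * dual_edge_length T d * sin (diamond_angle T d)"
    unfolding s by (simp add: real_sqrt_mult n mult.commute lengths_positive[OF d] less_imp_le abs_mult abs_of_pos)
qed

text \<open>
  For (R1) only this half of the area formula is of use: a diamond is not too thin for its
  diagonals.
\<close>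
lemma diamond_area:
  assumes d: "d \<in> diamonds T"
  shows "edge_length d * dual_edge_length T d * sin (diamond_angle T d) \<le> 2 * measure lebesgue (diamond_region T d)"
proof -
  let ?k = "center T (cellK d)" and ?l = "center T (cellL d)" and ?v = "vertK d" and ?w = "vertL d"
  have "\<bar>cross ?v ?w ?k - cross ?v ?w ?l\<bar> / 2 \<le> measure lebesgue (polygon_region [?k, ?v, ?l, ?w])"
  proof (rule quadrilateral_area)
    show "simple_polygon [?k, ?v, ?l, ?w]" using diamondD(7)[OF d] by (simp add: diamond_verts_def)
    show "cross ?v ?w ?k \<noteq> 0" using center_off_edge[OF d] diamondD(1)[OF d] by blast
    show "cross ?v ?w ?k * cross ?v ?w ?l < 0 \<or> ?l \<in> closed_segment ?v ?w"
      using diamondD(2)[OF d] centers_opposite[OF d] center_on_boundary_edge(1)[OF d] open_closed_segment by blast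
  qed
  moreover have "\<bar>cross ?v ?w ?k - cross ?v ?w ?l\<bar> = \<bar>rot90 (?w - ?v) \<bullet> (?l - ?k)\<bar>"
    by (simp add: cross_def inner_diff_right)
  ultimately show ?thesis using sin_diamond_angle(1)[OF d] by (simp add: diamond_region_def diamond_verts_def)
qed

lemma abs_inner_rot90_commute: "\<bar>rot90 a \<bullet> b\<bar> = \<bar>rot90 b \<bullet> a\<bar>"
  by (simp add: inner_point algebra_simps abs_minus_commute)

text \<open>
  Each of the two vectors in the discrete gradient is orthogonal to one diagonal, so the inner
  product with the unit vector along that diagonal is, up to sign, a single difference quotient.
\<close>
lemma gradient_components:
  assumes d: "d \<in> diamonds T" and s: "sin (diamond_angle T d) > 0"
  shows "\<bar>at_primal u (cellL d) - at_primal u (cellK d)\<bar> / dual_edge_length T d \<le> norm (discrete_gradient T u d)"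
    "\<bar>at_dual u (vertL d) - at_dual u (vertK d)\<bar> / edge_length d \<le> norm (discrete_gradient T u d)"
proof -
  let ?k = "center T (cellK d)" and ?l = "center T (cellL d)" and ?v = "vertK d" and ?w = "vertL d"
  let ?s = "sin (diamond_angle T d)" and ?g = "discrete_gradient T u d"
  let ?A = "(at_primal u (cellL d) - at_primal u (cellK d)) / dual_edge_length T d"
  let ?B = "(at_dual u ?w - at_dual u ?v) / edge_length d"
  have el: "edge_length d > 0" "dual_edge_length T d > 0" using lengths_positive[OF d] by auto
  have n: "norm (?l - ?k) = dual_edge_length T d" "norm (?w - ?v) = edge_length d"
    by (auto simp: dual_edge_length_def edge_length_def dist_norm norm_minus_commute)
  define s1 s2 where "s1 = sgn (rot90 (?w - ?v) \<bullet> (?v - ?k))" and "s2 = sgn (rot90 (?l - ?k) \<bullet> (?k - ?v))"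
  have "rot90 (?w - ?v) \<bullet> (?v - ?k) = - cross ?v ?w ?k" by (simp add: cross_def inner_diff_right)
  then have s1: "\<bar>s1\<bar> = 1" using center_off_edge[OF d, of "cellK d"] diamondD(1)[OF d] by (simp add: s1_def abs_sgn_eq)
  have "rot90 (?l - ?k) \<bullet> (?k - ?v) = - cross ?k ?l ?v" by (simp add: cross_def inner_diff_right)
  then have s2: "\<bar>s2\<bar> = 1" using vertex_off_dual_edge[OF d, of ?v] by (simp add: s2_def abs_sgn_eq edge_def)
  have na: "normal_away ?v ?w ?k = (s1 / edge_length d) *\<^sub>R rot90 (?w - ?v)"
    "normal_away ?k ?l ?v = (s2 / dual_edge_length T d) *\<^sub>R rot90 (?l - ?k)"
    by (simp_all add: normal_away_def s1_def s2_def sgn_div_norm n divide_inverse)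
  have g: "?g = (1 / ?s) *\<^sub>R (?A *\<^sub>R ((s1 / edge_length d) *\<^sub>R rot90 (?w - ?v)) + ?B *\<^sub>R ((s2 / dual_edge_length T d) *\<^sub>R rot90 (?l - ?k)))"
    unfolding discrete_gradient_def na ..
  have r: "\<bar>rot90 (?w - ?v) \<bullet> (?l - ?k)\<bar> = edge_length d * dual_edge_length T d * ?s"
    by (rule sin_diamond_angle(1)[OF d])
  have "?g \<bullet> (?l - ?k) = (1 / ?s) * (?A * (s1 / edge_length d) * (rot90 (?w - ?v) \<bullet> (?l - ?k)))"
    unfolding g by (simp add: inner_add_left)
  then have "\<bar>?g \<bullet> (?l - ?k)\<bar> = \<bar>?A\<bar> * dual_edge_length T d"
    using s el s1 by (simp add: abs_mult r)
  moreover have "\<bar>?g \<bullet> (?l - ?k)\<bar> \<le> norm ?g * dual_edge_length T d"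
    using Cauchy_Schwarz_ineq2[of ?g "?l - ?k"] n by simp
  ultimately show "\<bar>at_primal u (cellL d) - at_primal u (cellK d)\<bar> / dual_edge_length T d \<le> norm ?g"
    using el by (simp add: pos_divide_le_eq)
  have "?g \<bullet> (?w - ?v) = (1 / ?s) * (?B * (s2 / dual_edge_length T d) * (rot90 (?l - ?k) \<bullet> (?w - ?v)))"
    unfolding g by (simp add: inner_add_left)
  then have "\<bar>?g \<bullet> (?w - ?v)\<bar> = \<bar>?B\<bar> * edge_length d"
    using s el s2 abs_inner_rot90_commute[of "?l - ?k" "?w - ?v"] by (simp add: abs_mult r)
  moreover have "\<bar>?g \<bullet> (?w - ?v)\<bar> \<le> norm ?g * edge_length d"
    using Cauchy_Schwarz_ineq2[of ?g "?w - ?v"] n by simp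
  ultimately show "\<bar>at_dual u (vertL d) - at_dual u (vertK d)\<bar> / edge_length d \<le> norm ?g"
    using el by (simp add: pos_divide_le_eq)
qed

section \<open>Discrete functions as step functions\<close>

lemma primal_fun_eq: "primal_fun T u = cell_fun (primal T) (\<lambda>K. K) (at_primal u)"
  by (rule ext) (simp add: primal_fun_def cell_fun_def)

lemma dual_fun_eq: "dual_fun T u = cell_fun (vertices T) (dual_cell T) (at_dual u)"
  by (rule ext) (simp add: dual_fun_def cell_fun_def)

text \<open>
  The two triangles over the edge fill a neighbourhood of \<open>x\<close>, so a third cell would
  meet one of the two.
\<close>
lemma primal_cells_at_edge:
  assumes d: "d \<in> diamonds T" "cellL d \<in> primal T" and x: "x \<in> open_segment (vertK d) (vertL d)"
    and K: "K \<in> primal T" "x \<in> closure K"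
  shows "K = cellK d \<or> K = cellL d"
proof -
  have dK: "cellK d \<in> primal T" by (rule diamondD(1)[OF d(1)])
  obtain \<rho> where \<rho>: "\<rho> > 0" "ball x \<rho> \<subseteq> convex hull {vertK d, vertL d, center T (cellK d)} \<union> convex hull {vertK d, vertL d, center T (cellL d)}"
    using two_triangles_neighbourhood[OF x centers_opposite[OF d]] by blast
  have "ball x \<rho> \<inter> K \<noteq> {}" using \<rho>(1) K(2) by (intro open_meets_closure[of _ x]) auto
  then obtain y where y: "y \<in> ball x \<rho>" "y \<in> K" by blast
  then have "y \<in> closure (cellK d) \<or> y \<in> closure (cellL d)"
    using \<rho>(2) primal_triangle[OF dK diamondD(4)[OF d(1)]] primal_triangle[OF d(2) diamondD(5)[OF d]] by blast
  then have "K \<inter> cellK d \<noteq> {} \<or> K \<inter> cellL d \<noteq> {}"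
    using open_meets_closure[OF primal_cell(1)[OF K(1)] y(2)] by blast
  then show ?thesis using primal_disjoint[OF K(1) dK] primal_disjoint[OF K(1) d(2)] by blast
qed

lemma primal_interface:
  assumes x: "x \<in> \<Omega>" "x \<notin> vertices T" and K: "K \<in> primal T" "L \<in> primal T" "K \<noteq> L" "x \<in> closure K" "x \<in> closure L"
  shows "\<exists>d\<in>diamonds T. cellL d \<in> primal T \<and> x \<in> closed_segment (vertK d) (vertL d) \<and> {K, L} = {cellK d, cellL d}"
proof -
  have "x \<notin> K" using open_meets_closure[OF primal_cell(1)[OF K(1)] _ K(5)] primal_disjoint[OF K(1-3)] by blast
  then have "x \<in> frontier K" using K(4) primal_cell(1)[OF K(1)] by (simp add: frontier_def interior_open)
  then obtain a b where ab: "{a, b} \<in> polygon_edges (primal_verts T K)" "x \<in> closed_segment a b"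
    unfolding primal_cell(5)[OF K(1)] path_image_boundary_path[OF primal_cell(4)[OF K(1)]] by blast
  then have "{a, b} \<in> primal_edges T" using K(1) unfolding primal_edges_def by blast
  then obtain d where d: "d \<in> diamonds T" "edge d = {a, b}"
    using bspec[OF conjunct1[OF conjunct2[OF is_diamond_mesh[unfolded diamond_mesh_def]]], of "{a, b}"] by blast
  have xc: "x \<in> closed_segment (vertK d) (vertL d)" unfolding segments_of_edge(1)[OF d(2)] by (rule ab(2))
  have "x \<noteq> vertK d" "x \<noteq> vertL d"
    using edge_vertices[OF d(1)] x(2) by (auto simp: edge_def)
  then have xo: "x \<in> open_segment (vertK d) (vertL d)" using xc by (auto simp: open_segment_def)
  have L: "cellL d \<in> primal T"
  proof (rule ccontr)
    assume "cellL d \<notin> primal T"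
    then have b: "cellL d \<in> boundary_primal \<Omega> T" using diamondD(2)[OF d(1)] by blast
    then have "x \<in> cellL d" using diamondD(6)[OF d(1)] xo by blast
    then show False using boundary_primalD(1)[OF b] frontier_outside x(1) by blast
  qed
  have "K = cellK d \<or> K = cellL d" "L = cellK d \<or> L = cellL d"
    using primal_cells_at_edge[OF d(1) L xo] K by blast+
  then have "{K, L} = {cellK d, cellL d}" using K(3) by blast
  then show ?thesis using d L xc by blast
qed

text \<open>
  At a flat point on a boundary edge the triangle of the inner cell fills the domain near
  \<open>x\<close>: a point of the domain outside the triangle would have its mirror image with
  respect to \<open>x\<close> in the triangle, on the outer side of the boundary line. There is no
  cell on the other side, since \<open>x\<close> would then be interior to the closure.
\<close>
lemma primal_boundary_value:
  assumes x: "flat_point \<Omega> x" "x \<in> B" and B: "B \<in> boundary_primal \<Omega> T"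
    and K: "K \<in> primal T" "x \<in> closure K"
  shows "\<exists>d\<in>diamonds T. x \<in> closed_segment (vertK d) (vertL d) \<and> K = cellK d \<and> cellL d = B"
proof -
  obtain a b where ab: "B = open_segment a b" "{a, b} \<in> primal_edges T"
    using B unfolding boundary_primal_def by blast
  then obtain d where d: "d \<in> diamonds T" "edge d = {a, b}"
    using bspec[OF conjunct1[OF conjunct2[OF is_diamond_mesh[unfolded diamond_mesh_def]]], of "{a, b}"] by blast
  have dK: "cellK d \<in> primal T" by (rule diamondD(1)[OF d(1)])
  have BB: "B = open_segment (vertK d) (vertL d)" unfolding segments_of_edge(2)[OF d(2)] by (rule ab(1))
  then have xo: "x \<in> open_segment (vertK d) (vertL d)" using x(2) by simp
  have T1: "convex hull {vertK d, vertL d, center T (cellK d)} \<subseteq> closure (cellK d)"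
    by (rule primal_triangle[OF dK diamondD(4)[OF d(1)]])
  have L: "cellL d \<in> boundary_primal \<Omega> T"
  proof (rule ccontr)
    assume "cellL d \<notin> boundary_primal \<Omega> T"
    then have L: "cellL d \<in> primal T" using diamondD(2)[OF d(1)] by blast
    obtain \<rho> where \<rho>: "\<rho> > 0" "ball x \<rho> \<subseteq> convex hull {vertK d, vertL d, center T (cellK d)} \<union> convex hull {vertK d, vertL d, center T (cellL d)}"
      using two_triangles_neighbourhood[OF xo centers_opposite[OF d(1) L]] by blast
    then have "ball x \<rho> \<subseteq> closure \<Omega>"
      using T1 primal_triangle[OF L diamondD(5)[OF d(1) L]] primal_closure[OF dK] primal_closure[OF L] by blast
    then show False using flat_point_not_interior_closure[OF x(1) \<rho>(1)] by blast
  qed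
  have LB: "cellL d = B" using diamondD(6)[OF d(1) L] BB by simp
  obtain n r where n: "r > 0" "\<And>y. y \<in> ball x r \<Longrightarrow> y \<in> \<Omega> \<longleftrightarrow> 0 < (y - x) \<bullet> n"
    "\<And>y. y \<in> ball x r \<Longrightarrow> y \<in> closure \<Omega> \<Longrightarrow> 0 \<le> (y - x) \<bullet> n"
    using flat_pointE[OF x(1)] by metis
  let ?c = "cross (vertK d) (vertL d)"
  obtain \<rho> where \<rho>: "\<rho> > 0" "\<And>y. y \<in> ball x \<rho> \<Longrightarrow> 0 \<le> ?c y * ?c (center T (cellK d)) \<Longrightarrow> y \<in> convex hull {vertK d, vertL d, center T (cellK d)}"
    using half_disc_in_triangle[OF xo, of "center T (cellK d)"] center_off_edge[OF d(1) _ dK] by blast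
  have "ball x (min r \<rho>) \<inter> K \<noteq> {}" using n(1) \<rho>(1) K(2) by (intro open_meets_closure[of _ x]) auto
  then obtain y where y: "y \<in> ball x r" "y \<in> ball x \<rho>" "y \<in> K" by auto
  have y0: "0 < (y - x) \<bullet> n" using n(2)[OF y(1)] y(3) primal_cell(2)[OF K(1)] by blast
  define y' where "y' = x - (y - x)"
  have y': "y' \<in> ball x r" "y' \<in> ball x \<rho>" using y by (simp_all add: y'_def dist_norm norm_minus_commute)
  have cx: "?c x = 0" by (intro cross_on_segment open_closed_segment xo)
  have "?c y' + ?c y = 2 * ?c x" by (simp add: cross_coords y'_def algebra_simps)
  then have cy: "?c y' = - ?c y" using cx by simp
  have "0 \<le> ?c y * ?c (center T (cellK d))"
  proof (rule ccontr)
    assume "\<not> ?thesis"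
    then have "0 \<le> ?c y' * ?c (center T (cellK d))" using cy by simp
    then have "y' \<in> closure \<Omega>" using \<rho>(2)[OF y'(2)] T1 primal_closure[OF dK] by blast
    then have "0 \<le> (y' - x) \<bullet> n" using n(3)[OF y'(1)] by blast
    then show False using y0 by (simp add: y'_def inner_diff_left)
  qed
  then have "y \<in> closure (cellK d)" using \<rho>(2)[OF y(2)] T1 by blast
  then have "K \<inter> cellK d \<noteq> {}" using open_meets_closure[OF primal_cell(1)[OF K(1)] y(3)] by blast
  then have "K = cellK d" using primal_disjoint[OF K(1) dK] by blast
  then show ?thesis using d(1) LB open_closed_segment[OF xo] by blast
qed

text \<open>
  Boundary edges with a nonzero value are left out: their values enter neither the primal function
  nor (R2), and nothing is known about \<open>u\<close> there.
\<close>
definition primal_jump_diamonds :: "unknowns \<Rightarrow> diamond set" where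
  "primal_jump_diamonds u = {d \<in> diamonds T. cellL d \<in> primal T \<or> at_primal u (cellL d) = 0}"

lemma finite_primal_jump_diamonds: "finite (primal_jump_diamonds u)"
  using finite_diamonds by (simp add: primal_jump_diamonds_def)

lemma step_function_primal:
  assumes comp: "compatible \<Omega> \<Gamma>0 T" and u: "u \<in> Z_space \<Omega> \<Gamma>0 T" and Z: "Z \<subseteq> \<Gamma>0" "\<And>x. x \<in> Z \<Longrightarrow> flat_point \<Omega> x"
    and f: "f \<in> borel_measurable borel" "f 0 = 0"
  shows "step_function \<Omega> Z (\<lambda>x. f (primal_fun T u x))
     ((\<lambda>d. (vertK d, vertL d, f (at_primal u (cellK d)), f (at_primal u (cellL d)))) ` primal_jump_diamonds u)"
    (is "step_function _ _ _ ?E")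
proof -
  define F where "F = (\<lambda>K. (K, f (at_primal u K))) ` primal T"
  define N where "N = \<Gamma>0 - \<Union>{K \<in> boundary_primal \<Omega> T. K \<subseteq> \<Gamma>0}"
  have m: "(\<lambda>x. f (primal_fun T u x)) \<in> borel_measurable borel"
    unfolding primal_fun_eq by (intro measurable_compose[OF cell_fun_measurable[OF primal_partition] f(1)])
  have J: "\<exists>(a, b, p, q)\<in>?E. x \<in> closed_segment a b \<and> {c, c'} \<subseteq> {p, q}"
    if x: "x \<in> \<Omega> - vertices T" and V: "(V, c) \<in> F" "(V', c') \<in> F" and cl: "x \<in> closure V \<and> x \<in> closure V' \<and> c \<noteq> c'" for x V c V' c'
  proof -
    have VV: "V \<in> primal T" "c = f (at_primal u V)" "V' \<in> primal T" "c' = f (at_primal u V')" using V by (auto simp: F_def)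
    then have "V \<noteq> V'" using cl by blast
    then obtain d where d: "d \<in> diamonds T" "cellL d \<in> primal T" "x \<in> closed_segment (vertK d) (vertL d)" "{V, V'} = {cellK d, cellL d}"
      using primal_interface[of x V V'] x cl VV by blast
    have "{c, c'} \<subseteq> {f (at_primal u (cellK d)), f (at_primal u (cellL d))}"
      using d(4) VV by (auto simp: doubleton_eq_iff)
    moreover have "d \<in> primal_jump_diamonds u" using d by (simp add: primal_jump_diamonds_def)
    ultimately show ?thesis using d(3) by blast
  qed
  have Bd: "\<exists>(a, b, p, q)\<in>?E. x \<in> closed_segment a b \<and> {c, 0} \<subseteq> {p, q}"
    if x: "x \<in> Z - N" and V: "(V, c) \<in> F" and cl: "x \<in> closure V \<and> c \<noteq> 0" for x V c
  proof -
    have VV: "V \<in> primal T" "c = f (at_primal u V)" using V by (auto simp: F_def)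
    obtain B where B: "B \<in> boundary_primal \<Omega> T" "B \<subseteq> \<Gamma>0" "x \<in> B" using x Z(1) unfolding N_def by blast
    have "at_primal u B = 0" using u B by (simp add: Z_space_def)
    moreover obtain d where d: "d \<in> diamonds T" "x \<in> closed_segment (vertK d) (vertL d)" "V = cellK d" "cellL d = B"
      using primal_boundary_value[OF Z(2) B(3,1) VV(1)] x cl by blast
    ultimately have "d \<in> primal_jump_diamonds u" "{c, 0} \<subseteq> {f (at_primal u (cellK d)), f (at_primal u (cellL d))}"
      using VV f(2) by (simp_all add: primal_jump_diamonds_def)
    then show ?thesis using d(2) by blast
  qed
  have finE: "finite ?E" using finite_primal_jump_diamonds by simp
  show ?thesis
    unfolding step_function_def
  proof (rule conjI[OF finE], rule conjI[OF m], rule exI[of _ F], rule exI[of _ "vertices T"], rule exI[of _ N], intro conjI)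
    show "finite F" using finite_primal by (simp add: F_def)
    show "finite (vertices T)" by (rule finite_vertices)
    show "length_measure N = 0" using comp by (simp add: compatible_def N_def)
    show "\<forall>(V, c)\<in>F. open V \<and> (\<forall>x\<in>V. f (primal_fun T u x) = c)"
      unfolding F_def primal_fun_eq using cell_fun_eq[OF primal_partition, of _ _ "at_primal u"] primal_cell(1) by auto
    show "negligible (\<Omega> - \<Union>(fst ` F))"
      using primal_partition by (simp add: F_def open_partition_def image_image)
    show "\<forall>x\<in>\<Omega> - vertices T. \<forall>(V, c)\<in>F. \<forall>(V', c')\<in>F. x \<in> closure V \<and> x \<in> closure V' \<and> c \<noteq> c' \<longrightarrow>
           (\<exists>(a, b, p, q)\<in>?E. x \<in> closed_segment a b \<and> {c, c'} \<subseteq> {p, q})"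
      unfolding case_prod_unfold
    proof (intro ballI impI)
      fix x z z' assume "x \<in> \<Omega> - vertices T" "z \<in> F" "z' \<in> F" "x \<in> closure (fst z) \<and> x \<in> closure (fst z') \<and> snd z \<noteq> snd z'"
      then show "\<exists>e\<in>?E. x \<in> closed_segment (fst e) (fst (snd e)) \<and> {snd z, snd z'} \<subseteq> {fst (snd (snd e)), snd (snd (snd e))}"
        using J[of x "fst z" "snd z" "fst z'" "snd z'", unfolded case_prod_unfold] by simp
    qed
    show "\<forall>x\<in>Z - N. \<forall>(V, c)\<in>F. x \<in> closure V \<and> c \<noteq> 0 \<longrightarrow>
           (\<exists>(a, b, p, q)\<in>?E. x \<in> closed_segment a b \<and> {c, 0} \<subseteq> {p, q})"
      unfolding case_prod_unfold
    proof (intro ballI impI)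
      fix x z assume "x \<in> Z - N" "z \<in> F" "x \<in> closure (fst z) \<and> snd z \<noteq> 0"
      then show "\<exists>e\<in>?E. x \<in> closed_segment (fst e) (fst (snd e)) \<and> {snd z, 0} \<subseteq> {fst (snd (snd e)), snd (snd (snd e))}"
        using Bd[of x "fst z" "snd z", unfolded case_prod_unfold] by simp
    qed
  qed
qed

lemma dual_closure: "v \<in> vertices T \<Longrightarrow> closure (dual_cell T v) \<subseteq> closure \<Omega>"
  by (rule closure_mono[OF dual_cellD(2)])

lemma dual_edge_neighbourhood:
  assumes d: "d \<in> diamonds T" and x: "x \<in> open_segment (center T (cellK d)) (center T (cellL d))"
  shows "\<exists>\<rho>>0. ball x \<rho> \<subseteq> closure (dual_cell T (vertK d)) \<union> closure (dual_cell T (vertL d))"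
proof -
  have e: "vertK d \<in> edge d" "vertL d \<in> edge d" by (auto simp: edge_def)
  show ?thesis
    using two_triangles_neighbourhood[OF x vertices_opposite[OF d]] dual_triangle[OF d e(1)] dual_triangle[OF d e(2)] by blast
qed

lemma dual_interface:
  assumes x: "x \<in> \<Omega>" "x \<notin> (\<Union>d\<in>diamonds T. dual_edge T d)"
    and v: "v \<in> vertices T" "w \<in> vertices T" "v \<noteq> w" "x \<in> closure (dual_cell T v)" "x \<in> closure (dual_cell T w)"
  shows "\<exists>d\<in>diamonds T. x \<in> closed_segment (center T (cellK d)) (center T (cellL d)) \<and> {v, w} = {vertK d, vertL d}"
proof -
  have "x \<notin> dual_cell T v" using open_meets_closure[OF dual_cellD(1)[OF v(1)] _ v(5)] dual_disjoint[OF v(1-3)] by blast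
  then have "x \<in> frontier (dual_cell T v)" using v(4) dual_cellD(1)[OF v(1)] by (simp add: frontier_def interior_open)
  then obtain d where d: "d \<in> diamonds T" and xc: "x \<in> closed_segment (center T (cellK d)) (center T (cellL d))"
    using dual_cellD(8)[OF v(1)] frontier_outside x(1) by blast
  have "x \<noteq> center T (cellK d)" "x \<noteq> center T (cellL d)" using x(2) d by (auto simp: dual_edge_def)
  then have xo: "x \<in> open_segment (center T (cellK d)) (center T (cellL d))" using xc by (auto simp: open_segment_def)
  obtain \<rho> where \<rho>: "\<rho> > 0" "ball x \<rho> \<subseteq> closure (dual_cell T (vertK d)) \<union> closure (dual_cell T (vertL d))"
    using dual_edge_neighbourhood[OF d xo] by blast
  have vd: "vertK d \<in> vertices T" "vertL d \<in> vertices T" using edge_vertices[OF d] by (auto simp: edge_def)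
  have which: "z = vertK d \<or> z = vertL d" if z: "z \<in> vertices T" "x \<in> closure (dual_cell T z)" for z
  proof -
    have "ball x \<rho> \<inter> dual_cell T z \<noteq> {}" using \<rho>(1) z(2) by (intro open_meets_closure[of _ x]) auto
    then obtain y where y: "y \<in> ball x \<rho>" "y \<in> dual_cell T z" by blast
    then have "dual_cell T z \<inter> dual_cell T (vertK d) \<noteq> {} \<or> dual_cell T z \<inter> dual_cell T (vertL d) \<noteq> {}"
      using open_meets_closure[OF dual_cellD(1)[OF z(1)] y(2)] \<rho>(2) by blast
    then show ?thesis using dual_disjoint[OF z(1)] vd by blast
  qed
  have "{v, w} = {vertK d, vertL d}" using which[OF v(1,4)] which[OF v(2,5)] v(3) by blast
  then show ?thesis using d xc by blast
qed

text \<open>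
  If the vertex were interior, \<open>x\<close> would lie on a dual edge between two interior
  centers, with dual cells on both sides, and would be interior to the closure of
  \<open>\<Omega>\<close>.
\<close>
lemma dual_boundary_vertex:
  assumes x: "flat_point \<Omega> x" and v: "v \<in> vertices T" "x \<in> closure (dual_cell T v)"
  shows "v \<in> frontier \<Omega>"
proof -
  have x\<Omega>: "x \<notin> \<Omega>" by (rule flat_point_outside[OF x])
  have "x \<notin> dual_cell T v" using dual_cellD(2)[OF v(1)] x\<Omega> by blast
  then have "x \<in> frontier (dual_cell T v)" using v(2) dual_cellD(1)[OF v(1)] by (simp add: frontier_def interior_open)
  then consider d where "d \<in> diamonds T" "v \<in> edge d" "x \<in> closed_segment (center T (cellK d)) (center T (cellL d))"
    | "v \<in> frontier \<Omega>" using dual_cellD(8)[OF v(1)] by blast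
  then show ?thesis
  proof cases
    case 1
    show ?thesis
    proof (cases "cellL d \<in> primal T")
      case True
      have "center T (cellK d) \<in> \<Omega>" "center T (cellL d) \<in> \<Omega>"
        using primal_cell(2,3)[OF diamondD(1)[OF 1(1)]] primal_cell(2,3)[OF True] by blast+
      then have xo: "x \<in> open_segment (center T (cellK d)) (center T (cellL d))"
        using 1(3) x\<Omega> by (auto simp: open_segment_def)
      have vd: "vertK d \<in> vertices T" "vertL d \<in> vertices T" using edge_vertices[OF 1(1)] by (auto simp: edge_def)
      obtain \<rho> where \<rho>: "\<rho> > 0" "ball x \<rho> \<subseteq> closure (dual_cell T (vertK d)) \<union> closure (dual_cell T (vertL d))"
        using dual_edge_neighbourhood[OF 1(1) xo] by blast
      then have "ball x \<rho> \<subseteq> closure \<Omega>" using dual_closure[OF vd(1)] dual_closure[OF vd(2)] by blast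
      then show ?thesis using flat_point_not_interior_closure[OF x \<rho>(1)] by blast
    next
      case False
      then have L: "cellL d \<in> boundary_primal \<Omega> T" using diamondD(2)[OF 1(1)] by blast
      have "vertK d \<in> frontier \<Omega> \<and> vertL d \<in> frontier \<Omega>" by (rule boundary_primalD(4)[OF L diamondD(6)[OF 1(1) L]])
      then show ?thesis using 1(2) by (auto simp: edge_def)
    qed
  qed
qed

text \<open>
  A dual cell that touches \<open>Z\<close> belongs to a boundary vertex and its closure meets
  \<open>\<Gamma>0\<close>, so its value is \<open>0\<close>. For the primal function, in contrast,
  a jump down to the boundary value has to be recorded.
\<close>
lemma step_function_dual:
  assumes comp: "compatible \<Omega> \<Gamma>0 T" and u: "u \<in> Z_space \<Omega> \<Gamma>0 T" and Z: "Z \<subseteq> \<Gamma>0" "\<And>x. x \<in> Z \<Longrightarrow> flat_point \<Omega> x"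
    and f: "f \<in> borel_measurable borel" "f 0 = 0"
  shows "step_function \<Omega> Z (\<lambda>x. f (dual_fun T u x))
     ((\<lambda>d. (center T (cellK d), center T (cellL d), f (at_dual u (vertK d)), f (at_dual u (vertL d)))) ` diamonds T)"
    (is "step_function _ _ _ ?E")
proof -
  define F where "F = (\<lambda>v. (dual_cell T v, f (at_dual u v))) ` vertices T"
  define N where "N = \<Gamma>0 - \<Union>{K \<in> boundary_primal \<Omega> T. K \<subseteq> \<Gamma>0}"
  let ?P = "\<Union>d\<in>diamonds T. dual_edge T d"
  have m: "(\<lambda>x. f (dual_fun T u x)) \<in> borel_measurable borel"
    unfolding dual_fun_eq by (intro measurable_compose[OF cell_fun_measurable[OF dual_partition] f(1)])
  have J: "\<exists>(a, b, p, q)\<in>?E. x \<in> closed_segment a b \<and> {c, c'} \<subseteq> {p, q}"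
    if x: "x \<in> \<Omega> - ?P" and V: "(V, c) \<in> F" "(V', c') \<in> F" and cl: "x \<in> closure V \<and> x \<in> closure V' \<and> c \<noteq> c'" for x V c V' c'
  proof -
    obtain v v' where VV: "v \<in> vertices T" "V = dual_cell T v" "c = f (at_dual u v)"
      "v' \<in> vertices T" "V' = dual_cell T v'" "c' = f (at_dual u v')" using V by (auto simp: F_def)
    then have ne: "v \<noteq> v'" using cl by blast
    obtain d where d: "d \<in> diamonds T" "x \<in> closed_segment (center T (cellK d)) (center T (cellL d))" "{v, v'} = {vertK d, vertL d}"
      using dual_interface[OF _ _ VV(1,4) ne, of x] x cl VV(2,5) by blast
    have "{c, c'} \<subseteq> {f (at_dual u (vertK d)), f (at_dual u (vertL d))}"
      using d(3) VV(3,6) by (auto simp: doubleton_eq_iff)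
    then show ?thesis using d(1,2) by blast
  qed
  have Bd: "\<exists>(a, b, p, q)\<in>?E. x \<in> closed_segment a b \<and> {c, 0} \<subseteq> {p, q}"
    if x: "x \<in> Z - N" and V: "(V, c) \<in> F" and cl: "x \<in> closure V \<and> c \<noteq> 0" for x V c
  proof -
    obtain v where VV: "v \<in> vertices T" "V = dual_cell T v" "c = f (at_dual u v)" using V by (auto simp: F_def)
    have "v \<in> boundary_vertices \<Omega> T"
      using dual_boundary_vertex[OF Z(2) VV(1)] x cl VV(1,2) by (auto simp: boundary_vertices_def)
    moreover have "closure (dual_cell T v) \<inter> \<Gamma>0 \<noteq> {}" using x cl VV(2) Z(1) by blast
    ultimately have "at_dual u v = 0" using u by (simp add: Z_space_def)
    then show ?thesis using cl VV(3) f(2) by simp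
  qed
  have finE: "finite ?E" using finite_diamonds by simp
  show ?thesis
    unfolding step_function_def
  proof (rule conjI[OF finE], rule conjI[OF m], rule exI[of _ F], rule exI[of _ "?P"], rule exI[of _ N], intro conjI)
    show "finite F" using finite_vertices by (simp add: F_def)
    show "finite ?P" using finite_diamonds by (auto simp: dual_edge_def)
    show "length_measure N = 0" using comp by (simp add: compatible_def N_def)
    show "\<forall>(V, c)\<in>F. open V \<and> (\<forall>x\<in>V. f (dual_fun T u x) = c)"
      unfolding F_def dual_fun_eq using cell_fun_eq[OF dual_partition, of _ _ "at_dual u"] dual_cellD(1) by auto
    show "negligible (\<Omega> - \<Union>(fst ` F))"
      using dual_partition by (simp add: F_def open_partition_def image_image)
    show "\<forall>x\<in>\<Omega> - ?P. \<forall>(V, c)\<in>F. \<forall>(V', c')\<in>F. x \<in> closure V \<and> x \<in> closure V' \<and> c \<noteq> c' \<longrightarrow>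
           (\<exists>(a, b, p, q)\<in>?E. x \<in> closed_segment a b \<and> {c, c'} \<subseteq> {p, q})"
      unfolding case_prod_unfold
    proof (intro ballI impI)
      fix x z z' assume "x \<in> \<Omega> - ?P" "z \<in> F" "z' \<in> F" "x \<in> closure (fst z) \<and> x \<in> closure (fst z') \<and> snd z \<noteq> snd z'"
      then show "\<exists>e\<in>?E. x \<in> closed_segment (fst e) (fst (snd e)) \<and> {snd z, snd z'} \<subseteq> {fst (snd (snd e)), snd (snd (snd e))}"
        using J[of x "fst z" "snd z" "fst z'" "snd z'", unfolded case_prod_unfold] by simp
    qed
    show "\<forall>x\<in>Z - N. \<forall>(V, c)\<in>F. x \<in> closure V \<and> c \<noteq> 0 \<longrightarrow>
           (\<exists>(a, b, p, q)\<in>?E. x \<in> closed_segment a b \<and> {c, 0} \<subseteq> {p, q})"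
      unfolding case_prod_unfold
    proof (intro ballI impI)
      fix x z assume "x \<in> Z - N" "z \<in> F" "x \<in> closure (fst z) \<and> snd z \<noteq> 0"
      then show "\<exists>e\<in>?E. x \<in> closed_segment (fst e) (fst (snd e)) \<and> {snd z, 0} \<subseteq> {fst (snd (snd e)), snd (snd (snd e))}"
        using Bd[of x "fst z" "snd z", unfolded case_prod_unfold] by simp
    qed
  qed
qed

section \<open>The discrete inequality\<close>

lemma sin_angle_bounds:
  assumes "R1 T \<alpha>" "d \<in> diamonds T"
  shows "0 < sin \<alpha>" "sin \<alpha> \<le> sin (diamond_angle T d)"
proof -
  show "0 < sin \<alpha>" using assms(1) by (intro sin_gt_zero) (auto simp: R1_def)
  have "sin \<alpha> \<le> \<bar>sin (diamond_angle T d)\<bar>" using assms by (simp add: R1_def)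
  then show "sin \<alpha> \<le> sin (diamond_angle T d)" using sin_diamond_angle(2)[OF assms(2)] by simp
qed

text \<open>
  (R1) bounds the product of the diagonals by \<open>2 / sin \<alpha>\<close> times the area of the
  diamond.
\<close>
lemma weighted_gradient_sum:
  assumes R1: "R1 T \<alpha>" and p: "1 \<le> p" and D: "D \<subseteq> diamonds T"
    and g: "\<And>d. d \<in> D \<Longrightarrow> 0 \<le> g d \<and> g d \<le> norm (discrete_gradient T u d)"
  shows "(\<Sum>d\<in>D. edge_length d * dual_edge_length T d * g d powr p)
    \<le> 2 / sin \<alpha> * (\<Sum>d\<in>diamonds T. measure lebesgue (diamond_region T d) * norm (discrete_gradient T u d) powr p)"
proof -
  have "(\<Sum>d\<in>D. edge_length d * dual_edge_length T d * g d powr p)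
      \<le> (\<Sum>d\<in>D. 2 / sin \<alpha> * (measure lebesgue (diamond_region T d) * norm (discrete_gradient T u d) powr p))"
  proof (rule sum_mono)
    fix d assume d: "d \<in> D"
    then have dT: "d \<in> diamonds T" using D by blast
    note s = sin_angle_bounds[OF R1 dT]
    have w0: "0 \<le> edge_length d * dual_edge_length T d" using lengths_positive[OF dT] by simp
    have "edge_length d * dual_edge_length T d * sin \<alpha> \<le> edge_length d * dual_edge_length T d * sin (diamond_angle T d)"
      using s(2) w0 by (rule mult_left_mono)
    also have "\<dots> \<le> 2 * measure lebesgue (diamond_region T d)" by (rule diamond_area[OF dT])
    finally have w: "edge_length d * dual_edge_length T d \<le> 2 / sin \<alpha> * measure lebesgue (diamond_region T d)"
      using s(1) by (simp add: field_simps)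
    have "g d powr p \<le> norm (discrete_gradient T u d) powr p" using g[OF d] p by (intro powr_mono2) auto
    then have "edge_length d * dual_edge_length T d * g d powr p
        \<le> 2 / sin \<alpha> * measure lebesgue (diamond_region T d) * norm (discrete_gradient T u d) powr p"
      using s(1) by (intro mult_mono[OF w]) (auto simp: measure_nonneg)
    then show "edge_length d * dual_edge_length T d * g d powr p
        \<le> 2 / sin \<alpha> * (measure lebesgue (diamond_region T d) * norm (discrete_gradient T u d) powr p)"
      by (simp only: mult.assoc)
  qed
  also have "\<dots> \<le> (\<Sum>d\<in>diamonds T. 2 / sin \<alpha> * (measure lebesgue (diamond_region T d) * norm (discrete_gradient T u d) powr p))"
  proof (rule sum_mono2[OF finite_diamonds D])
    fix b assume "b \<in> diamonds T - D"
    then have "0 < sin \<alpha>" using sin_angle_bounds(1)[OF R1] by blast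
    then show "0 \<le> 2 / sin \<alpha> * (measure lebesgue (diamond_region T b) * norm (discrete_gradient T u b) powr p)"
      by (intro mult_nonneg_nonneg) auto
  qed
  finally show ?thesis by (simp only: sum_distrib_left)
qed

lemma weighted_primal_sum:
  assumes R2: "R2 T \<zeta>"
  shows "(\<Sum>d\<in>primal_jump_diamonds u. edge_length d * dual_edge_length T d *
      (\<bar>at_primal u (cellK d)\<bar> powr r + \<bar>at_primal u (cellL d)\<bar> powr r))
    \<le> (\<Sum>K\<in>primal T. measure lebesgue K * \<bar>at_primal u K\<bar> powr r) / \<zeta>"
proof (rule incidence_sum[where inc = "\<lambda>K d. K = cellK d \<or> K = cellL d"])
  let ?J = "primal_jump_diamonds u"
  have w0: "0 \<le> edge_length d * dual_edge_length T d" if "d \<in> diamonds T" for d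
    using lengths_positive[OF that] by simp
  have JT: "?J \<subseteq> diamonds T" by (auto simp: primal_jump_diamonds_def)
  show "0 \<le> edge_length d * dual_edge_length T d" if "d \<in> ?J" for d using that w0 JT by blast
  show "\<bar>at_primal u (cellK d)\<bar> powr r + \<bar>at_primal u (cellL d)\<bar> powr r
      \<le> (\<Sum>K\<in>{K \<in> primal T. K = cellK d \<or> K = cellL d}. \<bar>at_primal u K\<bar> powr r)" if d: "d \<in> ?J" for d
  proof -
    have dT: "d \<in> diamonds T" using d JT by blast
    have K: "cellK d \<in> primal T" by (rule diamondD(1)[OF dT])
    show ?thesis
    proof (cases "cellL d \<in> primal T")
      case True
      then have "{K \<in> primal T. K = cellK d \<or> K = cellL d} = {cellK d, cellL d}" using K by blast
      then show ?thesis using diamondD(3)[OF dT] by simp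
    next
      case False
      then have "{K \<in> primal T. K = cellK d \<or> K = cellL d} = {cellK d}" using K by blast
      moreover have "at_primal u (cellL d) = 0" using d False by (simp add: primal_jump_diamonds_def)
      ultimately show ?thesis by simp
    qed
  qed
  show "(\<Sum>d\<in>{d \<in> ?J. K = cellK d \<or> K = cellL d}. edge_length d * dual_edge_length T d) \<le> measure lebesgue K / \<zeta>"
    if K: "K \<in> primal T" for K
  proof -
    have "(\<Sum>d\<in>{d \<in> ?J. K = cellK d \<or> K = cellL d}. edge_length d * dual_edge_length T d)
      \<le> (\<Sum>d | d \<in> diamonds T \<and> edge d \<in> polygon_edges (primal_verts T K). edge_length d * dual_edge_length T d)"
    proof (rule sum_mono2)
      show "{d \<in> ?J. K = cellK d \<or> K = cellL d} \<subseteq> {d \<in> diamonds T. edge d \<in> polygon_edges (primal_verts T K)}"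
        using JT diamondD(4,5) K unfolding edge_def by blast
    qed (use finite_diamonds w0 in auto)
    also have "\<dots> \<le> measure lebesgue K / \<zeta>" using R2 K by (simp add: R2_def)
    finally show ?thesis .
  qed
qed (use finite_primal finite_primal_jump_diamonds in auto)

lemma weighted_dual_sum:
  assumes R2: "R2 T \<zeta>"
  shows "(\<Sum>d\<in>diamonds T. edge_length d * dual_edge_length T d *
      (\<bar>at_dual u (vertK d)\<bar> powr r + \<bar>at_dual u (vertL d)\<bar> powr r))
    \<le> (\<Sum>v\<in>vertices T. measure lebesgue (dual_cell T v) * \<bar>at_dual u v\<bar> powr r) / \<zeta>"
proof (rule incidence_sum[where inc = "\<lambda>v d. v \<in> edge d"])
  show w0: "0 \<le> edge_length d * dual_edge_length T d" if "d \<in> diamonds T" for d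
    using lengths_positive[OF that] by simp
  show "\<bar>at_dual u (vertK d)\<bar> powr r + \<bar>at_dual u (vertL d)\<bar> powr r
      \<le> (\<Sum>v\<in>{v \<in> vertices T. v \<in> edge d}. \<bar>at_dual u v\<bar> powr r)" if d: "d \<in> diamonds T" for d
  proof -
    have "{v \<in> vertices T. v \<in> edge d} = {vertK d, vertL d}"
      using edge_vertices[OF d] by (auto simp: edge_def)
    then show ?thesis using verts_distinct[OF d] by simp
  qed
  show "(\<Sum>d\<in>{d \<in> diamonds T. v \<in> edge d}. edge_length d * dual_edge_length T d) \<le> measure lebesgue (dual_cell T v) / \<zeta>"
    if v: "v \<in> vertices T" for v
  proof -
    have "(\<Sum>d\<in>{d \<in> diamonds T. v \<in> edge d}. edge_length d * dual_edge_length T d)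
      \<le> (\<Sum>d | d \<in> diamonds T \<and> dual_edge T d \<in> polygon_edges (dual_verts T v). edge_length d * dual_edge_length T d)"
    proof (rule sum_mono2)
      show "{d \<in> diamonds T. v \<in> edge d} \<subseteq> {d \<in> diamonds T. dual_edge T d \<in> polygon_edges (dual_verts T v)}"
        using dual_cellD(9)[OF v] by blast
    qed (use finite_diamonds w0 in auto)
    also have "\<dots> \<le> measure lebesgue (dual_cell T v) / \<zeta>" using R2 v by (simp add: R2_def)
    finally show ?thesis .
  qed
qed (use finite_vertices finite_diamonds in auto)

lemma cells_measure_le:
  assumes "open_partition \<Omega> I V"
  shows "(\<Sum>i\<in>I. measure lebesgue (V i)) \<le> measure lebesgue \<Omega>"
proof -
  have fin: "finite I" and dj: "disjoint_family_on V I" and V: "\<And>i. i \<in> I \<Longrightarrow> V i \<subseteq> \<Omega>"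
    using assms by (auto simp: open_partition_def)
  have lm: "V i \<in> lmeasurable" if "i \<in> I" for i using cell_lmeasurable[OF assms bounded that] .
  have "(\<Sum>i\<in>I. measure lebesgue (V i)) = measure lebesgue (\<Union>i\<in>I. V i)"
  proof (rule measure_finite_Union[symmetric, OF fin _ dj])
    show "V ` I \<subseteq> sets lebesgue" using lm by blast
    show "emeasure lebesgue (V i) \<noteq> \<infinity>" if "i \<in> I" for i
      using fmeasurableD2[OF lm[OF that]] unfolding infinity_ennreal_def .
  qed
  also have "\<dots> \<le> measure lebesgue \<Omega>"
    using V lm fin lmeasurable_open[OF bounded op] by (intro measure_mono_fmeasurable) (auto intro!: sets.finite_UN)
  finally show ?thesis .
qed

lemma power_sobolev:
  assumes C0: "0 < C0" and sob: "\<And>v E. step_function \<Omega> Z v E \<Longrightarrow>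
      (\<integral>\<^sup>+ z. ennreal ((v z)\<^sup>2) * indicator \<Omega> z \<partial>lborel) \<le> ennreal ((C0 * total_variation E)\<^sup>2)"
    and st: "step_function \<Omega> Z (\<lambda>x. \<bar>cell_fun I V c x\<bar> powr s) ((\<lambda>d. (a d, b d, \<bar>p d\<bar> powr s, \<bar>q d\<bar> powr s)) ` D)"
    and part: "open_partition \<Omega> I V" and D: "finite D"
  shows "(\<Sum>i\<in>I. measure lebesgue (V i) * \<bar>c i\<bar> powr (2 * s)) \<le> (C0 * (\<Sum>d\<in>D. dist (a d) (b d) * \<bar>\<bar>p d\<bar> powr s - \<bar>q d\<bar> powr s\<bar>))\<^sup>2"
proof -
  let ?E = "(\<lambda>d. (a d, b d, \<bar>p d\<bar> powr s, \<bar>q d\<bar> powr s)) ` D"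
  have sq: "(\<bar>t\<bar> powr s)\<^sup>2 = \<bar>t\<bar> powr (2 * s)" for t :: real
    by (simp add: power2_eq_square flip: powr_add)
  have "(\<integral>\<^sup>+ z. ennreal (\<bar>cell_fun I V c z\<bar> powr (2 * s)) * indicator \<Omega> z \<partial>lborel) \<le> ennreal ((C0 * total_variation ?E)\<^sup>2)"
    using sob[OF st] unfolding sq .
  then have "(\<Sum>i\<in>I. measure lebesgue (V i) * \<bar>c i\<bar> powr (2 * s)) \<le> (C0 * total_variation ?E)\<^sup>2"
    by (intro cell_sum_le_integral[OF part bounded, of "\<lambda>t. \<bar>t\<bar> powr (2 * s)"]) auto
  also have "\<dots> \<le> (C0 * (\<Sum>d\<in>D. dist (a d) (b d) * \<bar>\<bar>p d\<bar> powr s - \<bar>q d\<bar> powr s\<bar>))\<^sup>2"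
    using C0 total_variation_nonneg total_variation_image_le[OF D]
    by (intro power_mono mult_left_mono) auto
  finally show ?thesis .
qed

text \<open>
  The primal and the dual half of the theorem at once. \<open>dist (a d) (b d)\<close> is the length
  of the edge that carries the jump, and \<open>l d\<close> that of the other diagonal.
\<close>
lemma cell_Lq_bound:
  fixes I :: "'i set" and u :: unknowns
  assumes pq: "1 \<le> p \<and> p < 2 \<and> 1 \<le> q \<and> q \<le> 2 * p / (2 - p) \<or> 2 \<le> p \<and> 1 \<le> q"
    and C0: "0 < C0" and sob: "\<And>v E. step_function \<Omega> Z v E \<Longrightarrow>
      (\<integral>\<^sup>+ z. ennreal ((v z)\<^sup>2) * indicator \<Omega> z \<partial>lborel) \<le> ennreal ((C0 * total_variation E)\<^sup>2)"
    and st: "\<And>s. step_function \<Omega> Z (\<lambda>x. \<bar>cell_fun I V c x\<bar> powr s) ((\<lambda>d. (a d, b d, \<bar>f d\<bar> powr s, \<bar>g d\<bar> powr s)) ` D)"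
    and part: "open_partition \<Omega> I V" and D: "D \<subseteq> diamonds T"
    and l: "\<And>d. d \<in> D \<Longrightarrow> 0 < l d \<and> dist (a d) (b d) * l d = edge_length d * dual_edge_length T d"
    and grad: "\<And>d. d \<in> D \<Longrightarrow> \<bar>g d - f d\<bar> / l d \<le> norm (discrete_gradient T u d)"
    and weights: "\<And>r. 0 < r \<Longrightarrow> (\<Sum>d\<in>D. edge_length d * dual_edge_length T d * (\<bar>f d\<bar> powr r + \<bar>g d\<bar> powr r))
        \<le> (\<Sum>i\<in>I. measure lebesgue (V i) * \<bar>c i\<bar> powr r) / \<zeta>"
    and R1: "R1 T \<alpha>" and \<zeta>: "0 < \<zeta>"
  shows "(\<Sum>i\<in>I. measure lebesgue (V i) * \<bar>c i\<bar> powr q) \<le> (Lq_constant p q (measure lebesgue \<Omega>) C0 *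
      (2 * (seminorm_1 T p u / (sin \<alpha> powr (1 / p) * \<zeta> powr ((p - 1) / p))))) powr q"
proof -
  have p: "1 \<le> p" and q: "1 \<le> q" using pq by auto
  have finD: "finite D" using D finite_diamonds by (rule finite_subset)
  have sa: "0 < sin \<alpha>" using R1 by (intro sin_gt_zero) (auto simp: R1_def)
  define S where "S = (\<Sum>d\<in>diamonds T. measure lebesgue (diamond_region T d) * norm (discrete_gradient T u d) powr p)"
  have S0: "S \<ge> 0" by (auto simp: S_def intro!: sum_nonneg)
  define G where "G = 2 / sin \<alpha> * S"
  have "G powr (1 / p) = 2 powr (1 / p) * (S powr (1 / p) / sin \<alpha> powr (1 / p))"
    unfolding G_def using sa S0 by (simp add: powr_mult powr_divide)
  also have "\<dots> \<le> 2 * (S powr (1 / p) / sin \<alpha> powr (1 / p))"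
  proof (rule mult_right_mono)
    have "(2::real) powr (1 / p) \<le> 2 powr 1" using p by (intro powr_mono) auto
    then show "(2::real) powr (1 / p) \<le> 2" by simp
  qed simp
  finally have "G powr (1 / p) / \<zeta> powr ((p - 1) / p) \<le> 2 * (S powr (1 / p) / sin \<alpha> powr (1 / p)) / \<zeta> powr ((p - 1) / p)"
    by (intro divide_right_mono) auto
  then have GR: "G powr (1 / p) / \<zeta> powr ((p - 1) / p) \<le> 2 * (seminorm_1 T p u / (sin \<alpha> powr (1 / p) * \<zeta> powr ((p - 1) / p)))"
    by (simp add: seminorm_1_def S_def)
  have "(\<Sum>i\<in>I. measure lebesgue (V i) * \<bar>c i\<bar> powr q) \<le>
      (Lq_constant p q (measure lebesgue \<Omega>) C0 * (G powr (1 / p) / \<zeta> powr ((p - 1) / p))) powr q"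
  proof (rule sobolev_to_Lq[OF pq _ C0 _ finD])
    show "finite I" using part by (simp add: open_partition_def)
    show "\<forall>d\<in>D. 0 \<le> edge_length d * dual_edge_length T d \<and> 0 \<le> \<bar>g d - f d\<bar> / l d \<and> 0 \<le> dist (a d) (b d) \<and>
        dist (a d) (b d) * \<bar>f d - g d\<bar> = edge_length d * dual_edge_length T d * (\<bar>g d - f d\<bar> / l d)"
    proof
      fix d assume d: "d \<in> D"
      have "0 \<le> edge_length d * dual_edge_length T d" using lengths_positive d D by (simp add: less_imp_le subset_iff)
      moreover have "dist (a d) (b d) * \<bar>f d - g d\<bar> = dist (a d) (b d) * l d * (\<bar>g d - f d\<bar> / l d)"
      proof -
        have "l d \<noteq> 0" using l[OF d] by auto
        then show ?thesis by (simp add: abs_minus_commute)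
      qed
      ultimately show "0 \<le> edge_length d * dual_edge_length T d \<and> 0 \<le> \<bar>g d - f d\<bar> / l d \<and> 0 \<le> dist (a d) (b d) \<and>
          dist (a d) (b d) * \<bar>f d - g d\<bar> = edge_length d * dual_edge_length T d * (\<bar>g d - f d\<bar> / l d)"
        using l[OF d] by simp
    qed
    show "(\<Sum>d\<in>D. edge_length d * dual_edge_length T d * (\<bar>g d - f d\<bar> / l d) powr p) \<le> G"
      unfolding G_def S_def using l grad by (intro weighted_gradient_sum[OF R1 p D]) (auto simp: less_imp_le)
  qed (use power_sobolev[OF C0 sob st part finD] cells_measure_le[OF part] weights \<zeta> in auto)
  also have "\<dots> \<le> (Lq_constant p q (measure lebesgue \<Omega>) C0 *
      (2 * (seminorm_1 T p u / (sin \<alpha> powr (1 / p) * \<zeta> powr ((p - 1) / p))))) powr q"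
    using GR q Lq_constant_pos[OF pq _ C0, of "measure lebesgue \<Omega>"]
    by (intro powr_mono2 mult_left_mono mult_nonneg_nonneg) (auto simp: less_imp_le)
  finally show ?thesis .
qed

end

text \<open>
  A set of positive length cannot be covered by no edges, so one compatible mesh already shows that
  \<open>\<Gamma>0\<close> contains a segment.
\<close>
lemma boundary_segment_exists:
  assumes pos: "length_measure \<Gamma>0 > 0" and mesh: "ddfv_mesh \<Omega> T" and comp: "compatible \<Omega> \<Gamma>0 T"
  obtains x w where "w \<noteq> 0" "\<And>l. \<bar>l\<bar> < 1 / 2 \<Longrightarrow> x + l *\<^sub>R w \<in> \<Gamma>0 \<inter> frontier \<Omega>"
proof -
  have "{K \<in> boundary_primal \<Omega> T. K \<subseteq> \<Gamma>0} \<noteq> {}"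
  proof
    assume none: "{K \<in> boundary_primal \<Omega> T. K \<subseteq> \<Gamma>0} = {}"
    have "length_measure \<Gamma>0 = 0" using comp unfolding compatible_def none by simp
    then show False using pos by simp
  qed
  then obtain K where K: "K \<in> boundary_primal \<Omega> T" "K \<subseteq> \<Gamma>0" by blast
  then obtain a b where ab: "K = open_segment a b" "K \<subseteq> frontier \<Omega>" unfolding boundary_primal_def by blast
  have "center T K \<in> K"
    using mesh K(1) unfolding ddfv_mesh_def primal_mesh_def by blast
  then have ne: "a \<noteq> b" using ab by auto
  show thesis
  proof (rule that[of "b - a" "midpoint a b"])
    show "b - a \<noteq> 0" using ne by simp
    fix l :: real assume l: "\<bar>l\<bar> < 1 / 2"
    have "midpoint a b + l *\<^sub>R (b - a) = (1 - (1 / 2 + l)) *\<^sub>R a + (1 / 2 + l) *\<^sub>R b"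
      by (simp add: midpoint_def algebra_simps flip: scaleR_add_left)
    moreover have "0 < 1 / 2 + l" "1 / 2 + l < 1" using l by (auto simp: abs_less_iff)
    ultimately have "midpoint a b + l *\<^sub>R (b - a) \<in> K" using ne unfolding ab(1) in_segment by blast
    then show "midpoint a b + l *\<^sub>R (b - a) \<in> \<Gamma>0 \<inter> frontier \<Omega>" using K ab by blast
  qed
qed

theorem theorem11:
  fixes \<Omega> \<Gamma>0 :: "point set" and p q :: real
  assumes "polygonal_domain \<Omega>" and "lipschitz_domain \<Omega>"
    and "\<Gamma>0 \<subseteq> frontier \<Omega>" and "length_measure \<Gamma>0 > 0"
    and "1 \<le> p \<and> p < 2 \<and> 1 \<le> q \<and> q \<le> 2 * p / (2 - p) \<or> 2 \<le> p \<and> 1 \<le> q"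
  shows "\<exists>C>0. \<forall>T \<alpha> \<zeta>. ddfv_mesh \<Omega> T \<and> compatible \<Omega> \<Gamma>0 T \<and> R1 T \<alpha> \<and> R2 T \<zeta> \<longrightarrow>
           (\<forall>u\<in>Z_space \<Omega> \<Gamma>0 T.
              norm_0 \<Omega> T q u \<le> C / (sin \<alpha> powr (1 / p) * \<zeta> powr ((p - 1) / p)) * seminorm_1 T p u)"
proof (cases "\<exists>T. ddfv_mesh \<Omega> T \<and> compatible \<Omega> \<Gamma>0 T")
  case False
  then show ?thesis by (intro exI[of _ 1]) auto
next
  case True
  then obtain T0 where T0: "ddfv_mesh \<Omega> T0" "compatible \<Omega> \<Gamma>0 T0" by blast
  have op: "open \<Omega>" and bnd: "bounded \<Omega>" using assms(1) by (auto simp: polygonal_domain_def)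
  have p: "1 \<le> p" and q: "1 \<le> q" using assms(5) by auto
  obtain x w where w: "w \<noteq> 0" "\<And>l. \<bar>l\<bar> < 1 / 2 \<Longrightarrow> x + l *\<^sub>R w \<in> \<Gamma>0 \<inter> frontier \<Omega>"
    using boundary_segment_exists[OF assms(4) T0] by metis
  \<comment> \<open>\<open>Z\<close> is fixed by one mesh \<open>T0\<close>; from here on only \<open>Z\<close> and
    \<open>\<Omega>\<close> enter the constant.\<close>
  define Z where "Z = {x + l *\<^sub>R w | l. \<bar>l\<bar> < 1 / 2} \<inter> {y. flat_point \<Omega> y}"
  have Z: "Z \<subseteq> \<Gamma>0" "\<And>y. y \<in> Z \<Longrightarrow> flat_point \<Omega> y" using w(2) by (auto simp: Z_def)
  have "sobolev_set \<Omega> Z \<Omega>"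
    using w(2) by (intro sobolev_domain[OF assms(2) bnd w(1) _ _ Z_def]) auto
  then obtain C0 where C0: "C0 > 0" and sob: "\<And>v E. step_function \<Omega> Z v E \<Longrightarrow>
      (\<integral>\<^sup>+ z. ennreal ((v z)\<^sup>2) * indicator \<Omega> z \<partial>lborel) \<le> ennreal ((C0 * total_variation E)\<^sup>2)"
    unfolding sobolev_set_def by blast
  define C where "C = Lq_constant p q (measure lebesgue \<Omega>) C0"
  have C: "C > 0" unfolding C_def by (rule Lq_constant_pos[OF assms(5) _ C0]) simp
  show ?thesis
  proof (intro exI[of _ "2 * C"] conjI allI impI ballI)
    show "2 * C > 0" using C by simp
    fix T \<alpha> \<zeta> u
    assume "ddfv_mesh \<Omega> T \<and> compatible \<Omega> \<Gamma>0 T \<and> R1 T \<alpha> \<and> R2 T \<zeta>" and u: "u \<in> Z_space \<Omega> \<Gamma>0 T"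
    then have mesh: "ddfv_mesh \<Omega> T" and comp: "compatible \<Omega> \<Gamma>0 T" and R1: "R1 T \<alpha>" and R2: "R2 T \<zeta>" by auto
    interpret ddfv \<Omega> T by unfold_locales (fact op, fact bnd, fact mesh)
    have \<zeta>: "\<zeta> > 0" using R2 by (simp add: R2_def)
    have grad: "0 < sin (diamond_angle T d)" if "d \<in> diamonds T" for d
      using sin_angle_bounds[OF R1 that] by linarith
    define R where "R = 2 * (seminorm_1 T p u / (sin \<alpha> powr (1 / p) * \<zeta> powr ((p - 1) / p)))"
    have R0: "0 \<le> R" by (simp add: R_def seminorm_1_def)
    have f: "(\<lambda>t. \<bar>t\<bar> powr s) \<in> borel_measurable borel" "\<bar>0 :: real\<bar> powr s = 0" for s :: real by auto
    have X: "(\<Sum>K\<in>primal T. measure lebesgue K * \<bar>at_primal u K\<bar> powr q) \<le> (C * R) powr q"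
      unfolding C_def R_def
    proof (rule cell_Lq_bound[OF assms(5) C0 sob _ primal_partition _ _ _ _ R1 \<zeta>, where l = "dual_edge_length T"])
      show "step_function \<Omega> Z (\<lambda>x. \<bar>cell_fun (primal T) (\<lambda>K. K) (at_primal u) x\<bar> powr s)
          ((\<lambda>d. (vertK d, vertL d, \<bar>at_primal u (cellK d)\<bar> powr s, \<bar>at_primal u (cellL d)\<bar> powr s)) ` primal_jump_diamonds u)" for s
        using step_function_primal[OF comp u Z f(1,2), of s] by (simp add: primal_fun_eq)
    qed (use weighted_primal_sum[OF R2] lengths_positive gradient_components(1) grad in
          \<open>auto simp: primal_jump_diamonds_def edge_length_def\<close>)
    have Y: "(\<Sum>v\<in>vertices T. measure lebesgue (dual_cell T v) * \<bar>at_dual u v\<bar> powr q) \<le> (C * R) powr q"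
      unfolding C_def R_def
    proof (rule cell_Lq_bound[OF assms(5) C0 sob _ dual_partition order_refl _ _ _ R1 \<zeta>, where l = edge_length])
      show "step_function \<Omega> Z (\<lambda>x. \<bar>cell_fun (vertices T) (dual_cell T) (at_dual u) x\<bar> powr s)
          ((\<lambda>d. (center T (cellK d), center T (cellL d), \<bar>at_dual u (vertK d)\<bar> powr s, \<bar>at_dual u (vertL d)\<bar> powr s)) ` diamonds T)" for s
        using step_function_dual[OF comp u Z f(1,2), of s] by (simp add: dual_fun_eq)
    qed (use weighted_dual_sum[OF R2] lengths_positive gradient_components(2) grad in
          \<open>auto simp: dual_edge_length_def\<close>)
    have "norm_0 \<Omega> T q u = ((\<Sum>K\<in>primal T. measure lebesgue K * \<bar>at_primal u K\<bar> powr q) / 2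
        + (\<Sum>v\<in>vertices T. measure lebesgue (dual_cell T v) * \<bar>at_dual u v\<bar> powr q) / 2) powr (1 / q)"
      unfolding norm_0_def primal_fun_eq dual_fun_eq
      using Lp_norm_cell_fun[OF primal_partition bnd, of q] Lp_norm_cell_fun[OF dual_partition bnd, of q] q by simp
    also have "\<dots> \<le> ((C * R) powr q) powr (1 / q)"
      using X Y q by (intro powr_mono2) (auto intro!: add_nonneg_nonneg divide_nonneg_nonneg sum_nonneg)
    also have "\<dots> = C * R" using C R0 q by (simp add: powr_powr)
    also have "\<dots> = 2 * C / (sin \<alpha> powr (1 / p) * \<zeta> powr ((p - 1) / p)) * seminorm_1 T p u"
      by (simp add: R_def)
    finally show "norm_0 \<Omega> T q u \<le> 2 * C / (sin \<alpha> powr (1 / p) * \<zeta> powr ((p - 1) / p)) * seminorm_1 T p u" .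
  qed
qed

end
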